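(* Let $\{Y_t\}_{t\in[0,T]}$ be a complex-valued stochastic process such that for each $t\in[0,T]$, $Y_t\in L^2(\Omega,\sigma(X_t),P)$ and $Y_t$ belongs to the domains of $D_t$, $D_t^*$, $D_tD_t^*$ and $D_t^*D_t$. Let $g,\tilde g:[0,T]\to\mathbb R$ be Borel measurable, and assume the measurability and square-integrability conditions needed for the stochastic integrals below to exist (as It\^o integrals with respect to $X$). Then $$E\Big[\Big|\int_0^T (X_t-g(t))Y_t\,dX_t\Big|^2\Big]^{1/2}\,E\Big[\Big|\int_0^T (X_t-\tilde g(t))\,\mathcal GY_t\,dX_t\Big|^2\Big]^{1/2}\ \ge\ E\Big[\int_0^T |Y_t|^2\langle X\rangle_t\,d\langle X\rangle_t\Big].$$ The same holds with $\int_0^T$ replaced by $\int_0^\infty$ (when $I=[0,\infty)$).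
   Context: Let $(\Omega,\mathcal F,P)$ be a probability space with a filtration $\{\mathcal F_t\}_{t\in I}$, where $I=[0,T]$ for some $T>0$ or $I=[0,\infty)$. Let $\{X_t\}_{t\in I}$ be a real-valued, square integrable, continuous martingale adapted to $\{\mathcal F_t\}$, with $X_0=0$ a.s., whose quadratic variation $\langle X\rangle_t$ is deterministic. For $c\in\mathbb C$ and $t\in I$ define $\mathcal E_{c,t}:=\exp\!\big(cX_t-\tfrac12 c^2\langle X\rangle_t\big)$. Let $V_t$ be the complex linear span of $\{\mathcal E_{c,t}:c\in\mathbb C\}$ and $\mathcal H_t$ its closure in $L^2(\Omega,\mathcal F,P)$ (which equals $L^2(\Omega,\sigma(X_t),P)$), with inner product $\langle U,V\rangle=E[U\overline V]$. Let $\mathcal H$ be the closure in $L^2(\Omega,\mathcal F,P)$ of the span of all $\mathcal E_{c,t}$, $c\in\mathbb C$, $t\in I$, and let $\mathcal G:\mathcal H\to\mathcal H$ be the unique unitary operator with $\mathcal G\mathcal E_{c,t}=\mathcal E_{-ic,t}$. The differential operator $D_t$ is defined on $V_t$ by $D_t\mathcal E_{c,t}=c\langle X\rangle_t\mathcal E_{c,t}$ (extended linearly); $D_t$ also denotes its closure (a closed operator in $\mathcal H_t$), and $D_t^*$ is its adjoint in $\mathcal H_t$. *)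

theory Defs
  imports "HOL-Probability.Probability"
begin

definition filtration_on :: "'a measure \<Rightarrow> real set \<Rightarrow> (real \<Rightarrow> 'a measure) \<Rightarrow> bool" where
  "filtration_on M I F \<longleftrightarrow>
     (\<forall>t\<in>I. subalgebra M (F t)) \<and> (\<forall>s\<in>I. \<forall>t\<in>I. s \<le> t \<longrightarrow> sets (F s) \<subseteq> sets (F t))"

definition martingale_on :: "'a measure \<Rightarrow> real set \<Rightarrow> (real \<Rightarrow> 'a measure) \<Rightarrow> (real \<Rightarrow> 'a \<Rightarrow> real) \<Rightarrow> bool" where
  "martingale_on M I F Z \<longleftrightarrow>
     (\<forall>t\<in>I. Z t \<in> borel_measurable (F t) \<and> integrable M (Z t)) \<and>
     (\<forall>s\<in>I. \<forall>t\<in>I. s \<le> t \<longrightarrow> (AE \<omega> in M. real_cond_exp M (F s) (Z t) \<omega> = Z s \<omega>))"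

text \<open>X is a real, square integrable, continuous martingale with X_0 = 0 a.s.,
  and its quadratic variation is the deterministic function A: A is continuous,
  nondecreasing, A 0 = 0 (A is taken on all of the reals, constant 0 for t \<le> 0),
  and X_t^2 - A t is a martingale (Doob--Meyer characterisation of the
  quadratic variation).\<close>

definition cont_mart_det_qv ::
  "'a measure \<Rightarrow> real set \<Rightarrow> (real \<Rightarrow> 'a measure) \<Rightarrow> (real \<Rightarrow> 'a \<Rightarrow> real) \<Rightarrow> (real \<Rightarrow> real) \<Rightarrow> bool" where
  "cont_mart_det_qv M I F X A \<longleftrightarrow>
     prob_space M \<and> filtration_on M I F \<and>
     martingale_on M I F X \<and>
     (\<forall>t\<in>I. integrable M (\<lambda>\<omega>. (X t \<omega>)\<^sup>2)) \<and>
     (AE \<omega> in M. continuous_on I (\<lambda>t. X t \<omega>)) \<and>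
     (AE \<omega> in M. X 0 \<omega> = 0) \<and>
     mono A \<and> continuous_on UNIV A \<and> (\<forall>t\<le>0. A t = 0) \<and>
     martingale_on M I F (\<lambda>t \<omega>. (X t \<omega>)\<^sup>2 - A t)"

definition L2 :: "'a measure \<Rightarrow> ('a \<Rightarrow> complex) set" where
  "L2 M = {f. f \<in> borel_measurable M \<and> integrable M (\<lambda>\<omega>. (cmod (f \<omega>))\<^sup>2)}"

definition l2conv :: "'a measure \<Rightarrow> (nat \<Rightarrow> 'a \<Rightarrow> complex) \<Rightarrow> ('a \<Rightarrow> complex) \<Rightarrow> bool" where
  "l2conv M u f \<longleftrightarrow> (\<forall>n. u n \<in> L2 M) \<and> f \<in> L2 M \<and>
     (\<lambda>n. \<integral>\<omega>. (cmod (u n \<omega> - f \<omega>))\<^sup>2 \<partial>M) \<longlonglongrightarrow> 0"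

definition l2inner :: "'a measure \<Rightarrow> ('a \<Rightarrow> complex) \<Rightarrow> ('a \<Rightarrow> complex) \<Rightarrow> complex" where
  "l2inner M U V = (\<integral>\<omega>. U \<omega> * cnj (V \<omega>) \<partial>M)"

definition expm :: "(real \<Rightarrow> 'a \<Rightarrow> real) \<Rightarrow> (real \<Rightarrow> real) \<Rightarrow> complex \<Rightarrow> real \<Rightarrow> 'a \<Rightarrow> complex" where
  "expm X A c t \<omega> = exp (c * complex_of_real (X t \<omega>) - c\<^sup>2 * complex_of_real (A t) / 2)"

definition Vspan :: "(real \<Rightarrow> 'a \<Rightarrow> real) \<Rightarrow> (real \<Rightarrow> real) \<Rightarrow> real \<Rightarrow> ('a \<Rightarrow> complex) set" where
  "Vspan X A t = {(\<lambda>\<omega>. \<Sum>i<(n::nat). (a::nat\<Rightarrow>complex) i * expm X A (c i) t \<omega>) | n a c. True}"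

definition Hspace :: "'a measure \<Rightarrow> (real \<Rightarrow> 'a \<Rightarrow> real) \<Rightarrow> (real \<Rightarrow> real) \<Rightarrow> real \<Rightarrow> ('a \<Rightarrow> complex) set" where
  "Hspace M X A t = {Y. \<exists>u. (\<forall>n. u n \<in> Vspan X A t) \<and> l2conv M u Y}"

definition D0_graph :: "(real \<Rightarrow> 'a \<Rightarrow> real) \<Rightarrow> (real \<Rightarrow> real) \<Rightarrow> real \<Rightarrow> (('a \<Rightarrow> complex) \<times> ('a \<Rightarrow> complex)) set" where
  "D0_graph X A t = {((\<lambda>\<omega>. \<Sum>i<(n::nat). (a::nat\<Rightarrow>complex) i * expm X A (c i) t \<omega>),
                      (\<lambda>\<omega>. \<Sum>i<(n::nat). a i * (c::nat\<Rightarrow>complex) i * complex_of_real (A t) * expm X A (c i) t \<omega>)) | n a c. True}"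

definition D_graph :: "'a measure \<Rightarrow> (real \<Rightarrow> 'a \<Rightarrow> real) \<Rightarrow> (real \<Rightarrow> real) \<Rightarrow> real \<Rightarrow> (('a \<Rightarrow> complex) \<times> ('a \<Rightarrow> complex)) set" where
  "D_graph M X A t = {(Y, Z). \<exists>u v. (\<forall>n. (u n, v n) \<in> D0_graph X A t) \<and> l2conv M u Y \<and> l2conv M v Z}"

definition Dstar_graph :: "'a measure \<Rightarrow> (real \<Rightarrow> 'a \<Rightarrow> real) \<Rightarrow> (real \<Rightarrow> real) \<Rightarrow> real \<Rightarrow> (('a \<Rightarrow> complex) \<times> ('a \<Rightarrow> complex)) set" where
  "Dstar_graph M X A t = {(V, W). V \<in> Hspace M X A t \<and> W \<in> Hspace M X A t \<and>
      (\<forall>(U, Z) \<in> D_graph M X A t. l2inner M Z V = l2inner M U W)}"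

definition dom_D :: "'a measure \<Rightarrow> (real \<Rightarrow> 'a \<Rightarrow> real) \<Rightarrow> (real \<Rightarrow> real) \<Rightarrow> real \<Rightarrow> ('a \<Rightarrow> complex) set" where
  "dom_D M X A t = Domain (D_graph M X A t)"

definition dom_Dstar :: "'a measure \<Rightarrow> (real \<Rightarrow> 'a \<Rightarrow> real) \<Rightarrow> (real \<Rightarrow> real) \<Rightarrow> real \<Rightarrow> ('a \<Rightarrow> complex) set" where
  "dom_Dstar M X A t = Domain (Dstar_graph M X A t)"

definition dom_D_Dstar :: "'a measure \<Rightarrow> (real \<Rightarrow> 'a \<Rightarrow> real) \<Rightarrow> (real \<Rightarrow> real) \<Rightarrow> real \<Rightarrow> ('a \<Rightarrow> complex) set" where
  "dom_D_Dstar M X A t = {Y. \<exists>W. (Y, W) \<in> Dstar_graph M X A t \<and> W \<in> dom_D M X A t}"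

definition dom_Dstar_D :: "'a measure \<Rightarrow> (real \<Rightarrow> 'a \<Rightarrow> real) \<Rightarrow> (real \<Rightarrow> real) \<Rightarrow> real \<Rightarrow> ('a \<Rightarrow> complex) set" where
  "dom_Dstar_D M X A t = {Y. \<exists>Z. (Y, Z) \<in> D_graph M X A t \<and> Z \<in> dom_Dstar M X A t}"

definition G0_graph :: "real set \<Rightarrow> (real \<Rightarrow> 'a \<Rightarrow> real) \<Rightarrow> (real \<Rightarrow> real) \<Rightarrow> (('a \<Rightarrow> complex) \<times> ('a \<Rightarrow> complex)) set" where
  "G0_graph I X A = {((\<lambda>\<omega>. \<Sum>i<(n::nat). (a::nat\<Rightarrow>complex) i * expm X A (c i) (s i) \<omega>),
                      (\<lambda>\<omega>. \<Sum>i<(n::nat). (a::nat\<Rightarrow>complex) i * expm X A (- \<i> * c i) (s i) \<omega>)) | n a c s. \<forall>i<n. s i \<in> I}"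

definition G_graph :: "'a measure \<Rightarrow> real set \<Rightarrow> (real \<Rightarrow> 'a \<Rightarrow> real) \<Rightarrow> (real \<Rightarrow> real) \<Rightarrow> (('a \<Rightarrow> complex) \<times> ('a \<Rightarrow> complex)) set" where
  "G_graph M I X A = {(Y, Z). \<exists>u v. (\<forall>n. (u n, v n) \<in> G0_graph I X A) \<and> l2conv M u Y \<and> l2conv M v Z}"

definition simple_proc :: "'a measure \<Rightarrow> real set \<Rightarrow> (real \<Rightarrow> 'a measure) \<Rightarrow> nat \<Rightarrow> (nat \<Rightarrow> real) \<Rightarrow> (nat \<Rightarrow> 'a \<Rightarrow> complex) \<Rightarrow> bool" where
  "simple_proc M I F n \<tau> \<xi> \<longleftrightarrow> \<tau> 0 = 0 \<and> (\<forall>i<n. \<tau> i < \<tau> (Suc i)) \<and> (\<forall>i\<le>n. \<tau> i \<in> I) \<and>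
     (\<forall>i<n. \<xi> i \<in> borel_measurable (F (\<tau> i)) \<and> (\<exists>B. \<forall>\<omega>\<in>space M. cmod (\<xi> i \<omega>) \<le> B))"

definition simple_val :: "nat \<Rightarrow> (nat \<Rightarrow> real) \<Rightarrow> (nat \<Rightarrow> 'a \<Rightarrow> complex) \<Rightarrow> real \<Rightarrow> 'a \<Rightarrow> complex" where
  "simple_val n \<tau> \<xi> t \<omega> = (\<Sum>i<n. \<xi> i \<omega> * indicator {\<tau> i<..\<tau> (Suc i)} t)"

definition simple_int :: "(real \<Rightarrow> 'a \<Rightarrow> real) \<Rightarrow> nat \<Rightarrow> (nat \<Rightarrow> real) \<Rightarrow> (nat \<Rightarrow> 'a \<Rightarrow> complex) \<Rightarrow> 'a \<Rightarrow> complex" where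
  "simple_int X n \<tau> \<xi> \<omega> = (\<Sum>i<n. \<xi> i \<omega> * complex_of_real (X (\<tau> (Suc i)) \<omega> - X (\<tau> i) \<omega>))"

definition ito_integral ::
  "'a measure \<Rightarrow> real set \<Rightarrow> (real \<Rightarrow> 'a measure) \<Rightarrow> (real \<Rightarrow> 'a \<Rightarrow> real) \<Rightarrow> (real \<Rightarrow> real)
   \<Rightarrow> (real \<Rightarrow> 'a \<Rightarrow> complex) \<Rightarrow> ('a \<Rightarrow> complex) \<Rightarrow> bool" where
  "ito_integral M I F X A H J \<longleftrightarrow>
     (\<lambda>(\<omega>, t). H t \<omega>) \<in> borel_measurable (M \<Otimes>\<^sub>M borel) \<and>
     (\<exists>ns \<tau>s \<xi>s. (\<forall>k. simple_proc M I F (ns k) (\<tau>s k) (\<xi>s k)) \<and>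
        (\<lambda>k. \<integral>\<^sup>+\<omega>. (\<integral>\<^sup>+t\<in>I. ennreal ((cmod (simple_val (ns k) (\<tau>s k) (\<xi>s k) t \<omega> - H t \<omega>))\<^sup>2)
                 \<partial>interval_measure A) \<partial>M) \<longlonglongrightarrow> 0 \<and>
        l2conv M (\<lambda>k. simple_int X (ns k) (\<tau>s k) (\<xi>s k)) J)"

end

theory Submission
  imports Defs "HOL-Real_Asymp.Real_Asymp"
begin

text \<open>
  By Levy's theorem \<open>X\<close> is a Gaussian process with independent increments. It is proved by expanding
  \<open>exp (\<i> u X + u\<^sup>2 A / 2)\<close> along dyadic grids, stopped after the first increment exceeding \<open>\<epsilon>\<close>; the
  overshoot vanishes in the limit by path continuity and Doob's maximal inequality.
  Consequently the inner product of \<open>E_{c,s}\<close> and \<open>E_{d,t}\<close> is \<open>exp (c * cnj d * A (min s t))\<close>, which is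
  invariant under \<open>c \<mapsto> - \<i> c\<close>, \<open>d \<mapsto> - \<i> d\<close>, so that the Fourier transform \<open>G\<close> is isometric.
  On the span at a fixed time \<open>t\<close> one has \<open>D* = X - D\<close>, \<open>[D, D*] = A t\<close>, and
  \<open>norm ((X - h) G u) = norm (\<i> (D* - D) u - h u)\<close>; the Heisenberg argument for the symmetric operators
  \<open>D + D* - g\<close> and \<open>\<i> (D* - D) - h\<close> then gives
  \<open>A t * (norm u)\<^sup>2 \<le> norm ((X - g) u) * norm ((X - h) G u)\<close>.
  Multiplication by \<open>X\<close> is controlled by the graph norm of \<open>D\<close>, so the inequality extends to the domain
  of the closure. The Ito isometry and the Cauchy-Schwarz inequality in \<open>t\<close> finish the proof.
\<close>

text \<open>Only second moments of \<open>X\<close> are given at the start, so the cubic bound on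
  the Taylor remainder of an exponential need not be integrable, and an exponential has
  deterministic modulus only at a parameter \<open>\<i> * u\<close> with \<open>u\<close> real.
  Hence the exponential martingale is proved for these parameters; complex ones enter once the law
  of the increments is known. From then on inner products are explicit Gaussian integrals, and
  operator identities on the span become polynomial identities in \<open>c\<close> and
  \<open>cnj d\<close>, extended from pairs of exponentials. A second obstacle:
  \<open>D_graph\<close> and \<open>G_graph\<close> supply two unrelated approximating sequences for
  \<open>Y t\<close>, the latter with mixed times. The isometry on combinations over arbitrary times
  allows the transform to be computed along the first sequence. Elements of \<open>L2\<close> are
  functions, not classes, so products with \<open>X t\<close> exist pointwise and only their square
  integrability has to be established.\<close>

lemma integrable_mult_of_square_integrable:
  fixes f g :: "'a \<Rightarrow> 'b::{real_normed_div_algebra, banach, second_countable_topology}"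
  assumes [measurable]: "f \<in> borel_measurable M" "g \<in> borel_measurable M"
    and "integrable M (\<lambda>x. (norm (f x))\<^sup>2)" "integrable M (\<lambda>x. (norm (g x))\<^sup>2)"
  shows "integrable M (\<lambda>x. f x * g x)"
proof (rule Bochner_Integration.integrable_bound)
  show "integrable M (\<lambda>x. (norm (f x))\<^sup>2 + (norm (g x))\<^sup>2)"
    using assms by simp
  have "norm (f x * g x) \<le> norm ((norm (f x))\<^sup>2 + (norm (g x))\<^sup>2)" for x
  proof -
    have "0 \<le> norm (f x) * norm (g x)" by simp
    with sum_squares_bound[of "norm (f x)" "norm (g x)"]
    have "norm (f x) * norm (g x) \<le> (norm (f x))\<^sup>2 + (norm (g x))\<^sup>2" by linarith
    then show ?thesis by (simp add: norm_mult)
  qed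
  then show "AE x in M. norm (f x * g x) \<le> norm ((norm (f x))\<^sup>2 + (norm (g x))\<^sup>2)" by simp
qed measurable

section \<open>Complex weights against martingale increments\<close>

lemma cnj_measurable [measurable (raw)]:
  "f \<in> borel_measurable M \<Longrightarrow> (\<lambda>x. cnj (f x)) \<in> borel_measurable M"
  by (intro borel_measurable_continuous_on[of cnj]) (auto intro: continuous_intros)

text \<open>The conditional expectation in \<open>martingale_on\<close> is real, so the weight is
  split into real and imaginary part. Only the product with \<open>Z t\<close> has to be integrable,
  which admits unbounded weights; integrability of the product at the earlier time is part of the
  conclusion.\<close>

lemma martingale_on_integral_eq:
  fixes Z :: "real \<Rightarrow> 'a \<Rightarrow> real" and \<eta> :: "'a \<Rightarrow> complex"
  assumes "prob_space M" "filtration_on M I F" "martingale_on M I F Z"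
    and st: "s \<in> I" "t \<in> I" "s \<le> t"
    and \<eta>: "\<eta> \<in> borel_measurable (F s)"
    and int: "integrable M (\<lambda>\<omega>. \<eta> \<omega> * complex_of_real (Z t \<omega>))"
  shows "integrable M (\<lambda>\<omega>. \<eta> \<omega> * complex_of_real (Z s \<omega>))" (is ?thesis1)
    and "(\<integral>\<omega>. \<eta> \<omega> * complex_of_real (Z t \<omega>) \<partial>M) = (\<integral>\<omega>. \<eta> \<omega> * complex_of_real (Z s \<omega>) \<partial>M)" (is ?thesis2)
proof -
  interpret prob_space M by fact
  have sub: "subalgebra M (F s)" "subalgebra M (F t)"
    using assms by (auto simp: filtration_on_def)
  interpret finite_measure_subalgebra M "F s"
    by unfold_locales (use sub in auto)
  have Zt: "Z t \<in> borel_measurable M" and Zs: "Z s \<in> borel_measurable M"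
    using assms(3) st by (auto simp: martingale_on_def)
  have ce: "AE \<omega> in M. real_cond_exp M (F s) (Z t) \<omega> = Z s \<omega>"
    using assms(3) st by (auto simp: martingale_on_def)
  have ce_meas [measurable]: "real_cond_exp M (F s) (Z t) \<in> borel_measurable M"
    using borel_measurable_cond_exp2 by simp
  note [measurable] = Zt Zs
  have real: "integrable M (\<lambda>\<omega>. h \<omega> * Z s \<omega>) \<and> (\<integral>\<omega>. h \<omega> * Z t \<omega> \<partial>M) = (\<integral>\<omega>. h \<omega> * Z s \<omega> \<partial>M)"
    if hF: "h \<in> borel_measurable (F s)" and hi: "integrable M (\<lambda>\<omega>. h \<omega> * Z t \<omega>)" for h
  proof -
    have [measurable]: "h \<in> borel_measurable M"
      using measurable_from_subalg[OF sub(1) hF] .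
    note r = real_cond_exp_intg[OF hi hF Zt]
    have ae: "AE \<omega> in M. h \<omega> * real_cond_exp M (F s) (Z t) \<omega> = h \<omega> * Z s \<omega>"
      using ce by eventually_elim simp
    have "integrable M (\<lambda>\<omega>. h \<omega> * Z s \<omega>)"
      using r(1) by (subst integrable_cong_AE[symmetric, OF _ _ ae]) auto
    moreover have "(\<integral>\<omega>. h \<omega> * real_cond_exp M (F s) (Z t) \<omega> \<partial>M) = (\<integral>\<omega>. h \<omega> * Z s \<omega> \<partial>M)"
      by (rule integral_cong_AE) (use ae in auto)
    ultimately show ?thesis using r(2) by simp
  qed
  have ReI: "integrable M (\<lambda>\<omega>. Re (\<eta> \<omega>) * Z t \<omega>)" "integrable M (\<lambda>\<omega>. Im (\<eta> \<omega>) * Z t \<omega>)"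
    using integrable_Re[OF int] integrable_Im[OF int] by simp_all
  have RR: "(\<lambda>\<omega>. Re (\<eta> \<omega>)) \<in> borel_measurable (F s)" "(\<lambda>\<omega>. Im (\<eta> \<omega>)) \<in> borel_measurable (F s)"
    using \<eta> by measurable
  note a = real[OF RR(1) ReI(1)] real[OF RR(2) ReI(2)]
  have [measurable]: "\<eta> \<in> borel_measurable M"
    using measurable_from_subalg[OF sub(1) \<eta>] .
  show i1: ?thesis1
  proof -
    have "integrable M (\<lambda>\<omega>. complex_of_real (Re (\<eta> \<omega>) * Z s \<omega>) + \<i> * complex_of_real (Im (\<eta> \<omega>) * Z s \<omega>))"
      using a by (intro Bochner_Integration.integrable_add integrable_mult_right integrable_of_real) simp_all
    moreover have "complex_of_real (Re z * x) + \<i> * complex_of_real (Im z * x) = z * complex_of_real x" for z x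
      by (simp add: complex_eq_iff)
    ultimately show ?thesis by simp
  qed
  show ?thesis2
    using a integral_Re[OF int] integral_Im[OF int] integral_Re[OF i1] integral_Im[OF i1]
    by (intro complex_eqI) simp_all
qed

text \<open>Both horizons are covered by three properties of \<open>I\<close>: it contains the
  segment between any two of its points, it contains 0, and it has no negative element.\<close>

locale det_qv_martingale =
  fixes M :: "'a measure" and I :: "real set" and F :: "real \<Rightarrow> 'a measure"
    and X :: "real \<Rightarrow> 'a \<Rightarrow> real" and A :: "real \<Rightarrow> real"
  assumes setting: "cont_mart_det_qv M I F X A"
    and I_Icc: "s \<in> I \<Longrightarrow> t \<in> I \<Longrightarrow> {s..t} \<subseteq> I"
    and I_zero: "0 \<in> I" and I_nonneg: "t \<in> I \<Longrightarrow> 0 \<le> t"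
begin

sublocale prob_space M
  using setting by (simp add: cont_mart_det_qv_def)

lemma filtration: "filtration_on M I F"
  and mart: "martingale_on M I F X"
  and mart2: "martingale_on M I F (\<lambda>t \<omega>. (X t \<omega>)\<^sup>2 - A t)"
  and X_sq: "t \<in> I \<Longrightarrow> integrable M (\<lambda>\<omega>. (X t \<omega>)\<^sup>2)"
  and X_cont: "AE \<omega> in M. continuous_on I (\<lambda>t. X t \<omega>)"
  and X_zero: "AE \<omega> in M. X 0 \<omega> = 0"
  and A_mono: "mono A" and A_cont: "continuous_on UNIV A" and A_nonpos: "t \<le> 0 \<Longrightarrow> A t = 0"
  using setting by (auto simp: cont_mart_det_qv_def)

lemma A_nonneg: "0 \<le> A t"
  using A_nonpos[of "min t 0"] monoD[OF A_mono, of "min t 0" t] by simp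

lemma subalg: "t \<in> I \<Longrightarrow> subalgebra M (F t)"
  using filtration by (auto simp: filtration_on_def)

lemma measurable_F_mono:
  assumes "s \<in> I" "t \<in> I" "s \<le> t" "f \<in> measurable (F s) N"
  shows "f \<in> measurable (F t) N"
proof (rule measurable_from_subalg[OF _ assms(4)])
  show "subalgebra (F t) (F s)"
    using filtration subalg[of s] subalg[of t] assms by (auto simp: filtration_on_def subalgebra_def)
qed

lemma measurable_F_M: "t \<in> I \<Longrightarrow> f \<in> measurable (F t) N \<Longrightarrow> f \<in> measurable M N"
  using measurable_from_subalg subalg by blast

lemma X_F: "t \<in> I \<Longrightarrow> X t \<in> borel_measurable (F t)"
  using mart by (auto simp: martingale_on_def)

lemma X_M [measurable]: "t \<in> I \<Longrightarrow> X t \<in> borel_measurable M"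
  using X_F measurable_F_M by blast

lemma incr_sq_integrable:
  assumes "s \<in> I" "t \<in> I"
  shows "integrable M (\<lambda>\<omega>. (X t \<omega> - X s \<omega>)\<^sup>2)"
proof (rule Bochner_Integration.integrable_bound)
  show "integrable M (\<lambda>\<omega>. 2 * (X t \<omega>)\<^sup>2 + 2 * (X s \<omega>)\<^sup>2)"
    using X_sq assms by simp
  have "(x - y)\<^sup>2 \<le> 2 * x\<^sup>2 + 2 * y\<^sup>2" for x y :: real
    using zero_le_power2[of "x + y"] by (simp add: power2_eq_square algebra_simps)
  then show "AE \<omega> in M. norm ((X t \<omega> - X s \<omega>)\<^sup>2) \<le> norm (2 * (X t \<omega>)\<^sup>2 + 2 * (X s \<omega>)\<^sup>2)" by simp
qed (use assms in measurable)

text \<open>The \<open>F s\<close>-measurable factor is pulled out of the conditional expectation.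
  The weight is square integrable rather than bounded, because it will be a running maximum in
  Doob's inequality and an earlier increment in the Ito isometry.\<close>

lemma integral_incr_zero:
  assumes st: "s \<in> I" "t \<in> I" "s \<le> t" and \<eta>: "\<eta> \<in> borel_measurable (F s)"
    and sq: "integrable M (\<lambda>\<omega>. (cmod (\<eta> \<omega>))\<^sup>2)"
  shows "integrable M (\<lambda>\<omega>. \<eta> \<omega> * complex_of_real (X t \<omega> - X s \<omega>))"
    and "(\<integral>\<omega>. \<eta> \<omega> * complex_of_real (X t \<omega> - X s \<omega>) \<partial>M) = 0"
proof -
  have [measurable]: "\<eta> \<in> borel_measurable M" using measurable_F_M st \<eta> by blast
  note [measurable] = X_M[OF st(1)] X_M[OF st(2)]
  have int: "integrable M (\<lambda>\<omega>. \<eta> \<omega> * complex_of_real (X t \<omega>))"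
    by (rule integrable_mult_of_square_integrable) (use sq X_sq st in auto)
  note * = martingale_on_integral_eq[OF prob_space_axioms filtration mart st \<eta> int]
  show "integrable M (\<lambda>\<omega>. \<eta> \<omega> * complex_of_real (X t \<omega> - X s \<omega>))"
    using int *(1) by (simp add: algebra_simps)
  show "(\<integral>\<omega>. \<eta> \<omega> * complex_of_real (X t \<omega> - X s \<omega>) \<partial>M) = 0"
    using int * by (simp add: algebra_simps)
qed

text \<open>The squared increment is \<open>((X t)^2 - A t) - ((X s)^2 - A s) - 2 * X s * (X t - X
  s) + (A t - A s)\<close>. The two compensated squares cancel in the mean and the mixed term
  vanishes by \<open>integral_incr_zero\<close>. Boundedness of the weight makes
  \<open>\<eta> * X s\<close> square integrable.\<close>

lemma integral_incr_square:
  assumes st: "s \<in> I" "t \<in> I" "s \<le> t" and \<eta>: "\<eta> \<in> borel_measurable (F s)"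
    and bd: "\<And>\<omega>. \<omega> \<in> space M \<Longrightarrow> cmod (\<eta> \<omega>) \<le> B"
  shows "integrable M (\<lambda>\<omega>. \<eta> \<omega> * complex_of_real ((X t \<omega> - X s \<omega>)\<^sup>2))"
    and "(\<integral>\<omega>. \<eta> \<omega> * complex_of_real ((X t \<omega> - X s \<omega>)\<^sup>2) \<partial>M) = (\<integral>\<omega>. \<eta> \<omega> \<partial>M) * complex_of_real (A t - A s)"
proof -
  have [measurable]: "\<eta> \<in> borel_measurable M" using measurable_F_M st \<eta> by blast
  note [measurable] = X_M[OF st(1)] X_M[OF st(2)]
  have bdd: "integrable M (\<lambda>\<omega>. \<eta> \<omega> * complex_of_real (h \<omega>))" if h: "integrable M h" for h :: "'a \<Rightarrow> real"
  proof (rule Bochner_Integration.integrable_bound)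
    show "integrable M (\<lambda>\<omega>. B * h \<omega>)" using h by simp
    show "AE \<omega> in M. norm (\<eta> \<omega> * complex_of_real (h \<omega>)) \<le> norm (B * h \<omega>)"
      by (rule AE_I2) (auto simp: norm_mult abs_mult intro!: mult_right_mono dest!: bd)
  qed (use h in measurable)
  have int\<eta>: "integrable M \<eta>" using bdd[of "\<lambda>_. 1"] by simp
  show i1: "integrable M (\<lambda>\<omega>. \<eta> \<omega> * complex_of_real ((X t \<omega> - X s \<omega>)\<^sup>2))"
    by (rule bdd) (use incr_sq_integrable st in auto)
  have iT: "integrable M (\<lambda>\<omega>. \<eta> \<omega> * complex_of_real ((X t \<omega>)\<^sup>2 - A t))"
    by (rule bdd) (use X_sq st in auto)
  have iS: "integrable M (\<lambda>\<omega>. \<eta> \<omega> * complex_of_real ((X s \<omega>)\<^sup>2 - A s))"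
    by (rule bdd) (use X_sq st in auto)
  have e1: "(\<integral>\<omega>. \<eta> \<omega> * complex_of_real ((X t \<omega>)\<^sup>2 - A t) \<partial>M) = (\<integral>\<omega>. \<eta> \<omega> * complex_of_real ((X s \<omega>)\<^sup>2 - A s) \<partial>M)"
    using martingale_on_integral_eq(2)[OF prob_space_axioms filtration mart2 st \<eta>] iT by simp
  have \<eta>X: "(\<lambda>\<omega>. \<eta> \<omega> * complex_of_real (X s \<omega>)) \<in> borel_measurable (F s)"
    using \<eta> X_F[OF st(1)] by measurable
  have sq: "integrable M (\<lambda>\<omega>. (cmod (\<eta> \<omega> * complex_of_real (X s \<omega>)))\<^sup>2)"
  proof (rule Bochner_Integration.integrable_bound)
    show "integrable M (\<lambda>\<omega>. B\<^sup>2 * (X s \<omega>)\<^sup>2)" using X_sq st by simp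
    show "AE \<omega> in M. norm ((cmod (\<eta> \<omega> * complex_of_real (X s \<omega>)))\<^sup>2) \<le> norm (B\<^sup>2 * (X s \<omega>)\<^sup>2)"
      by (rule AE_I2) (auto simp: norm_mult abs_mult power_mult_distrib intro!: mult_right_mono power_mono dest!: bd)
  qed measurable
  note z = integral_incr_zero[OF st \<eta>X sq]
  have dec: "\<eta> \<omega> * complex_of_real ((X t \<omega> - X s \<omega>)\<^sup>2) =
      \<eta> \<omega> * complex_of_real ((X t \<omega>)\<^sup>2 - A t) - \<eta> \<omega> * complex_of_real ((X s \<omega>)\<^sup>2 - A s)
      - 2 * (\<eta> \<omega> * complex_of_real (X s \<omega>) * complex_of_real (X t \<omega> - X s \<omega>))
      + \<eta> \<omega> * complex_of_real (A t - A s)" for \<omega>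
    by (simp add: power2_eq_square algebra_simps)
  show "(\<integral>\<omega>. \<eta> \<omega> * complex_of_real ((X t \<omega> - X s \<omega>)\<^sup>2) \<partial>M) = (\<integral>\<omega>. \<eta> \<omega> \<partial>M) * complex_of_real (A t - A s)"
    unfolding dec using iT iS z e1 int\<eta>
    by (simp del: of_real_diff of_real_power)
qed

end

section \<open>Exponential martingales\<close>

primrec runmax :: "(nat \<Rightarrow> real) \<Rightarrow> nat \<Rightarrow> real" where
  "runmax x 0 = \<bar>x 0\<bar>"
| "runmax x (Suc n) = max (runmax x n) \<bar>x (Suc n)\<bar>"

lemma runmax_nonneg: "0 \<le> runmax x n"
  by (induction n) auto

lemma runmax_ge: "j \<le> n \<Longrightarrow> \<bar>x j\<bar> \<le> runmax x n"
  by (induction n) (auto simp: le_Suc_eq)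

lemma runmax_le: "(\<And>j. j \<le> n \<Longrightarrow> \<bar>x j\<bar> \<le> c) \<Longrightarrow> runmax x n \<le> c"
  by (induction n) auto

text \<open>Crude, but enough for the square integrability of the running maximum, which is required
  before expectations can be taken in \<open>doob_pathwise\<close>.\<close>

lemma runmax_sq_le: "(runmax x n)\<^sup>2 \<le> (\<Sum>j\<le>n. (x j)\<^sup>2)"
proof (induction n)
  case (Suc n)
  have "(max a b)\<^sup>2 \<le> a\<^sup>2 + b\<^sup>2" for a b :: real by (auto simp: max_def)
  from this[of "runmax x n" "\<bar>x (Suc n)\<bar>"] Suc show ?case by (simp del: max_def)
qed simp

text \<open>Pathwise form of Doob's maximal inequality: the sum is a martingale transform, whose
  expectation vanishes.\<close>

lemma doob_pathwise:
  "(runmax x n)\<^sup>2 \<le> 4 * (x n)\<^sup>2 - 4 * (\<Sum>k<n. runmax x k * sgn (x k) * (x (Suc k) - x k))"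
proof -
  \<comment> \<open>With \<open>S = runmax x\<close>, summation by parts turns the right-hand side
    into \<open>(x 0)^2\<close> plus the sum of the products of \<open>S (k + 1) - S k\<close> with
    the absolute value of \<open>x (k + 1)\<close>. Since \<open>S\<close> grows only when that
    absolute value equals \<open>S (k + 1)\<close>, each summand is at least half the increment of
    \<open>S^2\<close>.\<close>
  have *: "(runmax x n)\<^sup>2 / 2 \<le> runmax x n * \<bar>x n\<bar> - (\<Sum>k<n. runmax x k * (\<bar>x (Suc k)\<bar> - \<bar>x k\<bar>))"
  proof (induction n)
    case (Suc n)
    define S S' y y' where "S = runmax x n" "S' = runmax x (Suc n)" "y = \<bar>x n\<bar>" "y' = \<bar>x (Suc n)\<bar>"
    have "S'\<^sup>2 / 2 - S' * y' + S * y' \<le> S\<^sup>2 / 2"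
    proof (cases "y' \<le> S")
      case True then show ?thesis by (simp add: S_S'_y_y'_def)
    next
      case False
      then have "S' = y'" by (simp add: S_S'_y_y'_def)
      moreover have "0 \<le> (S - y')\<^sup>2" by simp
      ultimately show ?thesis by (simp add: power2_eq_square algebra_simps)
    qed
    then show ?case using Suc by (simp add: S_S'_y_y'_def algebra_simps)
  qed (simp add: power2_eq_square)
  \<comment> \<open>This absorbs half of the left-hand side of the previous inequality;
    \<open>S^2 / 4\<close> remains, hence the factor 4 in the conclusion.\<close>
  have 2: "runmax x n * \<bar>x n\<bar> \<le> (runmax x n)\<^sup>2 / 4 + (x n)\<^sup>2"
  proof -
    have "0 \<le> (runmax x n / 2 - \<bar>x n\<bar>)\<^sup>2" by simp
    then show ?thesis by (simp add: power2_eq_square algebra_simps)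
  qed
  \<comment> \<open>\<open>sgn a\<close> is a subgradient of the absolute value at \<open>a\<close>.
    It replaces increments of the absolute value by increments of \<open>x\<close> itself, whose
    weighted expectations will vanish.\<close>
  have 3: "(\<Sum>k<n. runmax x k * sgn (x k) * (x (Suc k) - x k)) \<le> (\<Sum>k<n. runmax x k * (\<bar>x (Suc k)\<bar> - \<bar>x k\<bar>))"
  proof (rule sum_mono)
    fix k
    have "sgn a * (b - a) \<le> \<bar>b\<bar> - \<bar>a\<bar>" for a b :: real by (auto simp: sgn_if)
    from mult_left_mono[OF this runmax_nonneg]
    show "runmax x k * sgn (x k) * (x (Suc k) - x k) \<le> runmax x k * (\<bar>x (Suc k)\<bar> - \<bar>x k\<bar>)"
      by (simp add: mult.assoc)
  qed
  from * 2 3 show ?thesis by linarith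
qed

text \<open>The partial sums, started at \<open>z 0\<close>, are \<open>z\<close> frozen at the
  first index where \<open>P\<close> fails. They agree with \<open>z n\<close> if \<open>P n\<close>
  holds, and otherwise both are bounded by \<open>K\<close>.\<close>

lemma stopped_sum_bound:
  fixes z :: "nat \<Rightarrow> complex"
  assumes dec: "\<And>k. P (Suc k) \<Longrightarrow> P k" and P0: "P 0" and bd: "\<And>k. k \<le> n \<Longrightarrow> cmod (z k) \<le> K"
  shows "cmod (z n - z 0 - (\<Sum>k<n. of_bool (P k) * (z (Suc k) - z k))) \<le> 2 * K * of_bool (\<not> P n)"
proof -
  define w where "w m = z 0 + (\<Sum>k<m. of_bool (P k) * (z (Suc k) - z k))" for m
  have "m \<le> n \<Longrightarrow> (P m \<longrightarrow> w m = z m) \<and> cmod (w m) \<le> K" for m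
  proof (induction m)
    case 0 then show ?case using bd[of 0] by (simp add: w_def)
  next
    case (Suc m)
    have ws: "w (Suc m) = w m + of_bool (P m) * (z (Suc m) - z m)" by (simp add: w_def)
    show ?case using Suc dec[of m] bd[of "Suc m"] by (cases "P m") (auto simp: ws)
  qed
  then have "P n \<longrightarrow> w n = z n" "cmod (w n) \<le> K" by auto
  moreover have "cmod (z n - w n) \<le> cmod (z n) + cmod (w n)" by (rule norm_triangle_ineq4)
  ultimately have "cmod (z n - w n) \<le> 2 * K * of_bool (\<not> P n)"
    using bd[of n] by (cases "P n") auto
  then show ?thesis by (simp only: w_def diff_diff_eq)
qed

definition iexp_rem :: "real \<Rightarrow> real \<Rightarrow> complex" where
  "iexp_rem u d = iexp (u * d) - (1 + \<i> * complex_of_real (u * d) - complex_of_real ((u * d)\<^sup>2) / 2)"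

text \<open>The cubic bound makes small increments negligible against their squares. The quadratic
  bound is for the increment at which the stopping occurs, where no third moment is at hand.\<close>

lemma iexp_rem_bounds:
  "cmod (iexp_rem u d) \<le> \<bar>u\<bar> ^ 3 * \<bar>d\<bar> ^ 3" "cmod (iexp_rem u d) \<le> u\<^sup>2 * d\<^sup>2"
proof -
  have eq: "(\<Sum>k\<le>2. (\<i> * complex_of_real (u * d)) ^ k / fact k) =
      1 + \<i> * complex_of_real (u * d) - complex_of_real ((u * d)\<^sup>2) / 2"
    by (simp add: numeral_2_eq_2 power_mult_distrib)
  have "cmod (iexp_rem u d) \<le> \<bar>u * d\<bar> ^ Suc 2 / fact (Suc 2)"
    using iexp_approx1[of "u * d" 2] unfolding eq iexp_rem_def by simp
  also have "\<dots> \<le> \<bar>u * d\<bar> ^ 3"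
  proof -
    have "fact (Suc 2) = (6::real)" "Suc 2 = 3" by (simp_all add: eval_nat_numeral)
    moreover have "0 \<le> \<bar>u * d\<bar> ^ 3" by simp
    ultimately show ?thesis by (simp only:)
  qed
  finally show "cmod (iexp_rem u d) \<le> \<bar>u\<bar> ^ 3 * \<bar>d\<bar> ^ 3" by (simp add: abs_mult power_mult_distrib)
  have "cmod (iexp_rem u d) \<le> 2 * \<bar>u * d\<bar> ^ 2 / fact 2"
    using iexp_approx2[of "u * d" 2] unfolding eq iexp_rem_def by simp
  then show "cmod (iexp_rem u d) \<le> u\<^sup>2 * d\<^sup>2" by (simp add: abs_mult power_mult_distrib)
qed

text \<open>The last term is zero as long as \<open>P\<close> holds. It is charged at the step where
  an increment first exceeds \<open>\<epsilon>\<close>, with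
  \<open>4 * u^2 * S^2 = u^2 * (2 * S)^2\<close> for the running maximum \<open>S\<close>;
  afterwards it merely grows with \<open>S\<close>, while the summands on the left are zero.\<close>

lemma stopped_remainder_bound:
  fixes x :: "nat \<Rightarrow> real" and \<epsilon> u :: real
  assumes "\<epsilon> > 0"
  defines "P \<equiv> \<lambda>k. \<forall>j<k. \<bar>x (Suc j) - x j\<bar> \<le> \<epsilon>"
  shows "(\<Sum>k<n. of_bool (P k) * cmod (iexp_rem u (x (Suc k) - x k)))
     \<le> \<bar>u\<bar> ^ 3 * \<epsilon> * (\<Sum>k<n. (x (Suc k) - x k)\<^sup>2) + 4 * u\<^sup>2 * (runmax x n)\<^sup>2 * of_bool (\<not> P n)"
proof (induction n)
  case (Suc n)
  define d where "d = x (Suc n) - x n"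
  have mono: "(runmax x n)\<^sup>2 \<le> (runmax x (Suc n))\<^sup>2"
    by (intro power_mono) (auto simp: runmax_nonneg)
  have nn: "0 \<le> \<bar>u\<bar> ^ 3 * \<epsilon> * d\<^sup>2" using assms(1) by simp
  show ?case
  proof (cases "P n")
    case False
    then have nS: "\<not> P (Suc n)" unfolding P_def using less_SucI by blast
    have "4 * u\<^sup>2 * (runmax x n)\<^sup>2 \<le> 4 * u\<^sup>2 * (runmax x (Suc n))\<^sup>2"
      using mono by (intro mult_left_mono) auto
    moreover have "of_bool (P n) = (0::real)" "of_bool (\<not> P n) = (1::real)" "of_bool (\<not> P (Suc n)) = (1::real)"
      using False nS by simp_all
    ultimately show ?thesis using Suc nn
      by (simp only: sum.lessThan_Suc d_def[symmetric] mult_zero_left mult_1_right distrib_left)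
  next
    case True
    have PS: "P (Suc n) \<longleftrightarrow> \<bar>d\<bar> \<le> \<epsilon>" using True by (auto simp: P_def d_def less_Suc_eq)
    have "cmod (iexp_rem u d) \<le> \<bar>u\<bar> ^ 3 * \<epsilon> * d\<^sup>2 + 4 * u\<^sup>2 * (runmax x (Suc n))\<^sup>2 * of_bool (\<not> P (Suc n))"
    proof (cases "\<bar>d\<bar> \<le> \<epsilon>")
      case True
      have "\<bar>d\<bar> ^ 3 = \<bar>d\<bar> * d\<^sup>2" by (simp add: power3_eq_cube power2_eq_square)
      also have "\<dots> \<le> \<epsilon> * d\<^sup>2" using True by (intro mult_right_mono) auto
      finally have "\<bar>u\<bar> ^ 3 * \<bar>d\<bar> ^ 3 \<le> \<bar>u\<bar> ^ 3 * (\<epsilon> * d\<^sup>2)" by (intro mult_left_mono) auto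
      moreover have "of_bool (\<not> P (Suc n)) = (0::real)" using PS True by simp
      ultimately show ?thesis using iexp_rem_bounds(1)[of u d]
        by (simp only: mult_zero_right add_0_right mult.assoc)
    next
      case False
      have "\<bar>d\<bar> \<le> 2 * runmax x (Suc n)"
        using runmax_ge[of "Suc n" "Suc n" x] runmax_ge[of n "Suc n" x] unfolding d_def by linarith
      then have "\<bar>d\<bar>\<^sup>2 \<le> (2 * runmax x (Suc n))\<^sup>2" by (intro power_mono) auto
      then have "u\<^sup>2 * d\<^sup>2 \<le> u\<^sup>2 * (4 * (runmax x (Suc n))\<^sup>2)"
        by (intro mult_left_mono) (auto simp: power_mult_distrib)
      moreover have "of_bool (\<not> P (Suc n)) = (1::real)" using PS False by simp
      ultimately show ?thesis using iexp_rem_bounds(2)[of u d] nn by (simp only: mult_1_right)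
    qed
    moreover have "(\<Sum>k<n. of_bool (P k) * cmod (iexp_rem u (x (Suc k) - x k)))
        \<le> \<bar>u\<bar> ^ 3 * \<epsilon> * (\<Sum>k<n. (x (Suc k) - x k)\<^sup>2)"
    proof -
      have "of_bool (\<not> P n) = (0::real)" using True by simp
      with Suc show ?thesis by (simp only: mult_zero_right add_0_right)
    qed
    moreover have "of_bool (P n) = (1::real)" using True by simp
    ultimately show ?thesis
      by (simp only: sum.lessThan_Suc d_def[symmetric] mult_1_left distrib_left)
  qed
qed simp

text \<open>With \<open>x = u^2 * (A t - A s) / 2\<close> this measures the quadratic Taylor term
  against the exact compensating factor. The bound holds because \<open>exp (- x)\<close> lies
  between \<open>1 - x\<close> and \<open>1 / (1 + x)\<close>.\<close>

lemma exp_minus_quadratic_bound: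
  fixes x :: real assumes "0 \<le> x" shows "\<bar>1 - x - exp (- x)\<bar> \<le> x\<^sup>2"
proof -
  have "1 - x \<le> exp (- x)" using exp_ge_add_one_self[of "- x"] by simp
  moreover have "exp (- x) \<le> 1 / (1 + x)"
    using exp_ge_add_one_self[of x] assms by (simp add: exp_minus field_simps)
  moreover have "1 / (1 + x) \<le> 1 - x + x\<^sup>2"
  proof -
    have "0 \<le> x ^ 3" using assms by simp
    then show ?thesis using assms by (simp add: field_simps power2_eq_square power3_eq_cube)
  qed
  ultimately show ?thesis by linarith
qed

lemma grid_mono:
  fixes \<tau> :: "nat \<Rightarrow> real"
  assumes "\<And>k. k < n \<Longrightarrow> \<tau> k \<le> \<tau> (Suc k)" "i \<le> j" "j \<le> n"
  shows "\<tau> i \<le> \<tau> j"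
  using assms(2,3)
proof (induction j)
  case (Suc j) then show ?case using assms(1)[of j] by (cases "i = Suc j") auto
qed simp

section \<open>Doob's inequality and exponential increments on a grid\<close>

context det_qv_martingale begin

lemma runmax_measurable:
  assumes "\<And>k. k \<le> n \<Longrightarrow> \<tau> k \<in> I" "\<And>k. k < n \<Longrightarrow> \<tau> k \<le> \<tau> (Suc k)" "m \<le> n"
  shows "(\<lambda>\<omega>. runmax (\<lambda>k. X (\<tau> k) \<omega>) m) \<in> borel_measurable (F (\<tau> m))"
  using assms(3)
proof (induction m)
  case 0 then show ?case using X_F[OF assms(1)[of 0]] by simp
next
  case (Suc m)
  have m: "\<tau> m \<in> I" "\<tau> (Suc m) \<in> I" "\<tau> m \<le> \<tau> (Suc m)"
    by (rule assms; use Suc in simp)+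
  have "(\<lambda>\<omega>. runmax (\<lambda>k. X (\<tau> k) \<omega>) m) \<in> borel_measurable (F (\<tau> m))"
    by (rule Suc.IH) (use Suc.prems in simp)
  note [measurable] = measurable_F_mono[OF m this] X_F[OF m(2)]
  show ?case unfolding runmax.simps by measurable
qed

text \<open>The weight at step \<open>k\<close> in \<open>doob_pathwise\<close> depends on the grid
  up to \<open>\<tau> k\<close> only, so \<open>integral_incr_zero\<close> removes every summand.
  The resulting bound involves the grid only through its last point and is therefore uniform under
  refinement.\<close>

lemma doob_grid:
  assumes \<tau>: "\<And>k. k \<le> n \<Longrightarrow> \<tau> k \<in> I" "\<And>k. k < n \<Longrightarrow> \<tau> k \<le> \<tau> (Suc k)"
  shows "integrable M (\<lambda>\<omega>. (runmax (\<lambda>k. X (\<tau> k) \<omega>) n)\<^sup>2)"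
    and "(\<integral>\<omega>. (runmax (\<lambda>k. X (\<tau> k) \<omega>) n)\<^sup>2 \<partial>M) \<le> 4 * (\<integral>\<omega>. (X (\<tau> n) \<omega>)\<^sup>2 \<partial>M)"
proof -
  let ?S = "\<lambda>m \<omega>. runmax (\<lambda>k. X (\<tau> k) \<omega>) m"
  have SF: "?S m \<in> borel_measurable (F (\<tau> m))" if "m \<le> n" for m
    using runmax_measurable[of n \<tau> m] \<tau> that by auto
  have [measurable]: "?S m \<in> borel_measurable M" if "m \<le> n" for m
    using measurable_F_M[OF \<tau>(1) SF] that by auto
  have S2: "integrable M (\<lambda>\<omega>. (?S m \<omega>)\<^sup>2)" if "m \<le> n" for m
  proof (rule Bochner_Integration.integrable_bound)
    show "integrable M (\<lambda>\<omega>. \<Sum>j\<le>m. (X (\<tau> j) \<omega>)\<^sup>2)"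
      using that by (intro Bochner_Integration.integrable_sum X_sq \<tau>) auto
    show "AE \<omega> in M. norm ((?S m \<omega>)\<^sup>2) \<le> norm (\<Sum>j\<le>m. (X (\<tau> j) \<omega>)\<^sup>2)"
      by (rule AE_I2) (use runmax_sq_le in \<open>auto simp: sum_nonneg\<close>)
    show "(\<lambda>\<omega>. (?S m \<omega>)\<^sup>2) \<in> borel_measurable M"
      using that by measurable
  qed
  then show "integrable M (\<lambda>\<omega>. (?S n \<omega>)\<^sup>2)" by simp
  define tr where "tr k \<omega> = ?S k \<omega> * sgn (X (\<tau> k) \<omega>) * (X (\<tau> (Suc k)) \<omega> - X (\<tau> k) \<omega>)" for k \<omega>
  have tr: "integrable M (tr k) \<and> (\<integral>\<omega>. tr k \<omega> \<partial>M) = 0" if "k < n" for k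
  proof -
    have k: "\<tau> k \<in> I" "\<tau> (Suc k) \<in> I" "\<tau> k \<le> \<tau> (Suc k)" "k \<le> n" using \<tau> that by auto
    let ?\<eta> = "\<lambda>\<omega>. complex_of_real (?S k \<omega> * sgn (X (\<tau> k) \<omega>))"
    have \<eta>: "?\<eta> \<in> borel_measurable (F (\<tau> k))"
      using SF[OF k(4)] X_F[OF k(1)] by measurable
    have "integrable M (\<lambda>\<omega>. (cmod (?\<eta> \<omega>))\<^sup>2)"
    proof (rule Bochner_Integration.integrable_bound[OF S2[OF k(4)]])
      show "AE \<omega> in M. norm ((cmod (?\<eta> \<omega>))\<^sup>2) \<le> norm ((?S k \<omega>)\<^sup>2)"
        by (rule AE_I2) (auto simp: norm_mult power_mult_distrib sgn_if)
      show "(\<lambda>\<omega>. (cmod (?\<eta> \<omega>))\<^sup>2) \<in> borel_measurable M" using measurable_F_M[OF k(1) \<eta>] by measurable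
    qed
    note r = integral_incr_zero[OF k(1-3) \<eta> this]
    have eq: "?\<eta> \<omega> * complex_of_real (X (\<tau> (Suc k)) \<omega> - X (\<tau> k) \<omega>) = complex_of_real (tr k \<omega>)" for \<omega>
      by (simp add: tr_def)
    show ?thesis using integrable_Re[OF r(1)[unfolded eq]] r(2)[unfolded eq] by simp
  qed
  have Xn: "integrable M (\<lambda>\<omega>. (X (\<tau> n) \<omega>)\<^sup>2)" using X_sq \<tau> by simp
  have sumint: "integrable M (\<lambda>\<omega>. \<Sum>k<n. tr k \<omega>)" using tr by (intro Bochner_Integration.integrable_sum) auto
  have "(\<integral>\<omega>. (?S n \<omega>)\<^sup>2 \<partial>M) \<le> (\<integral>\<omega>. 4 * (X (\<tau> n) \<omega>)\<^sup>2 - 4 * (\<Sum>k<n. tr k \<omega>) \<partial>M)"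
    using S2[of n] Xn sumint doob_pathwise[of "\<lambda>k. X (\<tau> k) _" n]
    by (intro integral_mono) (auto simp: tr_def)
  also have "\<dots> = 4 * (\<integral>\<omega>. (X (\<tau> n) \<omega>)\<^sup>2 \<partial>M)"
    using Xn sumint tr by (simp add: Bochner_Integration.integral_sum)
  finally show "(\<integral>\<omega>. (?S n \<omega>)\<^sup>2 \<partial>M) \<le> 4 * (\<integral>\<omega>. (X (\<tau> n) \<omega>)\<^sup>2 \<partial>M)" .
qed

text \<open>In the Taylor expansion the linear term has mean zero against \<open>\<eta>\<close>, and
  the quadratic term contributes \<open>- u^2 * (A t - A s) / 2\<close> times the mean of
  \<open>\<eta>\<close>. The factor \<open>exp (u^2 * (A t - A s) / 2)\<close> compensates this up
  to second order in \<open>A t - A s\<close>.\<close>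

lemma char_increment_step:
  fixes u :: real
  assumes st: "s \<in> I" "t \<in> I" "s \<le> t" and \<eta>: "\<eta> \<in> borel_measurable (F s)"
    and bd: "\<And>\<omega>. cmod (\<eta> \<omega>) \<le> C"
  shows "cmod (\<integral>\<omega>. \<eta> \<omega> * (exp (\<i> * complex_of_real (u * (X t \<omega> - X s \<omega>)) + complex_of_real (u\<^sup>2 * (A t - A s) / 2)) - 1) \<partial>M)
     \<le> exp (u\<^sup>2 * (A t - A s) / 2) * (C * (u\<^sup>2 * (A t - A s) / 2)\<^sup>2 + (\<integral>\<omega>. cmod (\<eta> \<omega>) * cmod (iexp_rem u (X t \<omega> - X s \<omega>)) \<partial>M))"
    and "integrable M (\<lambda>\<omega>. cmod (\<eta> \<omega>) * cmod (iexp_rem u (X t \<omega> - X s \<omega>)))"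
proof -
  have [measurable]: "\<eta> \<in> borel_measurable M" using measurable_F_M st \<eta> by blast
  note [measurable] = X_M[OF st(1)] X_M[OF st(2)]
  define x where "x = u\<^sup>2 * (A t - A s) / 2"
  have x0: "0 \<le> x" using monoD[OF A_mono st(3)] by (simp add: x_def)
  have C0: "0 \<le> C" using bd[of undefined] norm_ge_zero[of "\<eta> undefined"] by linarith
  let ?D = "\<lambda>\<omega>. X t \<omega> - X s \<omega>"
  have int\<eta>: "integrable M \<eta>"
    by (rule integrable_const_bound[of _ C]) (use bd in auto)
  have [measurable]: "(\<lambda>\<omega>. iexp_rem u (?D \<omega>)) \<in> borel_measurable M"
    unfolding iexp_rem_def by measurable
  have sq: "integrable M (\<lambda>\<omega>. (cmod (\<eta> \<omega>))\<^sup>2)"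
    by (rule integrable_const_bound[of _ "C\<^sup>2"]) (use bd in \<open>auto intro!: power_mono\<close>)
  note r1 = integral_incr_zero[OF st \<eta> sq]
  note r2 = integral_incr_square[OF st \<eta> bd]
  have remi: "integrable M (\<lambda>\<omega>. \<eta> \<omega> * iexp_rem u (?D \<omega>))"
  proof (rule Bochner_Integration.integrable_bound)
    show "integrable M (\<lambda>\<omega>. C * u\<^sup>2 * (?D \<omega>)\<^sup>2)" using incr_sq_integrable[OF st(1,2)] by simp
    have "cmod (\<eta> \<omega>) * cmod (iexp_rem u (?D \<omega>)) \<le> C * (u\<^sup>2 * (?D \<omega>)\<^sup>2)" for \<omega>
      using bd iexp_rem_bounds(2) C0 by (intro mult_mono) auto
    then show "AE \<omega> in M. norm (\<eta> \<omega> * iexp_rem u (?D \<omega>)) \<le> norm (C * u\<^sup>2 * (?D \<omega>)\<^sup>2)"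
      using C0 by (intro AE_I2) (simp add: norm_mult abs_mult mult.assoc)
  qed measurable
  show "integrable M (\<lambda>\<omega>. cmod (\<eta> \<omega>) * cmod (iexp_rem u (?D \<omega>)))"
    using integrable_norm[OF remi] by (simp add: norm_mult)
  have dec: "\<eta> \<omega> * (exp (\<i> * complex_of_real (u * ?D \<omega>) + complex_of_real x) - 1) =
     complex_of_real (exp x) * (\<eta> \<omega> + \<i> * complex_of_real u * (\<eta> \<omega> * complex_of_real (?D \<omega>))
       - (complex_of_real u)\<^sup>2 / 2 * (\<eta> \<omega> * complex_of_real ((?D \<omega>)\<^sup>2)) + \<eta> \<omega> * iexp_rem u (?D \<omega>)) - \<eta> \<omega>" for \<omega>
  proof -
    define d where "d = ?D \<omega>"
    have "exp (\<i> * complex_of_real (u * d) + complex_of_real x) = complex_of_real (exp x) * iexp (u * d)"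
      by (simp add: exp_add exp_of_real mult.commute)
    moreover have "iexp (u * d) = 1 + \<i> * complex_of_real (u * d) - complex_of_real ((u * d)\<^sup>2) / 2 + iexp_rem u d"
      by (simp add: iexp_rem_def)
    ultimately have e2: "exp (\<i> * complex_of_real (u * d) + complex_of_real x) =
        complex_of_real (exp x) * (1 + \<i> * complex_of_real (u * d) - complex_of_real ((u * d)\<^sup>2) / 2 + iexp_rem u d)"
      by simp
    show ?thesis unfolding d_def[symmetric] e2
      by (simp add: algebra_simps power_mult_distrib)
  qed
  let ?R = "\<integral>\<omega>. \<eta> \<omega> * iexp_rem u (?D \<omega>) \<partial>M"
  have lin: "(\<integral>\<omega>. e * (f0 \<omega> + a * f1 \<omega> - b * f2 \<omega> + f3 \<omega>) - f0 \<omega> \<partial>M) =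
      e * ((\<integral>\<omega>. f0 \<omega> \<partial>M) + a * (\<integral>\<omega>. f1 \<omega> \<partial>M) - b * (\<integral>\<omega>. f2 \<omega> \<partial>M) + (\<integral>\<omega>. f3 \<omega> \<partial>M)) - (\<integral>\<omega>. f0 \<omega> \<partial>M)"
    if "integrable M f0" "integrable M f1" "integrable M f2" "integrable M f3"
    for f0 f1 f2 f3 :: "'a \<Rightarrow> complex" and e a b
    using that by simp
  have "(\<integral>\<omega>. \<eta> \<omega> * (exp (\<i> * complex_of_real (u * ?D \<omega>) + complex_of_real x) - 1) \<partial>M) =
     complex_of_real (exp x) * ((\<integral>\<omega>. \<eta> \<omega> \<partial>M) - complex_of_real x * (\<integral>\<omega>. \<eta> \<omega> \<partial>M) + ?R) - (\<integral>\<omega>. \<eta> \<omega> \<partial>M)"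
    unfolding dec lin[OF int\<eta> r1(1) r2(1) remi] r1(2) r2(2) by (simp add: x_def)
  \<comment> \<open>The subtracted integral of \<open>\<eta>\<close> is written as
    \<open>exp x * exp (- x)\<close> times itself, so that \<open>exp_minus_quadratic_bound\<close>
    applies after factoring out \<open>exp x\<close>.\<close>
  also have "\<dots> = complex_of_real (exp x) * (complex_of_real (1 - x - exp (- x)) * (\<integral>\<omega>. \<eta> \<omega> \<partial>M) + ?R)"
  proof -
    have "complex_of_real (exp x) * complex_of_real (exp (- x)) = 1"
      by (simp flip: of_real_mult exp_add)
    then show ?thesis by (simp add: algebra_simps)
  qed
  finally have eq: "(\<integral>\<omega>. \<eta> \<omega> * (exp (\<i> * complex_of_real (u * ?D \<omega>) + complex_of_real x) - 1) \<partial>M) =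
    complex_of_real (exp x) * (complex_of_real (1 - x - exp (- x)) * (\<integral>\<omega>. \<eta> \<omega> \<partial>M) + ?R)" .
  have n1: "cmod (\<integral>\<omega>. \<eta> \<omega> \<partial>M) \<le> C"
  proof -
    have "cmod (\<integral>\<omega>. \<eta> \<omega> \<partial>M) \<le> (\<integral>\<omega>. cmod (\<eta> \<omega>) \<partial>M)" by simp
    also have "\<dots> \<le> (\<integral>\<omega>. C \<partial>M)" using int\<eta> bd by (intro integral_mono) auto
    finally show ?thesis by (simp add: prob_space)
  qed
  have n2: "cmod ?R \<le> (\<integral>\<omega>. cmod (\<eta> \<omega>) * cmod (iexp_rem u (?D \<omega>)) \<partial>M)"
    using integral_norm_bound[of M "\<lambda>\<omega>. \<eta> \<omega> * iexp_rem u (?D \<omega>)"] by (simp add: norm_mult)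
  have "cmod (complex_of_real (1 - x - exp (- x)) * (\<integral>\<omega>. \<eta> \<omega> \<partial>M)) \<le> x\<^sup>2 * C"
    unfolding norm_mult norm_of_real using exp_minus_quadratic_bound[OF x0] n1
    by (intro mult_mono) auto
  then have "cmod (complex_of_real (1 - x - exp (- x)) * (\<integral>\<omega>. \<eta> \<omega> \<partial>M) + ?R)
     \<le> C * x\<^sup>2 + (\<integral>\<omega>. cmod (\<eta> \<omega>) * cmod (iexp_rem u (?D \<omega>)) \<partial>M)"
    using n2 norm_triangle_ineq[of "complex_of_real (1 - x - exp (- x)) * (\<integral>\<omega>. \<eta> \<omega> \<partial>M)" ?R]
    by (simp add: mult.commute)
  then have "cmod (\<integral>\<omega>. \<eta> \<omega> * (exp (\<i> * complex_of_real (u * ?D \<omega>) + complex_of_real x) - 1) \<partial>M)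
    \<le> exp x * (C * x\<^sup>2 + (\<integral>\<omega>. cmod (\<eta> \<omega>) * cmod (iexp_rem u (?D \<omega>)) \<partial>M))"
    unfolding eq norm_mult norm_of_real abs_exp_cancel by (intro mult_left_mono) auto
  then show "cmod (\<integral>\<omega>. \<eta> \<omega> * (exp (\<i> * complex_of_real (u * ?D \<omega>) + complex_of_real (u\<^sup>2 * (A t - A s) / 2)) - 1) \<partial>M)
     \<le> exp (u\<^sup>2 * (A t - A s) / 2) * (C * (u\<^sup>2 * (A t - A s) / 2)\<^sup>2 + (\<integral>\<omega>. cmod (\<eta> \<omega>) * cmod (iexp_rem u (?D \<omega>)) \<partial>M))"
    unfolding x_def .
qed

text \<open>This is \<open>expm\<close> at the purely imaginary parameter \<open>\<i> * u\<close>.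
  Its modulus does not depend on the path, so it can serve as a bounded weight.\<close>

definition expi :: "real \<Rightarrow> real \<Rightarrow> 'a \<Rightarrow> complex" where
  "expi u t \<omega> = exp (\<i> * complex_of_real (u * X t \<omega>) + complex_of_real (u\<^sup>2 * A t / 2))"

lemma norm_expi: "cmod (expi u t \<omega>) = exp (u\<^sup>2 * A t / 2)"
  by (simp add: expi_def norm_exp)

lemma expi_F: "t \<in> I \<Longrightarrow> expi u t \<in> borel_measurable (F t)"
  using X_F[of t] unfolding expi_def[abs_def] by measurable

lemma expi_diff:
  "expi u t \<omega> - expi u s \<omega> =
    expi u s \<omega> * (exp (\<i> * complex_of_real (u * (X t \<omega> - X s \<omega>)) + complex_of_real (u\<^sup>2 * (A t - A s) / 2)) - 1)"
  unfolding expi_def right_diff_distrib mult_1_right exp_add[symmetric]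
  by (simp add: algebra_simps diff_divide_distrib)

text \<open>\<open>P k\<close> says that no increment before step \<open>k\<close> exceeds \<open>\<epsilon>\<close>. Summing only over steps with \<open>P k\<close>
  leaves at most one large increment, which is bounded by \<open>2 * S\<close>.\<close>

lemma expi_grid_bound:
  fixes u \<epsilon> \<delta> :: real and n :: nat and \<tau> :: "nat \<Rightarrow> real" and b :: "'a \<Rightarrow> complex"
  assumes \<tau>I: "\<And>k. k \<le> n \<Longrightarrow> \<tau> k \<in> I" and \<tau>m: "\<And>k. k < n \<Longrightarrow> \<tau> k \<le> \<tau> (Suc k)"
    and \<epsilon>: "\<epsilon> > 0" and b: "b \<in> borel_measurable (F (\<tau> 0))" and b1: "\<And>\<omega>. cmod (b \<omega>) \<le> 1"
    and \<delta>: "\<And>k. k < n \<Longrightarrow> A (\<tau> (Suc k)) - A (\<tau> k) \<le> \<delta>"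
  defines "P \<equiv> \<lambda>k \<omega>. \<forall>j<k. \<bar>X (\<tau> (Suc j)) \<omega> - X (\<tau> j) \<omega>\<bar> \<le> \<epsilon>"
    and "K \<equiv> exp (u\<^sup>2 * A (\<tau> n) / 2)"
    and "S \<equiv> \<lambda>\<omega>. runmax (\<lambda>k. X (\<tau> k) \<omega>) n"
  shows "cmod (\<integral>\<omega>. b \<omega> * (expi u (\<tau> n) \<omega> - expi u (\<tau> 0) \<omega>) \<partial>M) \<le>
     K\<^sup>2 * (u ^ 4 / 4 * \<delta> + \<bar>u\<bar> ^ 3 * \<epsilon>) * (A (\<tau> n) - A (\<tau> 0))
     + K\<^sup>2 * (4 * u\<^sup>2) * (\<integral>\<omega>. (S \<omega>)\<^sup>2 * of_bool (\<not> P n \<omega>) \<partial>M)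
     + 2 * K * (\<integral>\<omega>. of_bool (\<not> P n \<omega>) \<partial>M)"
proof -
  have mono: "\<tau> i \<le> \<tau> j" if "i \<le> j" "j \<le> n" for i j
    using grid_mono[of n \<tau> i j] \<tau>m that by blast
  have bF: "b \<in> borel_measurable (F (\<tau> k))" if "k \<le> n" for k
    by (rule measurable_F_mono[OF _ _ _ b]) (use that \<tau>I mono in auto)
  have XF: "X (\<tau> j) \<in> borel_measurable (F (\<tau> k))" if "j \<le> k" "k \<le> n" for j k
    by (rule measurable_F_mono[OF _ _ _ X_F]) (use that \<tau>I mono in auto)
  have PF: "(\<lambda>\<omega>. of_bool (P k \<omega>) :: complex) \<in> borel_measurable (F (\<tau> k))" if k: "k \<le> n" for k
  proof -
    \<comment> \<open>As a finite product, the indicator is checked for measurability one increment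
      at a time; every increment before step \<open>k\<close> is known at time
      \<open>\<tau> k\<close>.\<close>
    have eq: "(\<lambda>\<omega>. of_bool (P k \<omega>) :: complex) =
       (\<lambda>\<omega>. \<Prod>j<k. if \<bar>X (\<tau> (Suc j)) \<omega> - X (\<tau> j) \<omega>\<bar> \<le> \<epsilon> then 1 else 0)"
      by (rule ext) (auto simp: P_def of_bool_def)
    show ?thesis unfolding eq
    proof (rule borel_measurable_prod)
      fix j assume "j \<in> {..<k}"
      then have [measurable]: "X (\<tau> (Suc j)) \<in> borel_measurable (F (\<tau> k))" "X (\<tau> j) \<in> borel_measurable (F (\<tau> k))"
        using XF k by auto
      show "(\<lambda>\<omega>. if \<bar>X (\<tau> (Suc j)) \<omega> - X (\<tau> j) \<omega>\<bar> \<le> \<epsilon> then 1 else (0::complex)) \<in> borel_measurable (F (\<tau> k))"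
        by measurable
    qed
  qed
  have [measurable]: "Measurable.pred M (P k)" if "k \<le> n" for k
  proof -
    have "(\<lambda>\<omega>. of_bool (P k \<omega>) :: complex) \<in> borel_measurable M"
      using measurable_F_M[OF \<tau>I PF] that by auto
    then have "Measurable.pred M (\<lambda>\<omega>. of_bool (P k \<omega>) = (1::complex))" by measurable
    then show ?thesis by simp
  qed
  have [measurable]: "X (\<tau> k) \<in> borel_measurable M" if "k \<le> n" for k using X_M \<tau>I that by blast
  have [measurable]: "b \<in> borel_measurable M" using measurable_F_M[OF \<tau>I b] by simp
  have eM [measurable]: "expi u (\<tau> k) \<in> borel_measurable M" if "k \<le> n" for k
    using measurable_F_M[OF \<tau>I expi_F] that \<tau>I by blast
  have K1: "1 \<le> K" unfolding K_def using A_nonneg by simp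
  have AK: "exp (u\<^sup>2 * A (\<tau> k) / 2) \<le> K" if "k \<le> n" for k
    using monoD[OF A_mono mono[OF that order.refl]] by (simp add: K_def mult_left_mono)
  define \<alpha> where "\<alpha> k = A (\<tau> (Suc k)) - A (\<tau> k)" for k
  have \<alpha>0: "0 \<le> \<alpha> k" if "k < n" for k using monoD[OF A_mono \<tau>m[OF that]] by (simp add: \<alpha>_def)
  have \<alpha>sum: "(\<Sum>k<n. \<alpha> k) = A (\<tau> n) - A (\<tau> 0)" unfolding \<alpha>_def by (rule sum_lessThan_telescope)
  have eK: "exp (u\<^sup>2 * \<alpha> k / 2) \<le> K" if "k < n" for k
  proof -
    have "\<alpha> k \<le> A (\<tau> n)"
      using monoD[OF A_mono mono[of "Suc k" n]] A_nonneg[of "\<tau> k"] that by (simp add: \<alpha>_def)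
    then show ?thesis by (simp add: K_def mult_left_mono)
  qed
  \<comment> \<open>The weight of step \<open>k\<close> consists of the test function, the stopping
    indicator and the current exponential; \<open>\<eta> k * e k\<close> is then \<open>b\<close>
    times the stopped increment of \<open>expi\<close>.\<close>
  define \<eta> where "\<eta> k \<omega> = b \<omega> * of_bool (P k \<omega>) * expi u (\<tau> k) \<omega>" for k \<omega>
  define e where "e k \<omega> = exp (\<i> * complex_of_real (u * (X (\<tau> (Suc k)) \<omega> - X (\<tau> k) \<omega>))
       + complex_of_real (u\<^sup>2 * (A (\<tau> (Suc k)) - A (\<tau> k)) / 2)) - 1" for k \<omega>
  define r where "r k \<omega> = of_bool (P k \<omega>) * cmod (iexp_rem u (X (\<tau> (Suc k)) \<omega> - X (\<tau> k) \<omega>))" for k \<omega>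
  have \<eta>F: "\<eta> k \<in> borel_measurable (F (\<tau> k))" if "k \<le> n" for k
    unfolding \<eta>_def[abs_def] using bF[OF that] PF[OF that] expi_F[OF \<tau>I[OF that]]
    by (intro borel_measurable_times) auto
  have \<eta>b: "cmod (\<eta> k \<omega>) \<le> K * of_bool (P k \<omega>)" if "k \<le> n" for k \<omega>
  proof -
    have "cmod (b \<omega>) * exp (u\<^sup>2 * A (\<tau> k) / 2) \<le> 1 * K"
      using b1 AK[OF that] by (intro mult_mono) auto
    then show ?thesis by (auto simp: \<eta>_def norm_mult norm_expi)
  qed
  have \<eta>K: "cmod (\<eta> k \<omega>) \<le> K" if "k \<le> n" for k \<omega>
    by (rule order.trans[OF \<eta>b[OF that]]) (use K1 in \<open>auto simp: of_bool_def\<close>)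
  have stepI: "\<tau> k \<in> I" "\<tau> (Suc k) \<in> I" "\<tau> k \<le> \<tau> (Suc k)" "k \<le> n" if "k < n" for k
    using that \<tau>I \<tau>m by auto
  have rint: "integrable M (r k)" if "k < n" for k
  proof -
    have ob: "cmod (of_bool q) = of_bool q" for q by (cases q) auto
    then have "cmod (of_bool (P k \<omega>)) \<le> 1" for \<omega> by simp
    from char_increment_step(2)[OF stepI(1-3)[OF that] PF[OF stepI(4)[OF that]] this, of u]
    show ?thesis unfolding r_def[abs_def] ob .
  qed
  have step: "cmod (\<integral>\<omega>. \<eta> k \<omega> * e k \<omega> \<partial>M) \<le> K\<^sup>2 * (u ^ 4 / 4 * \<delta> * \<alpha> k) + K\<^sup>2 * (\<integral>\<omega>. r k \<omega> \<partial>M)" if k: "k < n" for k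
  proof -
    let ?R = "\<lambda>\<omega>. cmod (\<eta> k \<omega>) * cmod (iexp_rem u (X (\<tau> (Suc k)) \<omega> - X (\<tau> k) \<omega>))"
    note c = char_increment_step[OF stepI(1-3)[OF k] \<eta>F[OF stepI(4)[OF k]] \<eta>K[OF stepI(4)[OF k]], of u, folded \<alpha>_def]
    have "(\<integral>\<omega>. ?R \<omega> \<partial>M) \<le> (\<integral>\<omega>. K * r k \<omega> \<partial>M)"
    proof (rule integral_mono)
      show "integrable M ?R" using c(2) .
      show "integrable M (\<lambda>\<omega>. K * r k \<omega>)" using rint k by simp
      show "?R \<omega> \<le> K * r k \<omega>" for \<omega>
        using mult_right_mono[OF \<eta>b[OF stepI(4)[OF k], of \<omega>] norm_ge_zero[of "iexp_rem u (X (\<tau> (Suc k)) \<omega> - X (\<tau> k) \<omega>)"]]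
        by (simp add: r_def mult.assoc)
    qed
    then have R: "(\<integral>\<omega>. ?R \<omega> \<partial>M) \<le> K * (\<integral>\<omega>. r k \<omega> \<partial>M)" by simp
    have "(u\<^sup>2 * \<alpha> k / 2)\<^sup>2 = u ^ 4 / 4 * (\<alpha> k * \<alpha> k)"
      by (simp add: power2_eq_square power4_eq_xxxx)
    \<comment> \<open>One factor \<open>\<alpha> k\<close> is replaced by the bound
      \<open>\<delta>\<close>; the other is kept so that the sum over \<open>k\<close> telescopes to
      \<open>A (\<tau> n) - A (\<tau> 0)\<close>.\<close>
    also have "\<dots> \<le> u ^ 4 / 4 * (\<delta> * \<alpha> k)"
      using \<delta>[OF k] \<alpha>0[OF k] by (intro mult_left_mono mult_right_mono) (auto simp: \<alpha>_def)
    finally have q: "(u\<^sup>2 * \<alpha> k / 2)\<^sup>2 \<le> u ^ 4 / 4 * \<delta> * \<alpha> k" by (simp add: mult.assoc)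
    have in0: "0 \<le> K * (u\<^sup>2 * \<alpha> k / 2)\<^sup>2 + (\<integral>\<omega>. ?R \<omega> \<partial>M)" using K1 by (intro add_nonneg_nonneg integral_nonneg) auto
    have "cmod (\<integral>\<omega>. \<eta> k \<omega> * e k \<omega> \<partial>M) \<le> exp (u\<^sup>2 * \<alpha> k / 2) * (K * (u\<^sup>2 * \<alpha> k / 2)\<^sup>2 + (\<integral>\<omega>. ?R \<omega> \<partial>M))"
      using c(1) by (simp add: e_def \<alpha>_def)
    also have "\<dots> \<le> K * (K * (u\<^sup>2 * \<alpha> k / 2)\<^sup>2 + (\<integral>\<omega>. ?R \<omega> \<partial>M))"
      using eK[OF k] in0 by (intro mult_right_mono) auto
    also have "\<dots> \<le> K * (K * (u ^ 4 / 4 * \<delta> * \<alpha> k) + K * (\<integral>\<omega>. r k \<omega> \<partial>M))"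
      using q R K1 by (intro mult_left_mono add_mono) auto
    finally show ?thesis by (simp add: power2_eq_square distrib_left mult.assoc)
  qed
  have S2: "integrable M (\<lambda>\<omega>. (S \<omega>)\<^sup>2)"
    unfolding S_def using doob_grid(1)[of n \<tau>] \<tau>I \<tau>m by auto
  have SP: "integrable M (\<lambda>\<omega>. (S \<omega>)\<^sup>2 * of_bool (\<not> P n \<omega>))"
  proof (rule Bochner_Integration.integrable_bound[OF S2])
    show "(\<lambda>\<omega>. (S \<omega>)\<^sup>2 * of_bool (\<not> P n \<omega>)) \<in> borel_measurable M"
      using borel_measurable_integrable[OF S2] by measurable
  qed (auto simp: of_bool_def)
  have dint: "integrable M (\<lambda>\<omega>. (X (\<tau> (Suc k)) \<omega> - X (\<tau> k) \<omega>)\<^sup>2)" if "k < n" for k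
    using incr_sq_integrable stepI[OF that] by blast
  have dval: "(\<integral>\<omega>. (X (\<tau> (Suc k)) \<omega> - X (\<tau> k) \<omega>)\<^sup>2 \<partial>M) = \<alpha> k" if "k < n" for k
  proof -
    have "(\<integral>\<omega>. 1 * complex_of_real ((X (\<tau> (Suc k)) \<omega> - X (\<tau> k) \<omega>)\<^sup>2) \<partial>M) = (\<integral>\<omega>. (1::complex) \<partial>M) * complex_of_real (\<alpha> k)"
      unfolding \<alpha>_def by (rule integral_incr_square[where B=1, OF stepI(1-3)[OF that]]) auto
    then show ?thesis by (simp add: prob_space del: of_real_power of_real_diff)
  qed
  have rsum: "(\<Sum>k<n. (\<integral>\<omega>. r k \<omega> \<partial>M)) \<le> \<bar>u\<bar> ^ 3 * \<epsilon> * (A (\<tau> n) - A (\<tau> 0))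
      + 4 * u\<^sup>2 * (\<integral>\<omega>. (S \<omega>)\<^sup>2 * of_bool (\<not> P n \<omega>) \<partial>M)"
  proof -
    have "(\<Sum>k<n. (\<integral>\<omega>. r k \<omega> \<partial>M)) = (\<integral>\<omega>. (\<Sum>k<n. r k \<omega>) \<partial>M)"
      using rint by (intro Bochner_Integration.integral_sum[symmetric]) auto
    also have "\<dots> \<le> (\<integral>\<omega>. \<bar>u\<bar> ^ 3 * \<epsilon> * (\<Sum>k<n. (X (\<tau> (Suc k)) \<omega> - X (\<tau> k) \<omega>)\<^sup>2) + 4 * u\<^sup>2 * ((S \<omega>)\<^sup>2 * of_bool (\<not> P n \<omega>)) \<partial>M)"
    proof (rule integral_mono)
      show "integrable M (\<lambda>\<omega>. \<Sum>k<n. r k \<omega>)" using rint by (intro Bochner_Integration.integrable_sum) auto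
      show "integrable M (\<lambda>\<omega>. \<bar>u\<bar> ^ 3 * \<epsilon> * (\<Sum>k<n. (X (\<tau> (Suc k)) \<omega> - X (\<tau> k) \<omega>)\<^sup>2) + 4 * u\<^sup>2 * ((S \<omega>)\<^sup>2 * of_bool (\<not> P n \<omega>)))"
        using dint SP by (intro Bochner_Integration.integrable_add integrable_mult_right Bochner_Integration.integrable_sum) auto
      show "(\<Sum>k<n. r k \<omega>) \<le> \<bar>u\<bar> ^ 3 * \<epsilon> * (\<Sum>k<n. (X (\<tau> (Suc k)) \<omega> - X (\<tau> k) \<omega>)\<^sup>2) + 4 * u\<^sup>2 * ((S \<omega>)\<^sup>2 * of_bool (\<not> P n \<omega>))" for \<omega>
        using stopped_remainder_bound[OF \<epsilon>, of "\<lambda>k. X (\<tau> k) \<omega>" u n] by (simp only: r_def P_def S_def mult.assoc)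
    qed
    also have "\<dots> = \<bar>u\<bar> ^ 3 * \<epsilon> * (\<Sum>k<n. (\<integral>\<omega>. (X (\<tau> (Suc k)) \<omega> - X (\<tau> k) \<omega>)\<^sup>2 \<partial>M)) + 4 * u\<^sup>2 * (\<integral>\<omega>. (S \<omega>)\<^sup>2 * of_bool (\<not> P n \<omega>) \<partial>M)"
    proof -
      have i1: "integrable M (\<lambda>\<omega>. \<Sum>k<n. (X (\<tau> (Suc k)) \<omega> - X (\<tau> k) \<omega>)\<^sup>2)" using dint by (intro Bochner_Integration.integrable_sum) auto
      have "(\<integral>\<omega>. (\<Sum>k<n. (X (\<tau> (Suc k)) \<omega> - X (\<tau> k) \<omega>)\<^sup>2) \<partial>M) = (\<Sum>k<n. (\<integral>\<omega>. (X (\<tau> (Suc k)) \<omega> - X (\<tau> k) \<omega>)\<^sup>2 \<partial>M))"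
        using dint by (intro Bochner_Integration.integral_sum) auto
      then show ?thesis by (simp only: Bochner_Integration.integral_add[OF integrable_mult_right[OF i1] integrable_mult_right[OF SP]] integral_mult_right_zero)
    qed
    also have "(\<Sum>k<n. (\<integral>\<omega>. (X (\<tau> (Suc k)) \<omega> - X (\<tau> k) \<omega>)\<^sup>2 \<partial>M)) = A (\<tau> n) - A (\<tau> 0)"
      unfolding \<alpha>sum[symmetric] by (rule sum.cong) (use dval in auto)
    finally show ?thesis .
  qed
  \<comment> \<open>What the stopping discards: \<open>b\<close> times the difference between the
    full and the stopped increment. It lives on the event where some increment is large.\<close>
  define err where "err \<omega> = b \<omega> * (expi u (\<tau> n) \<omega> - expi u (\<tau> 0) \<omega>
      - (\<Sum>k<n. of_bool (P k \<omega>) * (expi u (\<tau> (Suc k)) \<omega> - expi u (\<tau> k) \<omega>)))" for \<omega>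
  have err_b: "cmod (err \<omega>) \<le> 2 * K * of_bool (\<not> P n \<omega>)" for \<omega>
  proof -
    have "cmod (expi u (\<tau> n) \<omega> - expi u (\<tau> 0) \<omega> - (\<Sum>k<n. of_bool (P k \<omega>) * (expi u (\<tau> (Suc k)) \<omega> - expi u (\<tau> k) \<omega>)))
       \<le> 2 * K * of_bool (\<not> P n \<omega>)"
      by (rule stopped_sum_bound[where P = "\<lambda>k. P k \<omega>" and z = "\<lambda>k. expi u (\<tau> k) \<omega>"])
        (auto simp: P_def norm_expi AK)
    from mult_mono[OF b1[of \<omega>] this] show ?thesis by (simp add: err_def norm_mult)
  qed
  have err_dec: "b \<omega> * (expi u (\<tau> n) \<omega> - expi u (\<tau> 0) \<omega>) = err \<omega> + (\<Sum>k<n. \<eta> k \<omega> * e k \<omega>)" for \<omega>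
  proof -
    have "\<eta> k \<omega> * e k \<omega> = b \<omega> * (of_bool (P k \<omega>) * (expi u (\<tau> (Suc k)) \<omega> - expi u (\<tau> k) \<omega>))" for k
      unfolding expi_diff by (simp add: \<eta>_def e_def mult.assoc)
    then show ?thesis by (simp add: err_def right_diff_distrib sum_distrib_left)
  qed
  have \<eta>M: "\<eta> k \<in> borel_measurable M" if "k \<le> n" for k using measurable_F_M[OF \<tau>I \<eta>F] that by blast
  have deM: "e k \<in> borel_measurable M" if "k < n" for k
    using that by (simp add: e_def[abs_def])
  have ei: "integrable M (\<lambda>\<omega>. \<eta> k \<omega> * e k \<omega>)" if k: "k < n" for k
  proof (rule integrable_const_bound[of _ "K * (K + 1)"])
    have "cmod (e k \<omega>) \<le> exp (u\<^sup>2 * \<alpha> k / 2) + 1" for \<omega>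
      unfolding e_def \<alpha>_def by (rule order.trans[OF norm_triangle_ineq4]) (simp add: norm_exp)
    then have "cmod (e k \<omega>) \<le> K + 1" for \<omega> using eK[OF k] by (meson add_right_mono order.trans)
    then show "AE \<omega> in M. cmod (\<eta> k \<omega> * e k \<omega>) \<le> K * (K + 1)"
      unfolding norm_mult using \<eta>K[of k] K1 k by (intro AE_I2 mult_mono) auto
    show "(\<lambda>\<omega>. \<eta> k \<omega> * e k \<omega>) \<in> borel_measurable M"
      using \<eta>M[OF less_imp_le[OF k]] deM[OF k] by (rule borel_measurable_times)
  qed
  have [measurable]: "err \<in> borel_measurable M"
    unfolding err_def[abs_def] by (intro borel_measurable_times borel_measurable_diff borel_measurable_sum) auto
  have Pint: "integrable M (\<lambda>\<omega>. of_bool (\<not> P n \<omega>) :: real)"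
    by (rule integrable_const_bound[of _ 1]) auto
  have erri: "integrable M err"
    by (rule Bochner_Integration.integrable_bound[OF integrable_mult_right[OF Pint, of "2 * K"]])
      (use err_b K1 in \<open>auto simp: abs_mult\<close>)
  have err_int: "cmod (\<integral>\<omega>. err \<omega> \<partial>M) \<le> 2 * K * (\<integral>\<omega>. of_bool (\<not> P n \<omega>) \<partial>M)"
  proof -
    have "cmod (\<integral>\<omega>. err \<omega> \<partial>M) \<le> (\<integral>\<omega>. cmod (err \<omega>) \<partial>M)" by simp
    also have "\<dots> \<le> (\<integral>\<omega>. 2 * K * of_bool (\<not> P n \<omega>) \<partial>M)"
      by (rule integral_mono) (use erri Pint err_b in auto)
    finally show ?thesis by simp
  qed
  have "(\<integral>\<omega>. b \<omega> * (expi u (\<tau> n) \<omega> - expi u (\<tau> 0) \<omega>) \<partial>M) = (\<integral>\<omega>. err \<omega> \<partial>M) + (\<Sum>k<n. (\<integral>\<omega>. \<eta> k \<omega> * e k \<omega> \<partial>M))"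
    unfolding err_dec using erri ei
    by (subst Bochner_Integration.integral_add) (auto simp: Bochner_Integration.integral_sum)
  also have "cmod \<dots> \<le> cmod (\<integral>\<omega>. err \<omega> \<partial>M) + (\<Sum>k<n. cmod (\<integral>\<omega>. \<eta> k \<omega> * e k \<omega> \<partial>M))"
    by (rule order.trans[OF norm_triangle_ineq]) (simp add: norm_sum)
  also have "\<dots> \<le> 2 * K * (\<integral>\<omega>. of_bool (\<not> P n \<omega>) \<partial>M) + (\<Sum>k<n. K\<^sup>2 * (u ^ 4 / 4 * \<delta> * \<alpha> k) + K\<^sup>2 * (\<integral>\<omega>. r k \<omega> \<partial>M))"
    using err_int step by (intro add_mono sum_mono) auto
  also have "(\<Sum>k<n. K\<^sup>2 * (u ^ 4 / 4 * \<delta> * \<alpha> k) + K\<^sup>2 * (\<integral>\<omega>. r k \<omega> \<partial>M)) =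
      K\<^sup>2 * (u ^ 4 / 4 * \<delta> * (\<Sum>k<n. \<alpha> k)) + K\<^sup>2 * (\<Sum>k<n. (\<integral>\<omega>. r k \<omega> \<partial>M))"
    by (simp only: sum.distrib sum_distrib_left)
  also have "\<dots> \<le> K\<^sup>2 * (u ^ 4 / 4 * \<delta> * (A (\<tau> n) - A (\<tau> 0))) + K\<^sup>2 * (\<bar>u\<bar> ^ 3 * \<epsilon> * (A (\<tau> n) - A (\<tau> 0))
      + 4 * u\<^sup>2 * (\<integral>\<omega>. (S \<omega>)\<^sup>2 * of_bool (\<not> P n \<omega>) \<partial>M))"
    unfolding \<alpha>sum using rsum by (intro add_left_mono mult_left_mono) auto
  finally show ?thesis by (simp add: algebra_simps)
qed

end

text \<open>A scaled standard normal law rather than a density, so that \<open>v = 0\<close>, which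
  occurs wherever \<open>A\<close> is constant, gives the point mass at 0.\<close>

definition gauss :: "real \<Rightarrow> real measure" where
  "gauss v = distr std_normal_distribution borel (\<lambda>x. sqrt v * x)"

lemma real_distribution_gauss: "real_distribution (gauss v)"
proof -
  interpret real_distribution std_normal_distribution by (rule real_dist_normal_dist)
  show ?thesis unfolding gauss_def by (rule real_distribution_distr) simp
qed

lemma char_gauss:
  assumes "0 \<le> v" shows "char (gauss v) u = complex_of_real (exp (- (u\<^sup>2 * v / 2)))"
proof -
  have "char (gauss v) u = char std_normal_distribution (u * sqrt v)"
    unfolding gauss_def char_def by (subst integral_distr) (auto simp: mult.assoc)
  then show ?thesis using assms by (simp add: char_std_normal_distribution power_mult_distrib)
qed

text \<open>Halving makes the grids nested in \<open>N\<close>, so that the running maxima over them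
  increase with \<open>N\<close>.\<close>

definition dyadic_point :: "real \<Rightarrow> real \<Rightarrow> nat \<Rightarrow> nat \<Rightarrow> real" where
  "dyadic_point s t N k = s + (t - s) * real k / 2 ^ N"

section \<open>Refinement of the grid and the law of the increments\<close>

context det_qv_martingale begin

lemma dyadic_grid:
  fixes s t :: real
  assumes st: "s \<in> I" "t \<in> I" "s < t"
  defines "\<tau> \<equiv> dyadic_point s t"
  shows "k \<le> 2 ^ N \<Longrightarrow> \<tau> N k \<in> {s..t}" "\<tau> N k \<le> \<tau> N (Suc k)" "\<tau> N 0 = s" "\<tau> N (2 ^ N) = t"
    "\<tau> (Suc N) (2 * k) = \<tau> N k" "\<tau> N (Suc k) - \<tau> N k = (t - s) / 2 ^ N"
    "k \<le> 2 ^ N \<Longrightarrow> \<tau> N k \<in> I"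
proof -
  show mem: "\<tau> N k \<in> {s..t}" if k: "k \<le> 2 ^ N"
  proof -
    have "real k \<le> 2 ^ N" using k by (metis of_nat_le_iff of_nat_numeral of_nat_power)
    then have "(t - s) * real k \<le> (t - s) * 2 ^ N" using st by (intro mult_left_mono) auto
    then have "(t - s) * real k / 2 ^ N \<le> t - s" by (simp add: pos_divide_le_eq)
    then show ?thesis using st by (simp add: \<tau>_def dyadic_point_def)
  qed
  show "k \<le> 2 ^ N \<Longrightarrow> \<tau> N k \<in> I" using mem I_Icc[OF st(1,2)] by blast
  show d: "\<tau> N (Suc k) - \<tau> N k = (t - s) / 2 ^ N" by (simp add: \<tau>_def dyadic_point_def field_simps)
  have "0 \<le> (t - s) / 2 ^ N" using st by simp
  then show "\<tau> N k \<le> \<tau> N (Suc k)" using d by linarith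
  show "\<tau> N 0 = s" "\<tau> N (2 ^ N) = t" "\<tau> (Suc N) (2 * k) = \<tau> N k" by (simp_all add: \<tau>_def dyadic_point_def)
qed

text \<open>Uniform continuity on the compact interval. It is applied to each continuous path, and
  to \<open>A\<close>, where it provides the bound on the increments of \<open>A\<close> over one
  cell.\<close>

lemma dyadic_oscillation:
  fixes s t :: real and h :: "real \<Rightarrow> real"
  assumes st: "s \<in> I" "t \<in> I" "s < t" and h: "continuous_on {s..t} h" and \<epsilon>: "\<epsilon> > 0"
  defines "\<tau> \<equiv> dyadic_point s t"
  shows "eventually (\<lambda>N. \<forall>j<2^N. \<bar>h (\<tau> N (Suc j)) - h (\<tau> N j)\<bar> \<le> \<epsilon>) sequentially"
proof -
  note g = dyadic_grid[OF st, folded \<tau>_def]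
  have "uniformly_continuous_on {s..t} h" by (rule compact_uniformly_continuous[OF h]) simp
  then obtain d where d: "d > 0" "\<And>x y. x \<in> {s..t} \<Longrightarrow> y \<in> {s..t} \<Longrightarrow> dist y x < d \<Longrightarrow> dist (h y) (h x) < \<epsilon>"
    using \<epsilon> unfolding uniformly_continuous_on_def by meson
  have "(\<lambda>N. (t - s) / 2 ^ N) \<longlonglongrightarrow> 0"
    by (rule LIMSEQ_divide_realpow_zero) simp
  then have "eventually (\<lambda>N. (t - s) / 2 ^ N < d) sequentially"
    by (rule order_tendstoD) (rule d)
  then show ?thesis
  proof eventually_elim
    case (elim N)
    show ?case
    proof (intro allI impI)
      fix j :: nat assume j: "j < 2 ^ N"
      have "dist (\<tau> N (Suc j)) (\<tau> N j) < d"
        using elim g(6)[where N=N and k=j] st by (simp add: dist_real_def)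
      then have "dist (h (\<tau> N (Suc j))) (h (\<tau> N j)) < \<epsilon>"
        using j by (intro d g) auto
      then show "\<bar>h (\<tau> N (Suc j)) - h (\<tau> N j)\<bar> \<le> \<epsilon>" by (simp add: dist_real_def)
    qed
  qed
qed

text \<open>The limits are taken in this order: for fixed \<open>\<epsilon>\<close> the grid is
  refined, which removes the terms carried by the bad event, and only then \<open>\<epsilon>\<close>
  tends to 0.\<close>

lemma expi_increment_zero:
  assumes st: "s \<in> I" "t \<in> I" "s < t" and b: "b \<in> borel_measurable (F s)" and b1: "\<And>\<omega>. cmod (b \<omega>) \<le> 1"
  shows "(\<integral>\<omega>. b \<omega> * (expi u t \<omega> - expi u s \<omega>) \<partial>M) = 0"
proof -
  define \<tau> where "\<tau> = dyadic_point s t"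
  note g = dyadic_grid[OF st, folded \<tau>_def]
  define S where "S N \<omega> = runmax (\<lambda>k. X (\<tau> N k) \<omega>) (2 ^ N)" for N \<omega>
  define K where "K = exp (u\<^sup>2 * A t / 2)"
  let ?D = "cmod (\<integral>\<omega>. b \<omega> * (expi u t \<omega> - expi u s \<omega>) \<partial>M)"
  let ?C = "K\<^sup>2 * (u ^ 4 / 4 + \<bar>u\<bar> ^ 3) * (A t - A s)"
  have S2: "integrable M (\<lambda>\<omega>. (S N \<omega>)\<^sup>2)" "(\<integral>\<omega>. (S N \<omega>)\<^sup>2 \<partial>M) \<le> 4 * (\<integral>\<omega>. (X t \<omega>)\<^sup>2 \<partial>M)" for N
    using doob_grid[of "2 ^ N" "\<tau> N"] g(2,7) unfolding S_def g(4) by blast+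
  have S_mono: "(S N \<omega>)\<^sup>2 \<le> (S (Suc N) \<omega>)\<^sup>2" for N \<omega>
  proof (rule power_mono)
    show "S N \<omega> \<le> S (Suc N) \<omega>" unfolding S_def
    proof (rule runmax_le)
      fix j :: nat assume "j \<le> 2 ^ N"
      then have "2 * j \<le> 2 ^ Suc N" by simp
      from runmax_ge[OF this, of "\<lambda>k. X (\<tau> (Suc N) k) \<omega>"]
      show "\<bar>X (\<tau> N j) \<omega>\<bar> \<le> runmax (\<lambda>k. X (\<tau> (Suc N) k) \<omega>) (2 ^ Suc N)" by (simp only: g(5))
    qed
  qed (simp add: S_def runmax_nonneg)
  note [measurable] = borel_measurable_integrable[OF S2(1)]
  \<comment> \<open>A majorant for all grids at once. The squares increase with \<open>N\<close>, so
    monotone convergence passes the uniform Doob bound on to their supremum.\<close>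
  define w where "w \<omega> = (SUP N. ennreal ((S N \<omega>)\<^sup>2))" for \<omega>
  have w_int: "(\<integral>\<^sup>+\<omega>. w \<omega> \<partial>M) < \<infinity>"
  proof -
    have "(\<integral>\<^sup>+\<omega>. w \<omega> \<partial>M) = (SUP N. \<integral>\<^sup>+\<omega>. ennreal ((S N \<omega>)\<^sup>2) \<partial>M)" unfolding w_def
      by (rule nn_integral_monotone_convergence_SUP)
         (auto intro!: incseq_SucI le_funI ennreal_leI S_mono)
    also have "\<dots> \<le> ennreal (4 * (\<integral>\<omega>. (X t \<omega>)\<^sup>2 \<partial>M))"
      using S2 by (intro SUP_least) (simp add: nn_integral_eq_integral ennreal_leI)
    finally show ?thesis by (rule order.strict_trans1) simp
  qed
  have [measurable]: "w \<in> borel_measurable M" unfolding w_def[abs_def] by measurable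
  have main: "?D \<le> ?C * \<epsilon>" if \<epsilon>: "\<epsilon> > 0" for \<epsilon>
  proof -
    define bad where "bad N \<omega> = (\<not> (\<forall>j<2^N. \<bar>X (\<tau> N (Suc j)) \<omega> - X (\<tau> N j) \<omega>\<bar> \<le> \<epsilon>))" for N \<omega>
    have [measurable]: "Measurable.pred M (bad N)" for N
    proof -
      have "{\<omega> \<in> space M. bad N \<omega>} = (\<Union>j\<in>{..<2^N}. {\<omega> \<in> space M. \<not> \<bar>X (\<tau> N (Suc j)) \<omega> - X (\<tau> N j) \<omega>\<bar> \<le> \<epsilon>})"
        by (auto simp: bad_def)
      also have "\<dots> \<in> sets M"
      proof (rule sets.finite_UN)
        fix j :: nat assume "j \<in> {..<2^N}"
        then have [measurable]: "X (\<tau> N (Suc j)) \<in> borel_measurable M" "X (\<tau> N j) \<in> borel_measurable M"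
          by (auto intro!: X_M g)
        show "{\<omega> \<in> space M. \<not> \<bar>X (\<tau> N (Suc j)) \<omega> - X (\<tau> N j) \<omega>\<bar> \<le> \<epsilon>} \<in> sets M" by measurable
      qed simp
      finally show ?thesis by (simp add: pred_def)
    qed
    have bad_ev: "AE \<omega> in M. eventually (\<lambda>N. \<not> bad N \<omega>) sequentially"
      using X_cont
    proof eventually_elim
      case (elim \<omega>)
      have "continuous_on {s..t} (\<lambda>t. X t \<omega>)" using elim I_Icc[OF st(1,2)] by (rule continuous_on_subset)
      from dyadic_oscillation[OF st this \<epsilon>] show ?case by (simp add: bad_def \<tau>_def)
    qed
    \<comment> \<open>Serves twice, with \<open>f N\<close> the squared running maximum and with
      \<open>f N = 1\<close>. Dominated convergence is run in the extended nonnegative reals, where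
      the majorant \<open>w\<close> takes its values.\<close>
    have lim: "(\<lambda>N. \<integral>\<omega>. f N \<omega> * of_bool (bad N \<omega>) \<partial>M) \<longlonglongrightarrow> 0"
      if fm: "\<And>N. f N \<in> borel_measurable M" and f0: "\<And>N \<omega>. 0 \<le> f N \<omega>" and fi: "\<And>N. integrable M (f N)"
        and wm: "w' \<in> borel_measurable M" and wi: "(\<integral>\<^sup>+\<omega>. w' \<omega> \<partial>M) < \<infinity>" and fw: "\<And>N \<omega>. ennreal (f N \<omega>) \<le> w' \<omega>"
      for f :: "nat \<Rightarrow> 'a \<Rightarrow> real" and w'
    proof -
      note [measurable] = fm wm
      have "(\<lambda>N. \<integral>\<^sup>+\<omega>. ennreal (f N \<omega> * of_bool (bad N \<omega>)) \<partial>M) \<longlonglongrightarrow> (\<integral>\<^sup>+\<omega>. 0 \<partial>M)"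
      proof (rule nn_integral_dominated_convergence[OF _ _ wm _ wi])
        show "AE x in M. ennreal (f j x * of_bool (bad j x)) \<le> w' x" for j
          using fw by (intro AE_I2) (auto simp: of_bool_def)
        show "AE x in M. (\<lambda>i. ennreal (f i x * of_bool (bad i x))) \<longlonglongrightarrow> 0"
          using bad_ev
        proof eventually_elim
          case (elim x)
          then have "eventually (\<lambda>i. ennreal (f i x * of_bool (bad i x)) = 0) sequentially"
            by eventually_elim simp
          then show ?case by (rule tendsto_eventually)
        qed
      qed simp_all
      moreover have "(\<integral>\<^sup>+\<omega>. ennreal (f N \<omega> * of_bool (bad N \<omega>)) \<partial>M) = ennreal (\<integral>\<omega>. f N \<omega> * of_bool (bad N \<omega>) \<partial>M)" for N
      proof (rule nn_integral_eq_integral)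
        show "integrable M (\<lambda>\<omega>. f N \<omega> * of_bool (bad N \<omega>))"
          by (rule Bochner_Integration.integrable_bound[OF fi[of N]]) (auto simp: of_bool_def)
      qed (use f0 in auto)
      ultimately have "(\<lambda>N. ennreal (\<integral>\<omega>. f N \<omega> * of_bool (bad N \<omega>) \<partial>M)) \<longlonglongrightarrow> ennreal 0" by simp
      then show ?thesis
        by (subst (asm) tendsto_ennreal_iff) (use f0 in \<open>auto intro!: integral_nonneg\<close>)
    qed
    have l1: "(\<lambda>N. \<integral>\<omega>. (S N \<omega>)\<^sup>2 * of_bool (bad N \<omega>) \<partial>M) \<longlonglongrightarrow> 0"
      by (rule lim[OF _ _ S2(1) _ w_int]) (auto simp: w_def intro!: SUP_upper)
    have l2: "(\<lambda>N. \<integral>\<omega>. of_bool (bad N \<omega>) \<partial>M :: real) \<longlonglongrightarrow> 0"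
      using lim[of "\<lambda>_ _. 1" "\<lambda>_. 1"] by (simp add: emeasure_space_1)
    \<comment> \<open>\<open>\<epsilon>\<close> also plays the role of \<open>\<delta>\<close> in
      \<open>expi_grid_bound\<close>, which is admissible for all fine grids because
      \<open>A\<close> is uniformly continuous on the interval.\<close>
    have "eventually (\<lambda>N. ?D \<le> ?C * \<epsilon> + K\<^sup>2 * (4 * u\<^sup>2) * (\<integral>\<omega>. (S N \<omega>)\<^sup>2 * of_bool (bad N \<omega>) \<partial>M)
        + 2 * K * (\<integral>\<omega>. of_bool (bad N \<omega>) \<partial>M)) sequentially"
      using dyadic_oscillation[OF st continuous_on_subset[OF A_cont] \<epsilon>, folded \<tau>_def, simplified]
    proof eventually_elim
      case (elim N)
      have "?D \<le> K\<^sup>2 * (u ^ 4 / 4 * \<epsilon> + \<bar>u\<bar> ^ 3 * \<epsilon>) * (A t - A s) + K\<^sup>2 * (4 * u\<^sup>2) * (\<integral>\<omega>. (S N \<omega>)\<^sup>2 * of_bool (bad N \<omega>) \<partial>M)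
        + 2 * K * (\<integral>\<omega>. of_bool (bad N \<omega>) \<partial>M)"
        using expi_grid_bound[of "2 ^ N" "\<tau> N" \<epsilon> b \<epsilon> u] \<epsilon> b b1 g elim
        unfolding S_def bad_def K_def by (simp add: abs_le_iff)
      then show ?case by (simp add: algebra_simps)
    qed
    moreover have "(\<lambda>N. ?C * \<epsilon> + K\<^sup>2 * (4 * u\<^sup>2) * (\<integral>\<omega>. (S N \<omega>)\<^sup>2 * of_bool (bad N \<omega>) \<partial>M)
        + 2 * K * (\<integral>\<omega>. of_bool (bad N \<omega>) \<partial>M)) \<longlonglongrightarrow> ?C * \<epsilon> + K\<^sup>2 * (4 * u\<^sup>2) * 0 + 2 * K * 0"
      by (intro tendsto_intros l1 l2)
    ultimately show ?thesis
      using tendsto_lowerbound[of _ _ sequentially ?D] by simp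
  qed
  have "(\<lambda>n. ?C * inverse (real (Suc n))) \<longlonglongrightarrow> ?C * 0"
    by (intro tendsto_intros LIMSEQ_inverse_real_of_nat)
  then have "?D \<le> ?C * 0"
    by (rule LIMSEQ_le_const) (use main in auto)
  then show ?thesis by simp
qed

text \<open>The test function is the indicator of \<open>B\<close> times
  \<open>iexp (- (u * X s))\<close>, which removes \<open>X s\<close> from the exponent. As
  \<open>B\<close> ranges over \<open>F s\<close>, this determines the characteristic function of
  the increment conditionally on \<open>F s\<close>.\<close>

lemma char_increment:
  assumes st: "s \<in> I" "t \<in> I" "s \<le> t" and B: "B \<in> sets (F s)"
  shows "(\<integral>\<omega>. indicator B \<omega> * iexp (u * (X t \<omega> - X s \<omega>)) \<partial>M) = complex_of_real (prob B * exp (- (u\<^sup>2 * (A t - A s) / 2)))"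
proof -
  have BM [measurable]: "B \<in> sets M" using B subalg[OF st(1)] by (auto simp: subalgebra_def)
  note [measurable] = X_M[OF st(1)] X_M[OF st(2)]
  define b where "b \<omega> = indicator B \<omega> * iexp (- (u * X s \<omega>))" for \<omega>
  have bF: "b \<in> borel_measurable (F s)" unfolding b_def[abs_def] using X_F[OF st(1)] B by measurable
  have b1: "cmod (b \<omega>) \<le> 1" for \<omega> by (simp add: b_def norm_mult split: split_indicator)
  have "(\<integral>\<omega>. b \<omega> * (expi u t \<omega> - expi u s \<omega>) \<partial>M) = 0"
    using expi_increment_zero[OF st(1,2) _ bF b1] st(3) by (cases "s = t") auto
  moreover have "b \<omega> * (expi u t \<omega> - expi u s \<omega>) =
      complex_of_real (exp (u\<^sup>2 * A t / 2)) * (indicator B \<omega> * iexp (u * (X t \<omega> - X s \<omega>)))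
      - complex_of_real (exp (u\<^sup>2 * A s / 2) * indicator B \<omega>)" for \<omega>
  proof -
    have "iexp (- (u * X s \<omega>)) * expi u r \<omega> = complex_of_real (exp (u\<^sup>2 * A r / 2)) * iexp (u * (X r \<omega> - X s \<omega>))" for r
      unfolding expi_def exp_of_real[symmetric] mult_exp_exp
      by (rule arg_cong[where f = exp]) (simp add: algebra_simps)
    from this[of t] this[of s] show ?thesis
      by (simp add: b_def right_diff_distrib split: split_indicator)
  qed
  moreover have i1: "integrable M (\<lambda>\<omega>. indicator B \<omega> * iexp (u * (X t \<omega> - X s \<omega>)))"
    by (rule integrable_const_bound[of _ 1]) (auto simp: norm_mult split: split_indicator)
  moreover have i2: "integrable M (\<lambda>\<omega>. exp (u\<^sup>2 * A s / 2) * indicator B \<omega>)"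
    by (intro integrable_mult_right integrable_real_indicator) (auto simp: emeasure_eq_measure)
  ultimately have "complex_of_real (exp (u\<^sup>2 * A t / 2)) * (\<integral>\<omega>. indicator B \<omega> * iexp (u * (X t \<omega> - X s \<omega>)) \<partial>M)
     - complex_of_real (\<integral>\<omega>. exp (u\<^sup>2 * A s / 2) * indicator B \<omega> \<partial>M) = 0"
    by (simp only: Bochner_Integration.integral_diff[OF integrable_mult_right[OF i1] integrable_of_real[OF i2]]
        integral_mult_right_zero integral_complex_of_real)
  then have "complex_of_real (exp (u\<^sup>2 * A t / 2)) * (\<integral>\<omega>. indicator B \<omega> * iexp (u * (X t \<omega> - X s \<omega>)) \<partial>M)
     = complex_of_real (exp (u\<^sup>2 * A s / 2) * prob B)" by simp
  then have "(\<integral>\<omega>. indicator B \<omega> * iexp (u * (X t \<omega> - X s \<omega>)) \<partial>M) = complex_of_real (exp (u\<^sup>2 * A s / 2) * prob B) / complex_of_real (exp (u\<^sup>2 * A t / 2))"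
    by (simp add: field_simps)
  also have "\<dots> = complex_of_real (prob B * exp (u\<^sup>2 * A s / 2 - u\<^sup>2 * A t / 2))"
    by (simp add: exp_diff)
  also have "u\<^sup>2 * A s / 2 - u\<^sup>2 * A t / 2 = - (u\<^sup>2 * (A t - A s) / 2)" by (simp add: field_simps)
  finally show ?thesis .
qed

text \<open>For \<open>prob B > 0\<close> the increment has the Gaussian characteristic function
  under the measure conditioned on \<open>B\<close>, and Levy's uniqueness theorem identifies its
  law. Null events are separated because one cannot condition on them.\<close>

lemma increment_law:
  assumes st: "s \<in> I" "t \<in> I" "s \<le> t" and B: "B \<in> sets (F s)" and S: "S \<in> sets borel"
  shows "prob (B \<inter> {\<omega> \<in> space M. X t \<omega> - X s \<omega> \<in> S}) = prob B * measure (gauss (A t - A s)) S"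
proof (cases "prob B = 0")
  case True
  have "B \<in> sets M" using B subalg[OF st(1)] by (auto simp: subalgebra_def)
  then have "prob (B \<inter> {\<omega> \<in> space M. X t \<omega> - X s \<omega> \<in> S}) \<le> prob B" by (intro finite_measure_mono) auto
  then show ?thesis using True by (simp add: measure_le_0_iff)
next
  case False
  have BM [measurable]: "B \<in> sets M" using B subalg[OF st(1)] by (auto simp: subalgebra_def)
  note [measurable] = X_M[OF st(1)] X_M[OF st(2)] S
  define p where "p = prob B"
  have p: "p > 0" using False by (simp add: p_def zero_less_measure_iff)
  let ?U = "uniform_measure M B"
  let ?d = "\<lambda>\<omega>. X t \<omega> - X s \<omega>"
  have U: "?U = density M (\<lambda>\<omega>. ennreal (indicator B \<omega> / p))"
    unfolding uniform_measure_def emeasure_eq_measure p_def[symmetric]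
    using p by (intro density_cong) (auto simp: divide_ennreal[of 1 p, simplified] split: split_indicator)
  interpret U: prob_space ?U
    by (rule prob_space_uniform_measure) (use p in \<open>auto simp: emeasure_eq_measure p_def\<close>)
  have [measurable]: "?d \<in> borel_measurable ?U" by simp
  have v: "0 \<le> A t - A s" using monoD[OF A_mono st(3)] by simp
  have "distr ?U borel ?d = gauss (A t - A s)"
  proof (rule Levy_uniqueness)
    show "real_distribution (distr ?U borel ?d)" by (rule U.real_distribution_distr) simp
    show "real_distribution (gauss (A t - A s))" by (rule real_distribution_gauss)
    show "char (distr ?U borel ?d) = char (gauss (A t - A s))"
    proof
      fix u
      have "char (distr ?U borel ?d) u = (\<integral>\<omega>. iexp (u * ?d \<omega>) \<partial>?U)"
        unfolding char_def by (rule integral_distr) auto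
      also have "\<dots> = (\<integral>\<omega>. (indicator B \<omega> / p) *\<^sub>R iexp (u * ?d \<omega>) \<partial>M)"
        unfolding U using p by (intro integral_density) auto
      also have "\<dots> = (\<integral>\<omega>. complex_of_real (1 / p) * (indicator B \<omega> * iexp (u * ?d \<omega>)) \<partial>M)"
        by (intro Bochner_Integration.integral_cong) (auto simp: scaleR_conv_of_real split: split_indicator)
      also have "\<dots> = complex_of_real (1 / p) * complex_of_real (p * exp (- (u\<^sup>2 * (A t - A s) / 2)))"
        unfolding integral_mult_right_zero char_increment[OF st B] p_def ..
      also have "\<dots> = char (gauss (A t - A s)) u" using p by (simp add: char_gauss[OF v])
      finally show "char (distr ?U borel ?d) u = char (gauss (A t - A s)) u" .
    qed
  qed
  then have "measure (gauss (A t - A s)) S = measure (distr ?U borel ?d) S" by simp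
  also have "\<dots> = measure ?U {\<omega> \<in> space M. ?d \<omega> \<in> S}"
    by (subst measure_distr) (auto simp: vimage_def Int_def intro!: arg_cong[where f="measure ?U"])
  also have "\<dots> = prob (B \<inter> {\<omega> \<in> space M. ?d \<omega> \<in> S}) / p"
    unfolding p_def by (rule measure_uniform_measure) (use p in \<open>auto simp: emeasure_eq_measure p_def\<close>)
  finally show ?thesis using p by (simp add: p_def field_simps)
qed

end

section \<open>Square integrable functions\<close>

text \<open>A seminorm: functions that agree almost everywhere are not identified.\<close>

definition l2norm :: "'a measure \<Rightarrow> ('a \<Rightarrow> complex) \<Rightarrow> real" where
  "l2norm M f = sqrt (\<integral>\<omega>. (cmod (f \<omega>))\<^sup>2 \<partial>M)"

lemma l2norm_nonneg [simp]: "0 \<le> l2norm M f"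
  by (simp add: l2norm_def)

lemma l2norm_sq: "(l2norm M f)\<^sup>2 = (\<integral>\<omega>. (cmod (f \<omega>))\<^sup>2 \<partial>M)"
  by (simp add: l2norm_def)

lemma l2inner_self: "l2inner M f f = complex_of_real ((l2norm M f)\<^sup>2)"
  unfolding l2inner_def l2norm_sq by (simp add: complex_norm_square[symmetric] del: of_real_power)

lemma L2_D: "f \<in> L2 M \<Longrightarrow> f \<in> borel_measurable M" "f \<in> L2 M \<Longrightarrow> integrable M (\<lambda>\<omega>. (cmod (f \<omega>))\<^sup>2)"
  by (auto simp: L2_def)

lemma L2_zero: "(\<lambda>\<omega>. 0) \<in> L2 M"
  by (simp add: L2_def)

lemma L2_cmult: "f \<in> L2 M \<Longrightarrow> (\<lambda>\<omega>. k * f \<omega>) \<in> L2 M"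
  by (auto simp: L2_def norm_mult power_mult_distrib)

lemma L2_add:
  assumes "f \<in> L2 M" "g \<in> L2 M" shows "(\<lambda>\<omega>. f \<omega> + g \<omega>) \<in> L2 M"
proof -
  note [measurable] = L2_D(1)[OF assms(1)] L2_D(1)[OF assms(2)]
  have "integrable M (\<lambda>\<omega>. (cmod (f \<omega> + g \<omega>))\<^sup>2)"
  proof (rule Bochner_Integration.integrable_bound)
    show "integrable M (\<lambda>\<omega>. 2 * (cmod (f \<omega>))\<^sup>2 + 2 * (cmod (g \<omega>))\<^sup>2)"
      using L2_D(2)[OF assms(1)] L2_D(2)[OF assms(2)] by simp
    have "(cmod (x + y))\<^sup>2 \<le> 2 * (cmod x)\<^sup>2 + 2 * (cmod y)\<^sup>2" for x y
    proof -
      have "(cmod (x + y))\<^sup>2 \<le> (cmod x + cmod y)\<^sup>2" by (intro power_mono norm_triangle_ineq) simp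
      also have "\<dots> \<le> 2 * (cmod x)\<^sup>2 + 2 * (cmod y)\<^sup>2"
        using zero_le_power2[of "cmod x - cmod y"] by (simp add: power2_eq_square algebra_simps)
      finally show ?thesis .
    qed
    then show "AE \<omega> in M. norm ((cmod (f \<omega> + g \<omega>))\<^sup>2) \<le> norm (2 * (cmod (f \<omega>))\<^sup>2 + 2 * (cmod (g \<omega>))\<^sup>2)" by simp
  qed measurable
  then show ?thesis by (simp add: L2_def)
qed

lemma L2_diff: "f \<in> L2 M \<Longrightarrow> g \<in> L2 M \<Longrightarrow> (\<lambda>\<omega>. f \<omega> - g \<omega>) \<in> L2 M"
  using L2_add[OF _ L2_cmult[of g M "-1"]] by simp

lemma L2_sum_list:
  "(\<And>x. x \<in> set xs \<Longrightarrow> f x \<in> L2 M) \<Longrightarrow> (\<lambda>\<omega>. \<Sum>x\<leftarrow>xs. f x \<omega>) \<in> L2 M"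
  by (induction xs) (auto intro: L2_zero L2_add)

lemma L2_norm_mult_integrable:
  assumes "f \<in> L2 M" "g \<in> L2 M" shows "integrable M (\<lambda>\<omega>. cmod (f \<omega>) * cmod (g \<omega>))"
  by (rule integrable_mult_of_square_integrable) (use assms in \<open>auto simp: L2_def\<close>)

lemma L2_mult_cnj_integrable:
  assumes "f \<in> L2 M" "g \<in> L2 M" shows "integrable M (\<lambda>\<omega>. f \<omega> * cnj (g \<omega>))"
  by (rule integrable_mult_of_square_integrable) (use assms in \<open>auto simp: L2_def intro: cnj_measurable\<close>)

lemma L2_Cauchy_Schwarz_norm:
  assumes "f \<in> L2 M" "g \<in> L2 M"
  shows "(\<integral>\<omega>. cmod (f \<omega>) * cmod (g \<omega>) \<partial>M) \<le> l2norm M f * l2norm M g"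
proof -
  note [measurable] = L2_D(1)[OF assms(1)] L2_D(1)[OF assms(2)]
  let ?I = "\<integral>\<omega>. cmod (f \<omega>) * cmod (g \<omega>) \<partial>M"
  have I0: "0 \<le> ?I" by (rule Bochner_Integration.integral_nonneg) auto
  have "(\<integral>\<^sup>+\<omega>. ennreal (cmod (f \<omega>)) * ennreal (cmod (g \<omega>)) \<partial>M) = ennreal ?I"
    using L2_norm_mult_integrable[OF assms] by (subst nn_integral_eq_integral[symmetric]) (auto simp: ennreal_mult)
  moreover have "(\<integral>\<^sup>+\<omega>. (ennreal (cmod (f \<omega>)))\<^sup>2 \<partial>M) = ennreal ((l2norm M f)\<^sup>2)" if "f \<in> L2 M" for f
    using L2_D(2)[OF that] unfolding l2norm_sq
    by (subst nn_integral_eq_integral[symmetric]) (auto simp: ennreal_power)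
  ultimately have "(ennreal ?I)\<^sup>2 \<le> ennreal ((l2norm M f)\<^sup>2) * ennreal ((l2norm M g)\<^sup>2)"
    using Cauchy_Schwarz_nn_integral[of "\<lambda>\<omega>. ennreal (cmod (f \<omega>))" M "\<lambda>\<omega>. ennreal (cmod (g \<omega>))"] assms by simp
  then have "ennreal (?I\<^sup>2) \<le> ennreal ((l2norm M f)\<^sup>2 * (l2norm M g)\<^sup>2)"
    using I0 by (simp only: ennreal_power ennreal_mult'[symmetric] zero_le_power2)
  then have "?I\<^sup>2 \<le> (l2norm M f * l2norm M g)\<^sup>2"
    by (simp add: power_mult_distrib ennreal_le_iff)
  then show ?thesis by (rule power2_le_imp_le) simp
qed

lemma l2inner_Cauchy_Schwarz:
  assumes "f \<in> L2 M" "g \<in> L2 M" shows "cmod (l2inner M f g) \<le> l2norm M f * l2norm M g"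
proof -
  have "cmod (l2inner M f g) \<le> (\<integral>\<omega>. cmod (f \<omega>) * cmod (g \<omega>) \<partial>M)"
    unfolding l2inner_def by (rule order.trans[OF integral_norm_bound]) (simp add: norm_mult)
  then show ?thesis using L2_Cauchy_Schwarz_norm[OF assms] by simp
qed

lemma l2norm_triangle:
  assumes "f \<in> L2 M" "g \<in> L2 M" shows "l2norm M (\<lambda>\<omega>. f \<omega> + g \<omega>) \<le> l2norm M f + l2norm M g"
proof (rule power2_le_imp_le)
  have i: "integrable M (\<lambda>\<omega>. (cmod (f \<omega>))\<^sup>2)" "integrable M (\<lambda>\<omega>. (cmod (g \<omega>))\<^sup>2)"
    "integrable M (\<lambda>\<omega>. 2 * (cmod (f \<omega>) * cmod (g \<omega>)))"
    using L2_D(2)[OF assms(1)] L2_D(2)[OF assms(2)] L2_norm_mult_integrable[OF assms] by simp_all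
  have "(l2norm M (\<lambda>\<omega>. f \<omega> + g \<omega>))\<^sup>2 \<le> (\<integral>\<omega>. (cmod (f \<omega>))\<^sup>2 + (cmod (g \<omega>))\<^sup>2 + 2 * (cmod (f \<omega>) * cmod (g \<omega>)) \<partial>M)"
    unfolding l2norm_sq
  proof (rule integral_mono)
    show "integrable M (\<lambda>\<omega>. (cmod (f \<omega> + g \<omega>))\<^sup>2)" using L2_D(2)[OF L2_add[OF assms]] .
    show "integrable M (\<lambda>\<omega>. (cmod (f \<omega>))\<^sup>2 + (cmod (g \<omega>))\<^sup>2 + 2 * (cmod (f \<omega>) * cmod (g \<omega>)))"
      using i by (intro Bochner_Integration.integrable_add)
    fix \<omega>
    have "(cmod (f \<omega> + g \<omega>))\<^sup>2 \<le> (cmod (f \<omega>) + cmod (g \<omega>))\<^sup>2" by (intro power_mono norm_triangle_ineq) simp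
    then show "(cmod (f \<omega> + g \<omega>))\<^sup>2 \<le> (cmod (f \<omega>))\<^sup>2 + (cmod (g \<omega>))\<^sup>2 + 2 * (cmod (f \<omega>) * cmod (g \<omega>))"
      by (simp add: power2_sum mult.assoc)
  qed
  also have "\<dots> = (l2norm M f)\<^sup>2 + (l2norm M g)\<^sup>2 + 2 * (\<integral>\<omega>. cmod (f \<omega>) * cmod (g \<omega>) \<partial>M)"
    unfolding l2norm_sq using i by (simp only: Bochner_Integration.integral_add[OF Bochner_Integration.integrable_add[OF i(1,2)] i(3)]
        Bochner_Integration.integral_add[OF i(1,2)] integral_mult_right_zero)
  also have "\<dots> \<le> (l2norm M f + l2norm M g)\<^sup>2"
    using L2_Cauchy_Schwarz_norm[OF assms] by (simp add: power2_sum)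
  finally show "(l2norm M (\<lambda>\<omega>. f \<omega> + g \<omega>))\<^sup>2 \<le> (l2norm M f + l2norm M g)\<^sup>2" .
qed simp

lemma l2norm_cmult: "l2norm M (\<lambda>\<omega>. k * f \<omega>) = cmod k * l2norm M f"
  by (simp add: l2norm_def norm_mult power_mult_distrib real_sqrt_mult)

lemma l2norm_minus_commute: "l2norm M (\<lambda>\<omega>. f \<omega> - g \<omega>) = l2norm M (\<lambda>\<omega>. g \<omega> - f \<omega>)"
  by (simp add: l2norm_def norm_minus_commute)

lemma l2norm_triangle_diff:
  assumes "f \<in> L2 M" "g \<in> L2 M" "h \<in> L2 M"
  shows "l2norm M (\<lambda>\<omega>. f \<omega> - h \<omega>) \<le> l2norm M (\<lambda>\<omega>. f \<omega> - g \<omega>) + l2norm M (\<lambda>\<omega>. g \<omega> - h \<omega>)"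
  using l2norm_triangle[OF L2_diff[OF assms(1,2)] L2_diff[OF assms(2,3)]] by simp

lemma l2norm_diff_le:
  assumes "f \<in> L2 M" "g \<in> L2 M"
  shows "\<bar>l2norm M f - l2norm M g\<bar> \<le> l2norm M (\<lambda>\<omega>. f \<omega> - g \<omega>)"
  using l2norm_triangle[OF L2_diff[OF assms] assms(2)] l2norm_triangle[OF L2_diff[OF assms(2,1)] assms(1)]
  by (simp add: l2norm_minus_commute[of M g f])

lemma l2conv_iff_l2norm:
  "l2conv M u f \<longleftrightarrow> (\<forall>n. u n \<in> L2 M) \<and> f \<in> L2 M \<and> (\<lambda>n. l2norm M (\<lambda>\<omega>. u n \<omega> - f \<omega>)) \<longlonglongrightarrow> 0"
proof -
  have "(\<lambda>n. \<integral>\<omega>. (cmod (u n \<omega> - f \<omega>))\<^sup>2 \<partial>M) \<longlonglongrightarrow> 0" if "(\<lambda>n. l2norm M (\<lambda>\<omega>. u n \<omega> - f \<omega>)) \<longlonglongrightarrow> 0"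
    using tendsto_power[OF that, of 2] by (simp add: l2norm_sq)
  moreover have "(\<lambda>n. l2norm M (\<lambda>\<omega>. u n \<omega> - f \<omega>)) \<longlonglongrightarrow> 0" if "(\<lambda>n. \<integral>\<omega>. (cmod (u n \<omega> - f \<omega>))\<^sup>2 \<partial>M) \<longlonglongrightarrow> 0"
    using tendsto_real_sqrt[OF that] by (simp add: l2norm_def)
  ultimately show ?thesis unfolding l2conv_def by blast
qed

lemma l2conv_l2norm:
  assumes "l2conv M u f" shows "(\<lambda>n. l2norm M (u n)) \<longlonglongrightarrow> l2norm M f"
proof -
  have a: "\<And>n. u n \<in> L2 M" "f \<in> L2 M" "(\<lambda>n. l2norm M (\<lambda>\<omega>. u n \<omega> - f \<omega>)) \<longlonglongrightarrow> 0"
    using assms by (auto simp: l2conv_iff_l2norm)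
  have "(\<lambda>n. l2norm M (u n) - l2norm M f) \<longlonglongrightarrow> 0"
    by (rule Lim_null_comparison[OF _ a(3)]) (use l2norm_diff_le[OF a(1,2)] in simp)
  then show ?thesis by (simp add: LIM_zero_iff)
qed

lemma l2conv_Cauchy:
  assumes "l2conv M u f" "e > 0"
  shows "\<exists>N. \<forall>m\<ge>N. \<forall>n\<ge>N. l2norm M (\<lambda>\<omega>. u n \<omega> - u m \<omega>) < e"
proof -
  have a: "\<And>n. u n \<in> L2 M" "f \<in> L2 M" "(\<lambda>n. l2norm M (\<lambda>\<omega>. u n \<omega> - f \<omega>)) \<longlonglongrightarrow> 0"
    using assms by (auto simp: l2conv_iff_l2norm)
  from order_tendstoD(2)[OF a(3), of "e / 2"] assms(2) obtain N
    where N: "\<And>n. n \<ge> N \<Longrightarrow> l2norm M (\<lambda>\<omega>. u n \<omega> - f \<omega>) < e / 2"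
    by (auto simp: eventually_sequentially)
  have "l2norm M (\<lambda>\<omega>. u n \<omega> - u m \<omega>) < e" if "m \<ge> N" "n \<ge> N" for m n
    using l2norm_triangle_diff[OF a(1)[of n] a(2) a(1)[of m]] N[OF that(1)] N[OF that(2)]
    by (simp add: l2norm_minus_commute[of M f])
  then show ?thesis by blast
qed

text \<open>Multiplication by \<open>h\<close> is a closed operator; Fatou's lemma along an a.e. convergent
  subsequence replaces completeness of the space.\<close>

lemma l2conv_mult_closed:
  assumes u: "l2conv M u f" and h [measurable]: "h \<in> borel_measurable M"
    and hu: "\<And>n. (\<lambda>\<omega>. h \<omega> * u n \<omega>) \<in> L2 M"
    and C: "\<And>e. e > 0 \<Longrightarrow> \<exists>N. \<forall>m\<ge>N. \<forall>n\<ge>N. l2norm M (\<lambda>\<omega>. h \<omega> * u n \<omega> - h \<omega> * u m \<omega>) < e"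
  shows "l2conv M (\<lambda>n \<omega>. h \<omega> * u n \<omega>) (\<lambda>\<omega>. h \<omega> * f \<omega>)"
proof -
  have a: "\<And>n. u n \<in> L2 M" "f \<in> L2 M" "(\<lambda>n. \<integral>\<omega>. (cmod (u n \<omega> - f \<omega>))\<^sup>2 \<partial>M) \<longlonglongrightarrow> 0"
    using u by (auto simp: l2conv_def)
  note [measurable] = L2_D(1)[OF a(1)] L2_D(1)[OF a(2)]
  have "\<exists>r. strict_mono r \<and> (AE \<omega> in M. (\<lambda>n. (cmod (u (r n) \<omega> - f \<omega>))\<^sup>2) \<longlonglongrightarrow> 0)"
    using tendsto_L1_AE_subseq[of M "\<lambda>n \<omega>. (cmod (u n \<omega> - f \<omega>))\<^sup>2"] L2_D(2)[OF L2_diff[OF a(1,2)]] a(3) by auto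
  then obtain r where r: "strict_mono r" and ae: "AE \<omega> in M. (\<lambda>n. (cmod (u (r n) \<omega> - f \<omega>))\<^sup>2) \<longlonglongrightarrow> 0" by blast
  \<comment> \<open>One index is kept fixed while the other runs along the subsequence. The bound is
    stated with an extended integral because square integrability of \<open>h * f\<close> is only
    deduced from it.\<close>
  have key: "(\<integral>\<^sup>+\<omega>. ennreal ((cmod (h \<omega> * u n \<omega> - h \<omega> * f \<omega>))\<^sup>2) \<partial>M) \<le> ennreal (e\<^sup>2)"
    if e: "e > 0" and N: "\<forall>m\<ge>N. \<forall>n\<ge>N. l2norm M (\<lambda>\<omega>. h \<omega> * u n \<omega> - h \<omega> * u m \<omega>) < e" and n: "n \<ge> N" for e N n
  proof -
    have "(\<integral>\<^sup>+\<omega>. ennreal ((cmod (h \<omega> * u n \<omega> - h \<omega> * f \<omega>))\<^sup>2) \<partial>M)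
       = (\<integral>\<^sup>+\<omega>. liminf (\<lambda>m. ennreal ((cmod (h \<omega> * u n \<omega> - h \<omega> * u (r m) \<omega>))\<^sup>2)) \<partial>M)"
    proof (rule nn_integral_cong_AE, use ae in eventually_elim)
      case (elim \<omega>)
      have "(\<lambda>m. cmod (u (r m) \<omega> - f \<omega>)) \<longlonglongrightarrow> 0"
        using tendsto_real_sqrt[OF elim] by simp
      then have "(\<lambda>m. u (r m) \<omega>) \<longlonglongrightarrow> f \<omega>"
        by (simp add: tendsto_norm_zero_iff LIM_zero_iff)
      then have "(\<lambda>m. ennreal ((cmod (h \<omega> * u n \<omega> - h \<omega> * u (r m) \<omega>))\<^sup>2)) \<longlonglongrightarrow> ennreal ((cmod (h \<omega> * u n \<omega> - h \<omega> * f \<omega>))\<^sup>2)"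
        by (intro tendsto_intros)
      from lim_imp_Liminf[OF sequentially_bot this] show ?case by simp
    qed
    also have "\<dots> \<le> liminf (\<lambda>m. \<integral>\<^sup>+\<omega>. ennreal ((cmod (h \<omega> * u n \<omega> - h \<omega> * u (r m) \<omega>))\<^sup>2) \<partial>M)"
      by (rule nn_integral_liminf) measurable
    also have "\<dots> \<le> ennreal (e\<^sup>2)"
    proof (rule Liminf_le)
      show "eventually (\<lambda>m. (\<integral>\<^sup>+\<omega>. ennreal ((cmod (h \<omega> * u n \<omega> - h \<omega> * u (r m) \<omega>))\<^sup>2) \<partial>M) \<le> ennreal (e\<^sup>2)) sequentially"
        using eventually_ge_at_top[of N]
      proof eventually_elim
        case (elim m)
        have "r m \<ge> N" using seq_suble[OF r, of m] elim by linarith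
        then have "l2norm M (\<lambda>\<omega>. h \<omega> * u n \<omega> - h \<omega> * u (r m) \<omega>) < e" using N n by blast
        then have "(l2norm M (\<lambda>\<omega>. h \<omega> * u n \<omega> - h \<omega> * u (r m) \<omega>))\<^sup>2 \<le> e\<^sup>2"
          by (intro power_mono) auto
        moreover have "(\<integral>\<^sup>+\<omega>. ennreal ((cmod (h \<omega> * u n \<omega> - h \<omega> * u (r m) \<omega>))\<^sup>2) \<partial>M)
           = ennreal ((l2norm M (\<lambda>\<omega>. h \<omega> * u n \<omega> - h \<omega> * u (r m) \<omega>))\<^sup>2)"
          unfolding l2norm_sq using L2_D(2)[OF L2_diff[OF hu[of n] hu[of "r m"]]] by (intro nn_integral_eq_integral) auto
        ultimately show ?case by (simp add: ennreal_leI)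
      qed
    qed simp
    finally show ?thesis .
  qed
  have dL2: "(\<lambda>\<omega>. h \<omega> * u n \<omega> - h \<omega> * f \<omega>) \<in> L2 M" if "e > 0" "\<forall>m\<ge>N. \<forall>n\<ge>N. l2norm M (\<lambda>\<omega>. h \<omega> * u n \<omega> - h \<omega> * u m \<omega>) < e" "n \<ge> N" for e N n
    using key[OF that] unfolding L2_def
    by (auto intro!: integrableI_bounded le_less_trans[OF key[OF that]])
  obtain N1 where N1: "\<forall>m\<ge>N1. \<forall>n\<ge>N1. l2norm M (\<lambda>\<omega>. h \<omega> * u n \<omega> - h \<omega> * u m \<omega>) < 1" using C[of 1] by auto
  have hf: "(\<lambda>\<omega>. h \<omega> * f \<omega>) \<in> L2 M"
    using L2_diff[OF hu[of N1] dL2[OF _ N1, of N1]] by simp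
  have "(\<lambda>n. l2norm M (\<lambda>\<omega>. h \<omega> * u n \<omega> - h \<omega> * f \<omega>)) \<longlonglongrightarrow> 0"
  proof (rule LIMSEQ_I)
    fix e :: real assume e: "e > 0"
    obtain N where N: "\<forall>m\<ge>N. \<forall>n\<ge>N. l2norm M (\<lambda>\<omega>. h \<omega> * u n \<omega> - h \<omega> * u m \<omega>) < e / 2" using C[of "e / 2"] e by auto
    have "l2norm M (\<lambda>\<omega>. h \<omega> * u n \<omega> - h \<omega> * f \<omega>) < e" if "n \<ge> N" for n
    proof -
      have "ennreal ((l2norm M (\<lambda>\<omega>. h \<omega> * u n \<omega> - h \<omega> * f \<omega>))\<^sup>2) \<le> ennreal ((e / 2)\<^sup>2)"
        using key[OF _ N that] e L2_D(2)[OF L2_diff[OF hu[of n] hf]] unfolding l2norm_sq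
        by (subst nn_integral_eq_integral[symmetric]) auto
      then have "(l2norm M (\<lambda>\<omega>. h \<omega> * u n \<omega> - h \<omega> * f \<omega>))\<^sup>2 \<le> (e / 2)\<^sup>2" by (simp add: ennreal_le_iff)
      then have "l2norm M (\<lambda>\<omega>. h \<omega> * u n \<omega> - h \<omega> * f \<omega>) \<le> e / 2" by (rule power2_le_imp_le) (use e in simp)
      then show ?thesis using e by simp
    qed
    then show "\<exists>no. \<forall>n\<ge>no. norm (l2norm M (\<lambda>\<omega>. h \<omega> * u n \<omega> - h \<omega> * f \<omega>) - 0) < e" by auto
  qed
  then show ?thesis using hu hf by (simp add: l2conv_iff_l2norm)
qed

lemma l2inner_sum_list:
  assumes "\<And>x. x \<in> set xs \<Longrightarrow> f x \<in> L2 M" "\<And>y. y \<in> set ys \<Longrightarrow> h y \<in> L2 M"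
  shows "l2inner M (\<lambda>\<omega>. \<Sum>x\<leftarrow>xs. f x \<omega>) (\<lambda>\<omega>. \<Sum>y\<leftarrow>ys. h y \<omega>) = (\<Sum>x\<leftarrow>xs. \<Sum>y\<leftarrow>ys. l2inner M (f x) (h y))"
proof -
  have add1: "l2inner M (\<lambda>\<omega>. p \<omega> + q \<omega>) r = l2inner M p r + l2inner M q r"
    if "p \<in> L2 M" "q \<in> L2 M" "r \<in> L2 M" for p q r
    using L2_mult_cnj_integrable[OF that(1,3)] L2_mult_cnj_integrable[OF that(2,3)] by (simp add: l2inner_def distrib_right)
  have add2: "l2inner M r (\<lambda>\<omega>. p \<omega> + q \<omega>) = l2inner M r p + l2inner M r q"
    if "p \<in> L2 M" "q \<in> L2 M" "r \<in> L2 M" for p q r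
    using L2_mult_cnj_integrable[OF that(3,1)] L2_mult_cnj_integrable[OF that(3,2)] by (simp add: l2inner_def distrib_left)
  have 2: "l2inner M r (\<lambda>\<omega>. \<Sum>y\<leftarrow>ys. h y \<omega>) = (\<Sum>y\<leftarrow>ys. l2inner M r (h y))" if "r \<in> L2 M" for r
    using assms(2)
  proof (induction ys)
    case (Cons y ys)
    then show ?case using that by (simp add: add2 L2_sum_list)
  qed (simp add: l2inner_def)
  have H: "(\<lambda>\<omega>. \<Sum>y\<leftarrow>ys. h y \<omega>) \<in> L2 M" using assms(2) by (rule L2_sum_list)
  show ?thesis using assms(1)
  proof (induction xs)
    case (Cons x xs)
    then show ?case using H by (simp add: add1 2 L2_sum_list)
  qed (simp add: l2inner_def)
qed

section \<open>Exponential moments of the normal distribution\<close>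

text \<open>The integrand of the moment generating function of the standard normal law at the
  complex argument \<open>k\<close>.\<close>

definition gker :: "complex \<Rightarrow> real \<Rightarrow> complex" where
  "gker k x = complex_of_real (std_normal_density x) * exp (k * complex_of_real x)"

lemma std_normal_density_tilt:
  "std_normal_density x * exp (p * x) = exp (p\<^sup>2 / 2) * std_normal_density (x - p)"
proof -
  have "exp (- x\<^sup>2 / 2) * exp (p * x) = exp (p\<^sup>2 / 2) * exp (- (x - p)\<^sup>2 / 2)"
    unfolding mult_exp_exp by (rule arg_cong[where f = exp]) (simp add: power2_eq_square field_simps)
  then show ?thesis by (simp add: std_normal_density_def)
qed

lemma norm_gker: "cmod (gker k x) = exp ((Re k)\<^sup>2 / 2) * std_normal_density (x - Re k)"
proof -
  have "cmod (gker k x) = std_normal_density x * exp (Re k * x)"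
    by (simp add: gker_def norm_mult norm_exp)
  also have "\<dots> = exp ((Re k)\<^sup>2 / 2) * std_normal_density (x - Re k)"
    by (rule std_normal_density_tilt)
  finally show ?thesis .
qed

text \<open>The real part of the parameter tilts the density, which amounts to a translation and a
  constant; the imaginary part remains as an oscillation. Complex exponential moments are thereby
  reduced to the characteristic function, without analytic continuation.\<close>

lemma gker_shift: "gker (complex_of_real p + \<i> * complex_of_real q) x =
    complex_of_real (exp (p\<^sup>2 / 2)) * (complex_of_real (std_normal_density (x - p)) * iexp (q * x))"
proof -
  have e: "complex_of_real (std_normal_density x) * complex_of_real (exp (p * x)) = complex_of_real (exp (p\<^sup>2 / 2)) * complex_of_real (std_normal_density (x - p))"
    by (simp only: of_real_mult[symmetric] std_normal_density_tilt)
  have "exp ((complex_of_real p + \<i> * complex_of_real q) * complex_of_real x) = complex_of_real (exp (p * x)) * iexp (q * x)"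
    unfolding exp_of_real[symmetric] mult_exp_exp by (rule arg_cong[where f = exp]) (simp add: algebra_simps)
  then show ?thesis using e by (simp add: gker_def mult.assoc[symmetric])
qed

lemma gker_measurable [measurable]: "gker k \<in> borel_measurable borel"
proof -
  have [measurable]: "(\<lambda>x. exp (k * complex_of_real x)) \<in> borel_measurable borel"
    by (intro borel_measurable_continuous_onI continuous_intros)
  show ?thesis unfolding gker_def[abs_def] by measurable
qed

text \<open>By \<open>norm_gker\<close> the modulus is a multiple of a translated normal density, so
  a translation and the moments of the standard normal law suffice.\<close>

lemma integrable_gker:
  assumes "j \<le> 2"
  shows "integrable lborel (\<lambda>x. complex_of_real x ^ j * gker k x)"
proof -
  define p where "p = Re k"
  have m: "integrable lborel (\<lambda>y. std_normal_density y * y ^ i)" for i by (rule integrable_std_normal_moment)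
  have "integrable lborel (\<lambda>y. std_normal_density y * (y + p) ^ j)"
  proof -
    consider "j = 0" | "j = 1" | "j = 2" using assms by linarith
    then show ?thesis
    proof cases
      case 1 then show ?thesis using m[of 0] by simp
    next
      case 2
      have "integrable lborel (\<lambda>y. std_normal_density y * y ^ 1 + p * (std_normal_density y * y ^ 0))"
        by (intro Bochner_Integration.integrable_add integrable_mult_right m)
      then show ?thesis using 2 by (simp add: algebra_simps)
    next
      case 3
      have "integrable lborel (\<lambda>y. std_normal_density y * y ^ 2 + 2 * p * (std_normal_density y * y ^ 1) + p\<^sup>2 * (std_normal_density y * y ^ 0))"
        by (intro Bochner_Integration.integrable_add integrable_mult_right m)
      then show ?thesis using 3 by (simp add: algebra_simps power2_eq_square)
    qed
  qed
  from lborel_integrable_real_affine[OF this, of 1 "- p"]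
  have i: "integrable lborel (\<lambda>x. exp (p\<^sup>2 / 2) * (std_normal_density (x - p) * x ^ j))"
    by simp
  show ?thesis
  proof (rule Bochner_Integration.integrable_bound[OF i])
    show "AE x in lborel. norm (complex_of_real x ^ j * gker k x) \<le> norm (exp (p\<^sup>2 / 2) * (std_normal_density (x - p) * x ^ j))"
      by (rule AE_I2) (simp add: norm_mult norm_gker p_def abs_mult norm_power power_abs)
  qed measurable
qed

lemma integral_gker: "(\<integral>x. gker k x \<partial>lborel) = exp (k\<^sup>2 / 2)"
proof -
  define p q where "p = Re k" and "q = Im k"
  have k: "k = complex_of_real p + \<i> * complex_of_real q" by (simp add: p_def q_def complex_eq_iff)
  have ch: "(\<integral>x. complex_of_real (std_normal_density x) * iexp (q * x) \<partial>lborel) = complex_of_real (exp (- (q\<^sup>2) / 2))"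
  proof -
    have "char std_normal_distribution q = (\<integral>x. std_normal_density x *\<^sub>R iexp (q * x) \<partial>lborel)"
      unfolding char_def by (subst integral_density) (auto simp: normal_density_nonneg)
    then show ?thesis by (simp add: char_std_normal_distribution scaleR_conv_of_real)
  qed
  have "(\<integral>x. gker k x \<partial>lborel) = complex_of_real (exp (p\<^sup>2 / 2)) * (\<integral>x. complex_of_real (std_normal_density (x - p)) * iexp (q * x) \<partial>lborel)"
    unfolding k gker_shift by (rule integral_mult_right_zero)
  \<comment> \<open>Translation by \<open>p\<close> recentres the tilted density and leaves the
    phase \<open>iexp (q * p)\<close>.\<close>
  also have "(\<integral>x. complex_of_real (std_normal_density (x - p)) * iexp (q * x) \<partial>lborel) =
      (\<integral>x. complex_of_real (std_normal_density x) * iexp (q * (p + x)) \<partial>lborel)"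
    by (subst lborel_integral_real_affine[of 1 _ p]) auto
  also have "\<dots> = (\<integral>x. iexp (q * p) * (complex_of_real (std_normal_density x) * iexp (q * x)) \<partial>lborel)"
    by (intro Bochner_Integration.integral_cong refl) (simp add: exp_add distrib_left)
  also have "\<dots> = iexp (q * p) * complex_of_real (exp (- (q\<^sup>2) / 2))"
    unfolding integral_mult_right_zero ch ..
  also have "complex_of_real (exp (p\<^sup>2 / 2)) * (iexp (q * p) * complex_of_real (exp (- (q\<^sup>2) / 2))) = exp (k\<^sup>2 / 2)"
    unfolding exp_of_real[symmetric] mult_exp_exp
    by (rule arg_cong[where f = exp]) (simp add: k power2_eq_square field_simps)
  finally show ?thesis .
qed

lemma gker_deriv: "(gker k has_vector_derivative (k - complex_of_real x) * gker k x) (at x)"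
proof -
  have "(std_normal_density has_real_derivative (- x * std_normal_density x)) (at x)"
    unfolding std_normal_density_def[abs_def]
    by (auto intro!: derivative_eq_intros simp: field_simps power2_eq_square)
  then have d: "((\<lambda>x. complex_of_real (std_normal_density x)) has_vector_derivative complex_of_real (- x * std_normal_density x)) (at x)"
    by (intro has_vector_derivative_of_real) (simp add: has_real_derivative_iff_has_vector_derivative)
  have "((\<lambda>z. exp (k * z)) has_field_derivative (k * exp (k * complex_of_real x))) (at (complex_of_real x))"
    by (auto intro!: derivative_eq_intros)
  from has_vector_derivative_real_field[OF this]
  have e: "((\<lambda>x. exp (k * complex_of_real x)) has_vector_derivative (k * exp (k * complex_of_real x))) (at x)" .
  show ?thesis unfolding gker_def[abs_def]
    by (rule has_vector_derivative_eq_rhs[OF has_vector_derivative_mult[OF d e]]) (simp add: gker_def algebra_simps)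
qed

lemma gker_lim:
  assumes "j \<le> 1"
  shows "((\<lambda>x. complex_of_real x ^ j * gker k x) \<longlongrightarrow> 0) at_top" "((\<lambda>x. complex_of_real x ^ j * gker k x) \<longlongrightarrow> 0) at_bot"
proof -
  define p where "p = Re k"
  have n: "norm (complex_of_real x ^ j * gker k x) = exp (p\<^sup>2 / 2) * (\<bar>x\<bar> ^ j * ((1 / sqrt (2 * pi)) * exp (- (x - p)\<^sup>2 / 2)))" for x
    by (simp add: norm_mult norm_gker p_def norm_power std_normal_density_def)
  have "((\<lambda>x::real. \<bar>x\<bar> ^ j * ((1 / sqrt (2 * pi)) * exp (- (x - p)\<^sup>2 / 2))) \<longlongrightarrow> 0) at_top"
    "((\<lambda>x::real. \<bar>x\<bar> ^ j * ((1 / sqrt (2 * pi)) * exp (- (x - p)\<^sup>2 / 2))) \<longlongrightarrow> 0) at_bot"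
    using assms by (cases "j = 0"; simp; real_asymp)+
  then have "((\<lambda>x. norm (complex_of_real x ^ j * gker k x)) \<longlongrightarrow> 0) at_top" "((\<lambda>x. norm (complex_of_real x ^ j * gker k x)) \<longlongrightarrow> 0) at_bot"
    unfolding n using tendsto_mult_right_zero by blast+
  then show "((\<lambda>x. complex_of_real x ^ j * gker k x) \<longlongrightarrow> 0) at_top" "((\<lambda>x. complex_of_real x ^ j * gker k x) \<longlongrightarrow> 0) at_bot"
    by (simp_all only: tendsto_norm_zero_iff)
qed

lemma integral_derivative_zero:
  fixes f F :: "real \<Rightarrow> complex"
  assumes F: "\<And>x. (F has_vector_derivative f x) (at x)" and c: "\<And>x. isCont f x" and i: "integrable lborel f"
    and l: "(F \<longlongrightarrow> 0) at_top" "(F \<longlongrightarrow> 0) at_bot"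
  shows "(\<integral>x. f x \<partial>lborel) = 0"
proof -
  have "(LBINT x=-\<infinity>..\<infinity>. f x) = 0 - 0"
  proof (rule interval_integral_FTC_integrable[where F = F])
    show "set_integrable lborel (einterval (- \<infinity>) \<infinity>) f" using i by (simp add: set_integrable_def einterval_def)
    show "((F \<circ> real_of_ereal) \<longlongrightarrow> 0) (at_right (- \<infinity>))" "((F \<circ> real_of_ereal) \<longlongrightarrow> 0) (at_left \<infinity>)"
      using l by (simp_all only: ereal_tendsto_simps)
  qed (use F c in auto)
  then show ?thesis by (simp add: interval_lebesgue_integral_def set_lebesgue_integral_def einterval_def)
qed

lemma isCont_gker: "isCont (gker k) x"
  using gker_deriv has_vector_derivative_continuous by blast

text \<open>Gaussian integration by parts: \<open>(k - x) * gker k x\<close> is the derivative of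
  \<open>gker k\<close>, which vanishes at both ends, so its integral is zero.\<close>

lemma integral_x_gker: "(\<integral>x. complex_of_real x * gker k x \<partial>lborel) = k * exp (k\<^sup>2 / 2)"
proof -
  have i: "integrable lborel (\<lambda>x. gker k x)" "integrable lborel (\<lambda>x. complex_of_real x * gker k x)"
    using integrable_gker[of 0 k] integrable_gker[of 1 k] by simp_all
  have "(\<integral>x. (k - complex_of_real x) * gker k x \<partial>lborel) = 0"
  proof (rule integral_derivative_zero[OF gker_deriv])
    show "isCont (\<lambda>x. (k - complex_of_real x) * gker k x) x" for x
      by (intro continuous_intros isCont_gker)
    show "integrable lborel (\<lambda>x. (k - complex_of_real x) * gker k x)"
      using i by (simp add: left_diff_distrib)
  qed (use gker_lim[of 0 k] in simp_all)
  then show ?thesis using i by (simp add: left_diff_distrib integral_gker)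
qed

text \<open>The argument for the first moment one degree higher, with \<open>x * gker k x\<close> as
  the function that is differentiated.\<close>

lemma integral_x2_gker: "(\<integral>x. (complex_of_real x)\<^sup>2 * gker k x \<partial>lborel) = (1 + k\<^sup>2) * exp (k\<^sup>2 / 2)"
proof -
  have i: "integrable lborel (\<lambda>x. gker k x)" "integrable lborel (\<lambda>x. k * (complex_of_real x * gker k x))"
     "integrable lborel (\<lambda>x. (complex_of_real x)\<^sup>2 * gker k x)"
    using integrable_gker[of 0 k] integrable_gker[of 1 k] integrable_gker[of 2 k] by simp_all
  let ?f = "\<lambda>x. gker k x + k * (complex_of_real x * gker k x) - (complex_of_real x)\<^sup>2 * gker k x"
  have "(\<integral>x. ?f x \<partial>lborel) = 0"
  proof (rule integral_derivative_zero[where F = "\<lambda>x. complex_of_real x * gker k x"])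
    have d: "(complex_of_real has_vector_derivative 1) (at x)" for x
      using has_vector_derivative_of_real[of "\<lambda>x. x" 1 "at x"] by simp
    show "((\<lambda>x. complex_of_real x * gker k x) has_vector_derivative ?f x) (at x)" for x
      by (rule has_vector_derivative_eq_rhs[OF has_vector_derivative_mult[OF d gker_deriv]])
        (simp add: algebra_simps power2_eq_square)
    show "isCont ?f x" for x
      by (intro continuous_intros isCont_gker)
    show "integrable lborel ?f" using i by (intro Bochner_Integration.integrable_diff Bochner_Integration.integrable_add)
  qed (use gker_lim[of 1 k] in simp_all)
  then have "exp (k\<^sup>2 / 2) + k * (k * exp (k\<^sup>2 / 2)) - (\<integral>x. (complex_of_real x)\<^sup>2 * gker k x \<partial>lborel) = 0"
    by (simp only: Bochner_Integration.integral_diff[OF Bochner_Integration.integrable_add[OF i(1,2)] i(3)]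
        Bochner_Integration.integral_add[OF i(1,2)] integral_mult_right_zero integral_gker integral_x_gker)
  then show ?thesis by (simp add: algebra_simps power2_eq_square)
qed

text \<open>\<open>Z\<close> is distributed as \<open>\<sigma> = sqrt v\<close> times a standard
  normal variable, so each moment is one of \<open>gker\<close> at \<open>k * \<sigma>\<close> times
  a power of \<open>\<sigma>\<close>. In the results \<open>\<sigma>\<close> occurs only through
  \<open>\<sigma>^2 = v\<close>, and \<open>v = 0\<close> is included.\<close>

lemma gauss_moments:
  assumes Z [measurable]: "Z \<in> borel_measurable M" and law: "distr M borel Z = gauss v" and v: "0 \<le> v"
  shows "integrable M (\<lambda>\<omega>. exp (k * complex_of_real (Z \<omega>)))"
    and "integrable M (\<lambda>\<omega>. complex_of_real (Z \<omega>) * exp (k * complex_of_real (Z \<omega>)))"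
    and "integrable M (\<lambda>\<omega>. (complex_of_real (Z \<omega>))\<^sup>2 * exp (k * complex_of_real (Z \<omega>)))"
    and "(\<integral>\<omega>. exp (k * complex_of_real (Z \<omega>)) \<partial>M) = exp (k\<^sup>2 * complex_of_real v / 2)"
    and "(\<integral>\<omega>. complex_of_real (Z \<omega>) * exp (k * complex_of_real (Z \<omega>)) \<partial>M) = k * complex_of_real v * exp (k\<^sup>2 * complex_of_real v / 2)"
    and "(\<integral>\<omega>. (complex_of_real (Z \<omega>))\<^sup>2 * exp (k * complex_of_real (Z \<omega>)) \<partial>M) =
       (complex_of_real v + k\<^sup>2 * (complex_of_real v)\<^sup>2) * exp (k\<^sup>2 * complex_of_real v / 2)"
proof -
  define \<sigma> where "\<sigma> = complex_of_real (sqrt v)"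
  have \<sigma>2: "\<sigma>\<^sup>2 = complex_of_real v" using v unfolding \<sigma>_def by (simp flip: of_real_power)
  have ks: "(k * \<sigma>)\<^sup>2 = k\<^sup>2 * complex_of_real v" by (simp add: power_mult_distrib \<sigma>2)
  define h where "h j x = complex_of_real x ^ j * exp (k * complex_of_real x)" for j x
  have hm [measurable]: "h j \<in> borel_measurable borel" for j
    unfolding h_def[abs_def] by (intro borel_measurable_continuous_onI continuous_intros)
  have hg: "std_normal_density x *\<^sub>R h j (sqrt v * x) = \<sigma> ^ j * (complex_of_real x ^ j * gker (k * \<sigma>) x)" for j x
    by (simp add: h_def gker_def scaleR_conv_of_real \<sigma>_def power_mult_distrib mult_ac)
  have int: "integrable M (\<lambda>\<omega>. h j (Z \<omega>))" if "j \<le> 2" for j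
  proof -
    have "integrable lborel (\<lambda>x. std_normal_density x *\<^sub>R h j (sqrt v * x))"
      unfolding hg using integrable_gker[OF that] by (intro integrable_mult_right)
    then have "integrable (density lborel (\<lambda>x. ennreal (std_normal_density x))) (\<lambda>x. h j (sqrt v * x))"
      by (subst integrable_density) (auto simp: normal_density_nonneg)
    then have "integrable (gauss v) (h j)"
      unfolding gauss_def by (subst integrable_distr_eq) auto
    then show ?thesis unfolding law[symmetric] by (subst (asm) integrable_distr_eq) auto
  qed
  have val: "(\<integral>\<omega>. h j (Z \<omega>) \<partial>M) = \<sigma> ^ j * (\<integral>x. complex_of_real x ^ j * gker (k * \<sigma>) x \<partial>lborel)" for j
  proof -
    have "(\<integral>\<omega>. h j (Z \<omega>) \<partial>M) = (\<integral>x. h j x \<partial>gauss v)"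
      unfolding law[symmetric] by (subst integral_distr) auto
    also have "\<dots> = (\<integral>x. h j (sqrt v * x) \<partial>std_normal_distribution)"
      unfolding gauss_def by (subst integral_distr) auto
    also have "\<dots> = (\<integral>x. std_normal_density x *\<^sub>R h j (sqrt v * x) \<partial>lborel)"
      by (subst integral_density) (auto simp: normal_density_nonneg)
    finally show ?thesis unfolding hg integral_mult_right_zero .
  qed
  show "integrable M (\<lambda>\<omega>. exp (k * complex_of_real (Z \<omega>)))" using int[of 0] by (simp add: h_def)
  show "integrable M (\<lambda>\<omega>. complex_of_real (Z \<omega>) * exp (k * complex_of_real (Z \<omega>)))" using int[of 1] by (simp add: h_def)
  show "integrable M (\<lambda>\<omega>. (complex_of_real (Z \<omega>))\<^sup>2 * exp (k * complex_of_real (Z \<omega>)))" using int[of 2] by (simp add: h_def)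
  show "(\<integral>\<omega>. exp (k * complex_of_real (Z \<omega>)) \<partial>M) = exp (k\<^sup>2 * complex_of_real v / 2)"
    using val[of 0] by (simp add: h_def integral_gker ks)
  have "\<sigma> * (k * \<sigma> * e) = k * complex_of_real v * e" for e
    by (simp add: \<sigma>2[symmetric] power2_eq_square)
  moreover have "(\<integral>\<omega>. complex_of_real (Z \<omega>) * exp (k * complex_of_real (Z \<omega>)) \<partial>M) = \<sigma> * (k * \<sigma> * exp (k\<^sup>2 * complex_of_real v / 2))"
    using val[of 1] by (simp add: h_def integral_x_gker ks)
  ultimately show "(\<integral>\<omega>. complex_of_real (Z \<omega>) * exp (k * complex_of_real (Z \<omega>)) \<partial>M) = k * complex_of_real v * exp (k\<^sup>2 * complex_of_real v / 2)"
    by (simp only:)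
  have "\<sigma>\<^sup>2 * ((1 + k\<^sup>2 * complex_of_real v) * e) = (complex_of_real v + k\<^sup>2 * (complex_of_real v)\<^sup>2) * e" for e
    unfolding \<sigma>2 by (simp add: algebra_simps power2_eq_square)
  moreover have "(\<integral>\<omega>. (complex_of_real (Z \<omega>))\<^sup>2 * exp (k * complex_of_real (Z \<omega>)) \<partial>M) =
       \<sigma>\<^sup>2 * ((1 + k\<^sup>2 * complex_of_real v) * exp (k\<^sup>2 * complex_of_real v / 2))"
    using val[of 2] by (simp add: h_def integral_x2_gker ks)
  ultimately show "(\<integral>\<omega>. (complex_of_real (Z \<omega>))\<^sup>2 * exp (k * complex_of_real (Z \<omega>)) \<partial>M) =
       (complex_of_real v + k\<^sup>2 * (complex_of_real v)\<^sup>2) * exp (k\<^sup>2 * complex_of_real v / 2)"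
    by (simp only:)
qed

section \<open>Gaussian increments\<close>

lemma L2_I:
  assumes [measurable]: "f \<in> borel_measurable M" and "integrable M (\<lambda>\<omega>. f \<omega> * cnj (f \<omega>))"
  shows "f \<in> L2 M"
proof -
  have "integrable M (\<lambda>\<omega>. cmod (f \<omega> * cnj (f \<omega>)))" using assms(2) by (rule integrable_norm)
  then show ?thesis by (simp add: L2_def norm_mult power2_eq_square)
qed

lemma l2inner_cnj: "cnj (l2inner M f g) = l2inner M g f"
  unfolding l2inner_def by (subst Bochner_Integration.integral_cnj[symmetric]) (simp add: mult.commute)

lemma l2conv_cmult:
  assumes "l2conv M u f" shows "l2conv M (\<lambda>n \<omega>. k * u n \<omega>) (\<lambda>\<omega>. k * f \<omega>)"
proof -
  have "(\<lambda>n. cmod k * l2norm M (\<lambda>\<omega>. u n \<omega> - f \<omega>)) \<longlonglongrightarrow> cmod k * 0"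
    using assms by (intro tendsto_intros) (auto simp: l2conv_iff_l2norm)
  moreover have "l2norm M (\<lambda>\<omega>. k * u n \<omega> - k * f \<omega>) = cmod k * l2norm M (\<lambda>\<omega>. u n \<omega> - f \<omega>)" for n
    by (simp add: l2norm_cmult flip: right_diff_distrib)
  ultimately show ?thesis using assms by (auto simp: l2conv_iff_l2norm intro: L2_cmult)
qed

lemma l2conv_diff:
  assumes "l2conv M u f" "l2conv M v g" shows "l2conv M (\<lambda>n \<omega>. u n \<omega> - v n \<omega>) (\<lambda>\<omega>. f \<omega> - g \<omega>)"
proof -
  have a: "\<And>n. u n \<in> L2 M" "f \<in> L2 M" "\<And>n. v n \<in> L2 M" "g \<in> L2 M"
    "(\<lambda>n. l2norm M (\<lambda>\<omega>. u n \<omega> - f \<omega>)) \<longlonglongrightarrow> 0" "(\<lambda>n. l2norm M (\<lambda>\<omega>. v n \<omega> - g \<omega>)) \<longlonglongrightarrow> 0"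
    using assms by (auto simp: l2conv_iff_l2norm)
  have le: "l2norm M (\<lambda>\<omega>. u n \<omega> - v n \<omega> - (f \<omega> - g \<omega>)) \<le> l2norm M (\<lambda>\<omega>. u n \<omega> - f \<omega>) + l2norm M (\<lambda>\<omega>. v n \<omega> - g \<omega>)" for n
    using l2norm_triangle[OF L2_diff[OF a(1)[of n] a(2)] L2_diff[OF a(4) a(3)[of n]]]
    by (simp add: l2norm_minus_commute[of M g] algebra_simps)
  have "(\<lambda>n. l2norm M (\<lambda>\<omega>. u n \<omega> - v n \<omega> - (f \<omega> - g \<omega>))) \<longlonglongrightarrow> 0"
    by (rule tendsto_sandwich[OF _ _ tendsto_const tendsto_add_zero[OF a(5,6)]]) (use le in auto)
  then show ?thesis using a by (auto simp: l2conv_iff_l2norm intro: L2_diff)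
qed

section \<open>Law and independence of increments, and inner products of exponentials\<close>

context det_qv_martingale begin

lemma increment_distr:
  assumes st: "s \<in> I" "t \<in> I" "s \<le> t"
  shows "distr M borel (\<lambda>\<omega>. X t \<omega> - X s \<omega>) = gauss (A t - A s)"
proof (rule measure_eqI)
  interpret G: real_distribution "gauss (A t - A s)" by (rule real_distribution_gauss)
  show "sets (distr M borel (\<lambda>\<omega>. X t \<omega> - X s \<omega>)) = sets (gauss (A t - A s))" by simp
  fix S assume "S \<in> sets (distr M borel (\<lambda>\<omega>. X t \<omega> - X s \<omega>))"
  then have S: "S \<in> sets borel" by simp
  note [measurable] = X_M[OF st(1)] X_M[OF st(2)] S
  have "space M \<in> sets (F s)" using subalg[OF st(1)] sets.top[of "F s"] by (simp add: subalgebra_def)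
  from increment_law[OF st this S]
  have "prob {\<omega> \<in> space M. X t \<omega> - X s \<omega> \<in> S} = measure (gauss (A t - A s)) S"
    by (simp add: prob_space Int_def)
  then show "emeasure (distr M borel (\<lambda>\<omega>. X t \<omega> - X s \<omega>)) S = emeasure (gauss (A t - A s)) S"
    by (subst emeasure_distr) (auto simp: emeasure_eq_measure G.emeasure_eq_measure vimage_def Int_def conj_commute)
qed

lemma X_distr:
  assumes t: "t \<in> I" shows "distr M borel (X t) = gauss (A t)"
proof -
  note [measurable] = X_M[OF t] X_M[OF I_zero]
  \<comment> \<open>\<open>X 0\<close> vanishes only almost surely, so the laws are equated rather
    than the functions.\<close>
  have "distr M borel (X t) = distr M borel (\<lambda>\<omega>. X t \<omega> - X 0 \<omega>)"
    by (rule distr_cong_AE) (use X_zero in auto)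
  then show ?thesis using increment_distr[OF I_zero t I_nonneg[OF t]] by (simp add: A_nonpos)
qed

text \<open>For events \<open>B\<close> generated by \<open>X s\<close>,
  \<open>increment_law\<close> is the product formula. The preimages of Borel sets are intersection
  stable, so independence passes to the generated sigma-algebras.\<close>

lemma indep_increment:
  assumes st: "s \<in> I" "t \<in> I" "s \<le> t"
  shows "indep_var borel (X s) borel (\<lambda>\<omega>. X t \<omega> - X s \<omega>)"
proof -
  note [measurable] = X_M[OF st(1)] X_M[OF st(2)]
  have stable: "Int_stable {f -` S \<inter> space M |S. S \<in> sets borel}" for f :: "'a \<Rightarrow> real"
  proof (rule Int_stableI)
    fix a b assume "a \<in> {f -` S \<inter> space M |S. S \<in> sets borel}" "b \<in> {f -` S \<inter> space M |S. S \<in> sets borel}"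
    then obtain S S' where "a = f -` S \<inter> space M" "b = f -` S' \<inter> space M" "S \<in> sets borel" "S' \<in> sets borel" by blast
    then have "a \<inter> b = f -` (S \<inter> S') \<inter> space M" "S \<inter> S' \<in> sets borel" by auto
    then show "a \<inter> b \<in> {f -` S \<inter> space M |S. S \<in> sets borel}" by blast
  qed
  have "indep_set {X s -` S \<inter> space M |S. S \<in> sets borel} {(\<lambda>\<omega>. X t \<omega> - X s \<omega>) -` S \<inter> space M |S. S \<in> sets borel}"
  proof (rule indep_setI)
    show "{X s -` S \<inter> space M |S. S \<in> sets borel} \<subseteq> events" by auto
    show "{(\<lambda>\<omega>. X t \<omega> - X s \<omega>) -` S \<inter> space M |S. S \<in> sets borel} \<subseteq> events" by auto
    fix a b assume "a \<in> {X s -` S \<inter> space M |S. S \<in> sets borel}" "b \<in> {(\<lambda>\<omega>. X t \<omega> - X s \<omega>) -` S \<inter> space M |S. S \<in> sets borel}"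
    then obtain S S' where a: "a = X s -` S \<inter> space M" and b: "b = (\<lambda>\<omega>. X t \<omega> - X s \<omega>) -` S' \<inter> space M"
      and S: "S \<in> sets borel" "S' \<in> sets borel" by blast
    have b': "b = {\<omega> \<in> space M. X t \<omega> - X s \<omega> \<in> S'}" unfolding b by auto
    have sp: "space (F s) = space M" using subalg[OF st(1)] by (simp add: subalgebra_def)
    have aF: "a \<in> sets (F s)" unfolding a using measurable_sets[OF X_F[OF st(1)] S(1)] by (simp add: sp)
    have spF: "space M \<in> sets (F s)" using sets.top[of "F s"] by (simp add: sp)
    have "prob b = measure (gauss (A t - A s)) S'"
      using increment_law[OF st spF S(2)] unfolding b' by (simp add: prob_space Int_def)
    then show "prob (a \<inter> b) = prob a * prob b" using increment_law[OF st aF S(2)] unfolding b' by simp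
  qed
  from indep_set_sigma_sets[OF this stable stable] show ?thesis
    unfolding indep_var_eq by simp
qed

text \<open>With \<open>a = A t\<close> and \<open>E = expm X A c t\<close>, the function
  \<open>E\<close> is \<open>aff t c 1 0\<close>, its product with \<open>X t\<close> is
  \<open>aff t c 0 1\<close>, its image under \<open>D\<close> is \<open>aff t c (c * a) 0\<close>,
  and its image under \<open>X - D\<close> is \<open>aff t c (- c * a) 1\<close>. One family thus
  holds the images of the exponentials under all operators that occur.\<close>

definition aff :: "real \<Rightarrow> complex \<Rightarrow> complex \<Rightarrow> complex \<Rightarrow> 'a \<Rightarrow> complex" where
  "aff t c p q \<omega> = (p + q * complex_of_real (X t \<omega>)) * expm X A c t \<omega>"

lemma expm_measurable: "t \<in> I \<Longrightarrow> expm X A c t \<in> borel_measurable M"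
proof -
  assume "t \<in> I"
  then have [measurable]: "X t \<in> borel_measurable M" by (rule X_M)
  have [measurable]: "(\<lambda>z. exp (c * complex_of_real z - c\<^sup>2 * complex_of_real (A t) / 2)) \<in> borel_measurable borel"
    by (intro borel_measurable_continuous_onI continuous_intros)
  show ?thesis unfolding expm_def[abs_def] by measurable
qed

lemma aff_measurable: "t \<in> I \<Longrightarrow> aff t c p q \<in> borel_measurable M"
proof -
  assume t: "t \<in> I"
  note [measurable] = X_M[OF t] expm_measurable[OF t]
  show ?thesis unfolding aff_def[abs_def] by measurable
qed

text \<open>The product of the two functions is a quadratic polynomial in \<open>X t\<close> times
  one exponential with parameter \<open>k = c + cnj d\<close>, so three Gaussian moments suffice.
  Later operator identities are verified by comparing the resulting polynomials in \<open>c\<close>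
  and \<open>cnj d\<close>.\<close>

lemma aff_inner:
  fixes c d p q r s :: complex
  assumes t: "t \<in> I"
  defines "a \<equiv> complex_of_real (A t)" and "k \<equiv> c + cnj d"
  shows "integrable M (\<lambda>\<omega>. aff t c p q \<omega> * cnj (aff t d r s \<omega>))" (is ?th1)
    and "l2inner M (aff t c p q) (aff t d r s) =
      (p * cnj r + (p * cnj s + q * cnj r) * (a * k) + q * cnj s * (a + a\<^sup>2 * k\<^sup>2)) * exp (c * cnj d * a)" (is ?th2)
proof -
  note m = gauss_moments[OF X_M[OF t] X_distr[OF t] A_nonneg, of k, folded a_def]
  let ?x = "\<lambda>\<omega>. complex_of_real (X t \<omega>)"
  let ?e = "\<lambda>\<omega>. exp (k * ?x \<omega>)"
  \<comment> \<open>The deterministic parts of the two exponents, collected. Together with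
    \<open>exp (k^2 * a / 2)\<close> from the moments they leave
    \<open>exp (c * cnj d * a)\<close>.\<close>
  define N where "N = exp (- (c\<^sup>2 + (cnj d)\<^sup>2) * a / 2)"
  have dec: "aff t c p q \<omega> * cnj (aff t d r s \<omega>) =
     N * (p * cnj r * ?e \<omega> + (p * cnj s + q * cnj r) * (?x \<omega> * ?e \<omega>) + q * cnj s * ((?x \<omega>)\<^sup>2 * ?e \<omega>))" for \<omega>
  proof -
    have e: "expm X A c t \<omega> * cnj (expm X A d t \<omega>) = N * ?e \<omega>"
      unfolding expm_def exp_cnj N_def mult_exp_exp
      by (rule arg_cong[where f = exp]) (simp add: a_def k_def field_simps)
    have "aff t c p q \<omega> * cnj (aff t d r s \<omega>) =
        (p + q * ?x \<omega>) * (cnj r + cnj s * ?x \<omega>) * (expm X A c t \<omega> * cnj (expm X A d t \<omega>))"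
      by (simp add: aff_def)
    also have "\<dots> = (p + q * ?x \<omega>) * (cnj r + cnj s * ?x \<omega>) * (N * ?e \<omega>)" unfolding e ..
    also have "\<dots> = N * (p * cnj r * ?e \<omega> + (p * cnj s + q * cnj r) * (?x \<omega> * ?e \<omega>) + q * cnj s * ((?x \<omega>)\<^sup>2 * ?e \<omega>))"
      by (simp add: algebra_simps power2_eq_square)
    finally show ?thesis .
  qed
  have i: "integrable M (\<lambda>\<omega>. p * cnj r * ?e \<omega>)" "integrable M (\<lambda>\<omega>. (p * cnj s + q * cnj r) * (?x \<omega> * ?e \<omega>))"
    "integrable M (\<lambda>\<omega>. q * cnj s * ((?x \<omega>)\<^sup>2 * ?e \<omega>))"
    by (intro integrable_mult_right m)+
  show ?th1 unfolding dec by (intro integrable_mult_right Bochner_Integration.integrable_add i)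
  have "l2inner M (aff t c p q) (aff t d r s) = N * (p * cnj r * exp (k\<^sup>2 * a / 2) + (p * cnj s + q * cnj r) * (k * a * exp (k\<^sup>2 * a / 2))
      + q * cnj s * ((a + k\<^sup>2 * a\<^sup>2) * exp (k\<^sup>2 * a / 2)))"
    unfolding l2inner_def dec integral_mult_right_zero
      Bochner_Integration.integral_add[OF Bochner_Integration.integrable_add[OF i(1,2)] i(3)]
      Bochner_Integration.integral_add[OF i(1,2)] m(4-6) ..
  also have "\<dots> = (p * cnj r + (p * cnj s + q * cnj r) * (a * k) + q * cnj s * (a + a\<^sup>2 * k\<^sup>2)) * (N * exp (k\<^sup>2 * a / 2))"
    by (simp add: algebra_simps)
  also have "N * exp (k\<^sup>2 * a / 2) = exp (c * cnj d * a)"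
    unfolding N_def mult_exp_exp
    by (rule arg_cong[where f = exp]) (simp add: k_def power2_eq_square field_simps)
  finally show ?th2 .
qed

lemma aff_L2: "t \<in> I \<Longrightarrow> aff t c p q \<in> L2 M"
  by (rule L2_I[OF aff_measurable aff_inner(1)])

lemma expm_aff: "expm X A c t = aff t c 1 0"
  by (rule ext) (simp add: aff_def)

lemma expm_L2: "t \<in> I \<Longrightarrow> expm X A c t \<in> L2 M"
  unfolding expm_aff by (rule aff_L2)

text \<open>The exponential at time \<open>t\<close> is the one at time \<open>s\<close> times an
  exponential of the increment, which has mean 1 and is independent of \<open>X s\<close>. The inner
  product thus reduces to the one at the earlier time.\<close>

lemma expm_inner_le:
  assumes st: "s \<in> I" "t \<in> I" "s \<le> t"
  shows "l2inner M (expm X A c s) (expm X A d t) = exp (c * cnj d * complex_of_real (A s))"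
proof -
  note [measurable] = X_M[OF st(1)] X_M[OF st(2)]
  define f where "f x = exp (c * complex_of_real x - c\<^sup>2 * complex_of_real (A s) / 2) * exp (cnj d * complex_of_real x - (cnj d)\<^sup>2 * complex_of_real (A s) / 2)" for x
  define g where "g x = exp (- ((cnj d)\<^sup>2 * complex_of_real (A t - A s) / 2)) * exp (cnj d * complex_of_real x)" for x
  have [measurable]: "f \<in> borel_measurable borel" "g \<in> borel_measurable borel"
    unfolding f_def[abs_def] g_def[abs_def] by (intro borel_measurable_continuous_onI continuous_intros)+
  have v: "0 \<le> A t - A s" using monoD[OF A_mono st(3)] by simp
  have ind: "indep_var borel (\<lambda>\<omega>. f (X s \<omega>)) borel (\<lambda>\<omega>. g (X t \<omega> - X s \<omega>))"
    using indep_var_compose[OF indep_increment[OF st], of f borel g borel] by (simp add: comp_def)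
  have fs: "f (X s \<omega>) = expm X A c s \<omega> * cnj (expm X A d s \<omega>)" for \<omega>
    unfolding f_def expm_def exp_cnj by simp
  have "(\<lambda>\<omega>. X t \<omega> - X s \<omega>) \<in> borel_measurable M" by measurable
  note m = gauss_moments(1,4)[OF this increment_distr[OF st] v, of "cnj d"]
  have f1: "integrable M (\<lambda>\<omega>. f (X s \<omega>))" "(\<integral>\<omega>. f (X s \<omega>) \<partial>M) = exp (c * cnj d * complex_of_real (A s))"
    using aff_inner[OF st(1), of c 1 0 d 1 0] unfolding fs expm_aff[symmetric] l2inner_def by simp_all
  have g1: "integrable M (\<lambda>\<omega>. g (X t \<omega> - X s \<omega>))"
    unfolding g_def using m(1) by (intro integrable_mult_right)
  have g2: "(\<integral>\<omega>. g (X t \<omega> - X s \<omega>) \<partial>M) = 1"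
    unfolding g_def integral_mult_right_zero m(2) unfolding mult_exp_exp by simp
  have "expm X A c s \<omega> * cnj (expm X A d t \<omega>) = f (X s \<omega>) * g (X t \<omega> - X s \<omega>)" for \<omega>
    unfolding f_def g_def expm_def exp_cnj mult_exp_exp
    by (rule arg_cong[where f = exp]) (simp add: algebra_simps add_divide_distrib diff_divide_distrib)
  then have "l2inner M (expm X A c s) (expm X A d t) = (\<integral>\<omega>. f (X s \<omega>) * g (X t \<omega> - X s \<omega>) \<partial>M)"
    by (simp add: l2inner_def)
  also have "\<dots> = exp (c * cnj d * complex_of_real (A s)) * 1"
    unfolding indep_var_lebesgue_integral[OF ind f1(1) g1] f1(2) g2 ..
  finally show ?thesis by simp
qed

lemma expm_inner:
  assumes st: "s \<in> I" "t \<in> I"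
  shows "l2inner M (expm X A c s) (expm X A d t) = exp (c * cnj d * complex_of_real (A (min s t)))"
proof (cases "s \<le> t")
  case True then show ?thesis using expm_inner_le[OF st True] by simp
next
  case False
  then have "l2inner M (expm X A d t) (expm X A c s) = exp (d * cnj c * complex_of_real (A t))"
    by (intro expm_inner_le st) simp
  then have "cnj (l2inner M (expm X A d t) (expm X A c s)) = exp (c * cnj d * complex_of_real (A t))"
    by (simp add: exp_cnj mult.commute)
  then show ?thesis using False by (simp add: l2inner_cnj)
qed

end

section \<open>The uncertainty inequality at a fixed time\<close>

text \<open>Lists of pairs of a coefficient and an index, with repetitions allowed, so that a
  difference of two combinations is an append with \<open>lneg\<close> and no index sets have to be
  merged.\<close>

definition lcomb :: "('b \<Rightarrow> 'a \<Rightarrow> complex) \<Rightarrow> (complex \<times> 'b) list \<Rightarrow> 'a \<Rightarrow> complex" where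
  "lcomb F xs \<omega> = (\<Sum>x\<leftarrow>xs. fst x * F (snd x) \<omega>)"

definition lneg :: "(complex \<times> 'b) list \<Rightarrow> (complex \<times> 'b) list" where
  "lneg xs = map (\<lambda>x. (- fst x, snd x)) xs"

lemma lcomb_diff: "lcomb F (xs @ lneg ys) \<omega> = lcomb F xs \<omega> - lcomb F ys \<omega>"
  by (simp add: lcomb_def lneg_def o_def uminus_sum_list_map[unfolded o_def, symmetric])

lemma lcomb_upt: "lcomb F (map (\<lambda>i. (a i, c i)) [0..<n]) = (\<lambda>\<omega>. \<Sum>i<n. a i * F (c i) \<omega>)"
  by (rule ext) (simp add: lcomb_def o_def interv_sum_list_conv_sum_set_nat lessThan_atLeast0)

lemma lcomb_L2: "(\<And>c. c \<in> snd ` set xs \<Longrightarrow> F c \<in> L2 M) \<Longrightarrow> lcomb F xs \<in> L2 M"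
  unfolding lcomb_def[abs_def] by (intro L2_sum_list L2_cmult) auto

lemma l2inner_cmult: "l2inner M (\<lambda>\<omega>. a * f \<omega>) (\<lambda>\<omega>. b * g \<omega>) = a * cnj b * l2inner M f g"
proof -
  have "a * f \<omega> * cnj (b * g \<omega>) = a * cnj b * (f \<omega> * cnj (g \<omega>))" for \<omega> by simp
  then show ?thesis unfolding l2inner_def by (simp only: integral_mult_right_zero)
qed

lemma l2inner_lcomb:
  assumes "\<And>c. c \<in> snd ` set xs \<Longrightarrow> F c \<in> L2 M" "\<And>c. c \<in> snd ` set ys \<Longrightarrow> G c \<in> L2 M"
  shows "l2inner M (lcomb F xs) (lcomb G ys) = (\<Sum>x\<leftarrow>xs. \<Sum>y\<leftarrow>ys. fst x * cnj (fst y) * l2inner M (F (snd x)) (G (snd y)))"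
  unfolding lcomb_def[abs_def] l2inner_cmult[symmetric]
  by (rule l2inner_sum_list; rule L2_cmult; rule assms; simp)

text \<open>Sesquilinear extension from pairs of generators to the span: the coefficients enter all
  three forms in the same way. The value \<open>b = 0\<close> gives isometries, other values give
  commutation relations.\<close>

lemma l2inner_lcomb_linear:
  assumes L: "\<And>c. c \<in> snd ` set xs \<Longrightarrow> F1 c \<in> L2 M \<and> G1 c \<in> L2 M \<and> F2 c \<in> L2 M \<and> G2 c \<in> L2 M \<and> F3 c \<in> L2 M \<and> G3 c \<in> L2 M"
    and id: "\<And>c d. c \<in> snd ` set xs \<Longrightarrow> d \<in> snd ` set xs \<Longrightarrow>
      l2inner M (F1 c) (G1 d) = l2inner M (F2 c) (G2 d) + b * l2inner M (F3 c) (G3 d)"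
  shows "l2inner M (lcomb F1 xs) (lcomb G1 xs) =
    l2inner M (lcomb F2 xs) (lcomb G2 xs) + b * l2inner M (lcomb F3 xs) (lcomb G3 xs)"
proof -
  have "(\<Sum>x\<leftarrow>xs. \<Sum>y\<leftarrow>xs. fst x * cnj (fst y) * l2inner M (F1 (snd x)) (G1 (snd y))) =
     (\<Sum>x\<leftarrow>xs. \<Sum>y\<leftarrow>xs. fst x * cnj (fst y) * l2inner M (F2 (snd x)) (G2 (snd y)) + b * (fst x * cnj (fst y) * l2inner M (F3 (snd x)) (G3 (snd y))))"
    by (intro arg_cong[where f = sum_list] map_cong refl) (simp add: id distrib_left)
  also have "\<dots> = (\<Sum>x\<leftarrow>xs. \<Sum>y\<leftarrow>xs. fst x * cnj (fst y) * l2inner M (F2 (snd x)) (G2 (snd y)))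
      + b * (\<Sum>x\<leftarrow>xs. \<Sum>y\<leftarrow>xs. fst x * cnj (fst y) * l2inner M (F3 (snd x)) (G3 (snd y)))"
    by (simp only: sum_list_addf sum_list_const_mult)
  finally show ?thesis using L by (simp add: l2inner_lcomb)
qed

lemma lcomb_add:
  assumes "\<And>c \<omega>. F c \<omega> = G c \<omega> + H c \<omega>" shows "lcomb F xs \<omega> = lcomb G xs \<omega> + lcomb H xs \<omega>"
  by (simp add: lcomb_def assms distrib_left sum_list_addf)

lemma lcomb_scale:
  assumes "\<And>c \<omega>. F c \<omega> = k * G c \<omega>" shows "lcomb F xs \<omega> = k * lcomb G xs \<omega>"
  by (simp add: lcomb_def assms mult.left_commute sum_list_const_mult)

section \<open>Operator identities and bounds on the span of exponentials\<close>

context det_qv_martingale begin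

lemma lcomb_aff: "lcomb (\<lambda>c. aff t (f c) p q) xs \<omega> = (p + q * complex_of_real (X t \<omega>)) * lcomb (\<lambda>c. expm X A (f c) t) xs \<omega>"
  unfolding lcomb_def sum_list_const_mult[symmetric] aff_def by (simp add: mult.left_commute)

text \<open>Each index carries its own time, because approximants in \<open>G0_graph\<close> may mix
  times and have to be compared with combinations at a single time.\<close>

lemma l2norm_fourier:
  assumes "\<And>x. x \<in> set xs \<Longrightarrow> snd (snd x) \<in> I"
  shows "l2norm M (lcomb (\<lambda>(c, s). expm X A (- \<i> * c) s) xs) = l2norm M (lcomb (\<lambda>(c, s). expm X A c s) xs)"
proof -
  let ?G = "\<lambda>(c, s). expm X A (- \<i> * c) s" and ?E = "\<lambda>(c, s). expm X A c s"
  have k: "\<i> * a * (\<i> * b) = - (a * b)" for a b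
    by (simp add: complex_eq_iff algebra_simps)
  have "l2inner M (lcomb ?G xs) (lcomb ?G xs) = l2inner M (lcomb ?E xs) (lcomb ?E xs) + 0 * l2inner M (lcomb ?E xs) (lcomb ?E xs)"
    by (rule l2inner_lcomb_linear) (use assms in \<open>auto simp: expm_inner expm_L2 k\<close>)
  then have "(l2norm M (lcomb ?G xs))\<^sup>2 = (l2norm M (lcomb ?E xs))\<^sup>2"
    by (simp add: l2inner_self del: of_real_power)
  then show ?thesis by simp
qed

text \<open>With \<open>D* = X - D\<close>, this is the commutation relation \<open>[D, D*] = A t\<close> in quadratic form.\<close>

lemma l2norm_creation:
  assumes t: "t \<in> I"
  shows "(l2norm M (lcomb (\<lambda>c. aff t c (- c * complex_of_real (A t)) 1) xs))\<^sup>2 =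
    (l2norm M (lcomb (\<lambda>c. aff t c (c * complex_of_real (A t)) 0) xs))\<^sup>2 + A t * (l2norm M (lcomb (\<lambda>c. expm X A c t) xs))\<^sup>2"
proof -
  have "l2inner M (lcomb (\<lambda>c. aff t c (- c * complex_of_real (A t)) 1) xs) (lcomb (\<lambda>c. aff t c (- c * complex_of_real (A t)) 1) xs) =
    l2inner M (lcomb (\<lambda>c. aff t c (c * complex_of_real (A t)) 0) xs) (lcomb (\<lambda>c. aff t c (c * complex_of_real (A t)) 0) xs)
    + complex_of_real (A t) * l2inner M (lcomb (\<lambda>c. aff t c 1 0) xs) (lcomb (\<lambda>c. aff t c 1 0) xs)"
    by (rule l2inner_lcomb_linear) (auto simp: aff_L2[OF t] aff_inner(2)[OF t] algebra_simps power2_eq_square)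
  then have "complex_of_real ((l2norm M (lcomb (\<lambda>c. aff t c (- c * complex_of_real (A t)) 1) xs))\<^sup>2) = complex_of_real
    ((l2norm M (lcomb (\<lambda>c. aff t c (c * complex_of_real (A t)) 0) xs))\<^sup>2 + A t * (l2norm M (lcomb (\<lambda>c. expm X A c t) xs))\<^sup>2)"
    unfolding l2inner_self expm_aff by simp
  then show ?thesis unfolding of_real_eq_iff .
qed

text \<open>The Fourier transform turns \<open>X - h\<close> into \<open>\<i> (D* - D) - h\<close>, and \<open>\<i> (D* - D) = \<i> (X - 2 D)\<close>.\<close>

lemma l2norm_fourier_X:
  assumes t: "t \<in> I"
  shows "l2norm M (lcomb (\<lambda>c. aff t (- \<i> * c) (- complex_of_real h) 1) xs) =
    l2norm M (lcomb (\<lambda>c. aff t c (- 2 * \<i> * c * complex_of_real (A t) - complex_of_real h) \<i>) xs)"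
proof -
  let ?G = "\<lambda>c. aff t (- \<i> * c) (- complex_of_real h) 1"
  let ?Q = "\<lambda>c. aff t c (- 2 * \<i> * c * complex_of_real (A t) - complex_of_real h) \<i>"
  have "l2inner M (lcomb ?G xs) (lcomb ?G xs) = l2inner M (lcomb ?Q xs) (lcomb ?Q xs) + 0 * l2inner M (lcomb ?Q xs) (lcomb ?Q xs)"
    by (rule l2inner_lcomb_linear) (auto simp: aff_L2[OF t] aff_inner(2)[OF t] algebra_simps power2_eq_square)
  then have "(l2norm M (lcomb ?G xs))\<^sup>2 = (l2norm M (lcomb ?Q xs))\<^sup>2"
    by (simp add: l2inner_self del: of_real_power)
  then show ?thesis by simp
qed

text \<open>For \<open>P = X - g\<close> and \<open>Q = \<i> * (X - 2 * D) - h\<close>, the inner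
  product of \<open>P u\<close> with \<open>Q u\<close> minus that of \<open>Q u\<close> with
  \<open>P u\<close> is \<open>- 2 * \<i> * A t\<close> times the squared norm of \<open>u\<close>;
  the real shifts \<open>g\<close> and \<open>h\<close> cancel. The Cauchy-Schwarz inequality bounds
  both inner products, and its factor 2 cancels the one of the commutator.\<close>

lemma span_uncertainty:
  assumes t: "t \<in> I"
  shows "A t * (l2norm M (lcomb (\<lambda>c. expm X A c t) xs))\<^sup>2 \<le>
    l2norm M (lcomb (\<lambda>c. aff t c (- complex_of_real g) 1) xs) *
    l2norm M (lcomb (\<lambda>c. aff t (- \<i> * c) (- complex_of_real h) 1) xs)"
proof -
  let ?P = "\<lambda>c. aff t c (- complex_of_real g) 1"
  let ?Q = "\<lambda>c. aff t c (- 2 * \<i> * c * complex_of_real (A t) - complex_of_real h) \<i>"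
  have "l2inner M (lcomb ?P xs) (lcomb ?Q xs) = l2inner M (lcomb ?Q xs) (lcomb ?P xs)
      + (- 2 * \<i> * complex_of_real (A t)) * l2inner M (lcomb (\<lambda>c. aff t c 1 0) xs) (lcomb (\<lambda>c. aff t c 1 0) xs)"
    by (rule l2inner_lcomb_linear) (auto simp: aff_L2[OF t] aff_inner(2)[OF t] algebra_simps power2_eq_square)
  then have "2 * \<i> * complex_of_real (A t * (l2norm M (lcomb (\<lambda>c. expm X A c t) xs))\<^sup>2) =
      l2inner M (lcomb ?Q xs) (lcomb ?P xs) - l2inner M (lcomb ?P xs) (lcomb ?Q xs)"
    unfolding l2inner_self expm_aff by simp
  then have "cmod (2 * \<i> * complex_of_real (A t * (l2norm M (lcomb (\<lambda>c. expm X A c t) xs))\<^sup>2)) \<le>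
      cmod (l2inner M (lcomb ?Q xs) (lcomb ?P xs)) + cmod (l2inner M (lcomb ?P xs) (lcomb ?Q xs))"
    by (simp only: norm_triangle_ineq4)
  also have "\<dots> \<le> 2 * (l2norm M (lcomb ?P xs) * l2norm M (lcomb ?Q xs))"
    using l2inner_Cauchy_Schwarz[of "lcomb ?P xs" M "lcomb ?Q xs"] l2inner_Cauchy_Schwarz[of "lcomb ?Q xs" M "lcomb ?P xs"]
    by (simp add: lcomb_L2 aff_L2[OF t] mult.commute)
  also have "cmod (2 * \<i> * complex_of_real (A t * (l2norm M (lcomb (\<lambda>c. expm X A c t) xs))\<^sup>2)) =
      2 * (A t * (l2norm M (lcomb (\<lambda>c. expm X A c t) xs))\<^sup>2)"
    using A_nonneg[of t] by (simp add: norm_mult norm_power)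
  finally show ?thesis unfolding l2norm_fourier_X[OF t] by simp
qed

text \<open>Put \<open>C = X - D\<close>. Multiplication by \<open>X\<close> is
  \<open>D + C\<close>, and after the Fourier transform it has the norm of
  \<open>\<i> * C - \<i> * D\<close>. By \<open>l2norm_creation\<close> the norm of
  \<open>C u\<close> is at most that of \<open>D u\<close> plus \<open>sqrt (A t)\<close> times that
  of \<open>u\<close>, so the same bound \<open>B\<close> serves both sides.\<close>

lemma span_X_bound:
  fixes xs :: "(complex \<times> complex) list"
  assumes t: "t \<in> I"
  defines "B \<equiv> 2 * l2norm M (lcomb (\<lambda>c. aff t c (c * complex_of_real (A t)) 0) xs) + sqrt (A t) * l2norm M (lcomb (\<lambda>c. expm X A c t) xs)"
  shows "l2norm M (lcomb (\<lambda>c. aff t c 0 1) xs) \<le> B" "l2norm M (lcomb (\<lambda>c. aff t (- \<i> * c) 0 1) xs) \<le> B"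
proof -
  let ?D = "lcomb (\<lambda>c. aff t c (c * complex_of_real (A t)) 0) xs"
  let ?C = "lcomb (\<lambda>c. aff t c (- c * complex_of_real (A t)) 1) xs"
  let ?U = "lcomb (\<lambda>c. expm X A c t) xs"
  have L: "?D \<in> L2 M" "?C \<in> L2 M" by (auto intro!: lcomb_L2 aff_L2 t)
  have C: "l2norm M ?C \<le> l2norm M ?D + sqrt (A t) * l2norm M ?U"
  proof (rule power2_le_imp_le)
    show "(l2norm M ?C)\<^sup>2 \<le> (l2norm M ?D + sqrt (A t) * l2norm M ?U)\<^sup>2"
      unfolding l2norm_creation[OF t] using A_nonneg[of t] by (simp add: power2_sum power_mult_distrib)
  qed (simp add: A_nonneg)
  have "l2norm M (lcomb (\<lambda>c. aff t c 0 1) xs) = l2norm M (\<lambda>\<omega>. ?D \<omega> + ?C \<omega>)"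
    by (intro arg_cong[where f = "l2norm M"] ext lcomb_add) (simp add: aff_def algebra_simps)
  also have "\<dots> \<le> l2norm M ?D + l2norm M ?C" by (rule l2norm_triangle[OF L])
  finally show "l2norm M (lcomb (\<lambda>c. aff t c 0 1) xs) \<le> B" using C by (simp add: B_def)
  have Q: "lcomb (\<lambda>c. aff t c (- 2 * \<i> * c * complex_of_real (A t)) \<i>) xs \<omega> = \<i> * ?C \<omega> + (- \<i>) * ?D \<omega>" for \<omega>
  proof -
    let ?G = "\<lambda>c \<omega>. \<i> * aff t c (- c * complex_of_real (A t)) 1 \<omega>"
    let ?H = "\<lambda>c \<omega>. (- \<i>) * aff t c (c * complex_of_real (A t)) 0 \<omega>"
    have "lcomb (\<lambda>c. aff t c (- 2 * \<i> * c * complex_of_real (A t)) \<i>) xs \<omega> = lcomb ?G xs \<omega> + lcomb ?H xs \<omega>"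
      by (rule lcomb_add) (simp add: aff_def algebra_simps)
    also have "lcomb ?G xs \<omega> = \<i> * ?C \<omega>" by (rule lcomb_scale) (rule refl)
    also have "lcomb ?H xs \<omega> = (- \<i>) * ?D \<omega>" by (rule lcomb_scale) (rule refl)
    finally show ?thesis .
  qed
  have "l2norm M (lcomb (\<lambda>c. aff t (- \<i> * c) 0 1) xs) = l2norm M (lcomb (\<lambda>c. aff t c (- 2 * \<i> * c * complex_of_real (A t)) \<i>) xs)"
    using l2norm_fourier_X[OF t, of 0 xs] by (simp only: of_real_0 minus_zero diff_zero)
  also have "\<dots> = l2norm M (\<lambda>\<omega>. \<i> * ?C \<omega> + (- \<i>) * ?D \<omega>)"
    by (intro arg_cong[where f = "l2norm M"] ext Q)
  also have "\<dots> \<le> l2norm M (\<lambda>\<omega>. \<i> * ?C \<omega>) + l2norm M (\<lambda>\<omega>. (- \<i>) * ?D \<omega>)"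
    by (rule l2norm_triangle) (intro L2_cmult L)+
  also have "\<dots> = l2norm M ?C + l2norm M ?D" unfolding l2norm_cmult by simp
  finally show "l2norm M (lcomb (\<lambda>c. aff t (- \<i> * c) 0 1) xs) \<le> B" using C by (simp add: B_def)
qed

text \<open>The sequences \<open>u\<close>, \<open>d\<close> come from the closure of
  \<open>D\<close> at time \<open>t\<close>, and \<open>u'\<close>, \<open>v'\<close> from the
  closure of the Fourier transform. All estimates run along \<open>u\<close> and its termwise
  transform \<open>v\<close>, which has the same limit \<open>Y'\<close> as
  \<open>v'\<close>.\<close>

lemma uncertainty_at:
  fixes g h :: real
  assumes t: "t \<in> I" and Yd: "Y \<in> dom_D M X A t" and G: "(Y, Y') \<in> G_graph M I X A"
  shows "(\<lambda>\<omega>. complex_of_real (X t \<omega> - g) * Y \<omega>) \<in> L2 M" (is ?t1)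
    and "(\<lambda>\<omega>. complex_of_real (X t \<omega> - h) * Y' \<omega>) \<in> L2 M" (is ?t2)
    and "A t * (l2norm M Y)\<^sup>2 \<le> l2norm M (\<lambda>\<omega>. complex_of_real (X t \<omega> - g) * Y \<omega>) * l2norm M (\<lambda>\<omega>. complex_of_real (X t \<omega> - h) * Y' \<omega>)" (is ?t3)
proof -
  let ?a = "complex_of_real (A t)"
  let ?E = "\<lambda>c. expm X A c t" and ?F = "\<lambda>c. expm X A (- \<i> * c) t" and ?D = "\<lambda>c. aff t c (c * ?a) 0"
  let ?E2 = "\<lambda>(c, s). expm X A c s" and ?F2 = "\<lambda>(c, s). expm X A (- \<i> * c) s"
  obtain Z u d where ud: "\<And>n. (u n, d n) \<in> D0_graph X A t" and u: "l2conv M u Y" and d: "l2conv M d Z"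
    using Yd unfolding dom_D_def D_graph_def by auto
  have "\<exists>xs. u n = lcomb ?E xs \<and> d n = lcomb ?D xs" for n
  proof -
    obtain m a c where e: "u n = (\<lambda>\<omega>. \<Sum>i<(m::nat). a i * expm X A (c i) t \<omega>)"
      "d n = (\<lambda>\<omega>. \<Sum>i<m. a i * c i * ?a * expm X A (c i) t \<omega>)"
      using ud[of n] unfolding D0_graph_def by auto
    have "u n = lcomb ?E (map (\<lambda>i. (a i, c i)) [0..<m])" unfolding lcomb_upt e(1) ..
    moreover have "d n = lcomb ?D (map (\<lambda>i. (a i, c i)) [0..<m])" unfolding lcomb_upt e(2) by (simp add: aff_def mult.assoc)
    ultimately show ?thesis by blast
  qed
  then obtain xs where xs: "\<And>n. u n = lcomb ?E (xs n)" "\<And>n. d n = lcomb ?D (xs n)" by metis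
  obtain u' v' where uv: "\<And>n. (u' n, v' n) \<in> G0_graph I X A" and u': "l2conv M u' Y" and v': "l2conv M v' Y'"
    using G unfolding G_graph_def by auto
  have "\<exists>ys. u' n = lcomb ?E2 ys \<and> v' n = lcomb ?F2 ys \<and> (\<forall>y\<in>set ys. snd (snd y) \<in> I)" for n
  proof -
    obtain m a c s where e: "u' n = (\<lambda>\<omega>. \<Sum>i<(m::nat). a i * expm X A (c i) (s i) \<omega>)"
      "v' n = (\<lambda>\<omega>. \<Sum>i<m. a i * expm X A (- \<i> * c i) (s i) \<omega>)" "\<forall>i<m. s i \<in> I"
      using uv[of n] unfolding G0_graph_def by auto
    have "u' n = lcomb ?E2 (map (\<lambda>i. (a i, (c i, s i))) [0..<m])" unfolding lcomb_upt e(1) by simp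
    moreover have "v' n = lcomb ?F2 (map (\<lambda>i. (a i, (c i, s i))) [0..<m])" unfolding lcomb_upt e(2) by simp
    moreover have "\<forall>y\<in>set (map (\<lambda>i. (a i, (c i, s i))) [0..<m]). snd (snd y) \<in> I" using e(3) by auto
    ultimately show ?thesis by blast
  qed
  then obtain ys where ys: "\<And>n. u' n = lcomb ?E2 (ys n)" "\<And>n. v' n = lcomb ?F2 (ys n)" "\<And>n y. y \<in> set (ys n) \<Longrightarrow> snd (snd y) \<in> I" by metis
  define v where "v n = lcomb ?F (xs n)" for n
  have vL: "v n \<in> L2 M" for n unfolding v_def by (intro lcomb_L2 expm_L2 t)
  have uL: "u n \<in> L2 M" "u' n \<in> L2 M" "v' n \<in> L2 M" "Y \<in> L2 M" "Y' \<in> L2 M" "d n \<in> L2 M" for n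
    using u u' v' d by (auto simp: l2conv_def)
  have v: "l2conv M v Y'"
  proof -
    have eq: "l2norm M (\<lambda>\<omega>. v n \<omega> - v' n \<omega>) = l2norm M (\<lambda>\<omega>. u n \<omega> - u' n \<omega>)" for n
    proof -
      \<comment> \<open>Joins \<open>u n\<close> and the negative of \<open>u' n\<close> into one
        combination over mixed times, so that the isometry carries their distance over to
        \<open>v n\<close> and \<open>v' n\<close>.\<close>
      define zs where "zs = map (\<lambda>x. (fst x, (snd x, t))) (xs n) @ lneg (ys n)"
      have m: "lcomb H (map (\<lambda>x. (fst x, (snd x, t))) l) = lcomb (\<lambda>c. H (c, t)) l" for H :: "complex \<times> real \<Rightarrow> 'a \<Rightarrow> complex" and l
        by (rule ext) (simp add: lcomb_def o_def)
      have "l2norm M (lcomb ?F2 zs) = l2norm M (lcomb ?E2 zs)"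
        by (rule l2norm_fourier) (use ys(3) t in \<open>auto simp: zs_def lneg_def\<close>)
      moreover have "lcomb ?F2 zs = (\<lambda>\<omega>. v n \<omega> - v' n \<omega>)" "lcomb ?E2 zs = (\<lambda>\<omega>. u n \<omega> - u' n \<omega>)"
        unfolding zs_def by (rule ext, simp add: lcomb_diff m v_def xs ys)+
      ultimately show ?thesis by simp
    qed
    have t0: "(\<lambda>n. l2norm M (\<lambda>\<omega>. u n \<omega> - Y \<omega>) + l2norm M (\<lambda>\<omega>. u' n \<omega> - Y \<omega>) + l2norm M (\<lambda>\<omega>. v' n \<omega> - Y' \<omega>)) \<longlonglongrightarrow> 0 + 0 + 0"
      using u u' v' by (intro tendsto_add) (auto simp: l2conv_iff_l2norm)
    have le: "l2norm M (\<lambda>\<omega>. v n \<omega> - Y' \<omega>) \<le> l2norm M (\<lambda>\<omega>. u n \<omega> - Y \<omega>) + l2norm M (\<lambda>\<omega>. u' n \<omega> - Y \<omega>) + l2norm M (\<lambda>\<omega>. v' n \<omega> - Y' \<omega>)" for n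
      using l2norm_triangle_diff[OF vL[of n] uL(3)[of n] uL(5)] l2norm_triangle_diff[OF uL(1)[of n] uL(4) uL(2)[of n]]
      by (simp add: eq l2norm_minus_commute[of M Y])
    have "(\<lambda>n. l2norm M (\<lambda>\<omega>. v n \<omega> - Y' \<omega>)) \<longlonglongrightarrow> 0"
      by (rule tendsto_sandwich[OF _ _ tendsto_const]) (use t0 le in auto)
    then show ?thesis using vL uL by (simp add: l2conv_iff_l2norm)
  qed
  have XM: "(\<lambda>\<omega>. complex_of_real (X t \<omega>)) \<in> borel_measurable M" using X_M[OF t] by measurable
  \<comment> \<open>Stated for differences of approximants, these bounds yield the Cauchy condition
    that \<open>l2conv_mult_closed\<close> asks for, along \<open>u\<close> and along
    \<open>v\<close> with the same right-hand side.\<close>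
  have bound: "l2norm M (lcomb (\<lambda>c. aff t c 0 1) (xs n @ lneg (xs m))) \<le> 2 * l2norm M (\<lambda>\<omega>. d n \<omega> - d m \<omega>) + sqrt (A t) * l2norm M (\<lambda>\<omega>. u n \<omega> - u m \<omega>)"
    "l2norm M (lcomb (\<lambda>c. aff t (- \<i> * c) 0 1) (xs n @ lneg (xs m))) \<le> 2 * l2norm M (\<lambda>\<omega>. d n \<omega> - d m \<omega>) + sqrt (A t) * l2norm M (\<lambda>\<omega>. u n \<omega> - u m \<omega>)" for n m
    using span_X_bound[OF t, of "xs n @ lneg (xs m)"] unfolding lcomb_diff[abs_def] xs by auto
  have small: "\<exists>N. \<forall>m\<ge>N. \<forall>n\<ge>N. 2 * l2norm M (\<lambda>\<omega>. d n \<omega> - d m \<omega>) + sqrt (A t) * l2norm M (\<lambda>\<omega>. u n \<omega> - u m \<omega>) < e" if e: "e > 0" for e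
  proof -
    have s0: "0 \<le> sqrt (A t)" by (simp add: A_nonneg)
    define e' where "e' = e / (2 + sqrt (A t))"
    have e': "e' > 0" using e s0 by (simp add: e'_def add_pos_nonneg)
    obtain N1 where N1: "\<forall>m\<ge>N1. \<forall>n\<ge>N1. l2norm M (\<lambda>\<omega>. d n \<omega> - d m \<omega>) < e'" using l2conv_Cauchy[OF d e'] by blast
    obtain N2 where N2: "\<forall>m\<ge>N2. \<forall>n\<ge>N2. l2norm M (\<lambda>\<omega>. u n \<omega> - u m \<omega>) < e'" using l2conv_Cauchy[OF u e'] by blast
    have "2 * l2norm M (\<lambda>\<omega>. d n \<omega> - d m \<omega>) + sqrt (A t) * l2norm M (\<lambda>\<omega>. u n \<omega> - u m \<omega>) < e" if "m \<ge> max N1 N2" "n \<ge> max N1 N2" for m n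
    proof -
      have "2 * l2norm M (\<lambda>\<omega>. d n \<omega> - d m \<omega>) < 2 * e'" using N1 that by simp
      moreover have "sqrt (A t) * l2norm M (\<lambda>\<omega>. u n \<omega> - u m \<omega>) \<le> sqrt (A t) * e'"
        using N2 that s0 by (intro mult_left_mono) (auto intro: less_imp_le)
      moreover have "2 * e' + sqrt (A t) * e' = e"
      proof -
        have "2 + sqrt (A t) \<noteq> 0" using s0 by linarith
        then have "(2 + sqrt (A t)) * e' = e" by (simp add: e'_def)
        then show ?thesis by (simp only: distrib_right)
      qed
      ultimately show ?thesis by linarith
    qed
    then show ?thesis by blast
  qed
  have Xu: "(\<lambda>\<omega>. complex_of_real (X t \<omega>) * u n \<omega>) = lcomb (\<lambda>c. aff t c 0 1) (xs n)" for n
    by (rule ext) (simp add: lcomb_aff[where f = "\<lambda>c. c"] xs)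
  have Xv: "(\<lambda>\<omega>. complex_of_real (X t \<omega>) * v n \<omega>) = lcomb (\<lambda>c. aff t (- \<i> * c) 0 1) (xs n)" for n
    unfolding lcomb_aff[where f = "\<lambda>c. - \<i> * c", abs_def] v_def by simp
  have cXu: "l2conv M (\<lambda>n \<omega>. complex_of_real (X t \<omega>) * u n \<omega>) (\<lambda>\<omega>. complex_of_real (X t \<omega>) * Y \<omega>)"
  proof (rule l2conv_mult_closed[OF u XM])
    show "(\<lambda>\<omega>. complex_of_real (X t \<omega>) * u n \<omega>) \<in> L2 M" for n unfolding Xu by (intro lcomb_L2 aff_L2 t)
    show "\<exists>N. \<forall>m\<ge>N. \<forall>n\<ge>N. l2norm M (\<lambda>\<omega>. complex_of_real (X t \<omega>) * u n \<omega> - complex_of_real (X t \<omega>) * u m \<omega>) < e" if "e > 0" for e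
    proof -
      have "(\<lambda>\<omega>. complex_of_real (X t \<omega>) * u n \<omega> - complex_of_real (X t \<omega>) * u m \<omega>) = lcomb (\<lambda>c. aff t c 0 1) (xs n @ lneg (xs m))" for n m
        unfolding lcomb_diff[abs_def] Xu[symmetric] ..
      note eq = this
      obtain N where N: "\<forall>m\<ge>N. \<forall>n\<ge>N. 2 * l2norm M (\<lambda>\<omega>. d n \<omega> - d m \<omega>) + sqrt (A t) * l2norm M (\<lambda>\<omega>. u n \<omega> - u m \<omega>) < e"
        using small[OF \<open>e > 0\<close>] by blast
      show ?thesis unfolding eq
        by (intro exI[of _ N] allI impI order.strict_trans1[OF bound(1)]) (use N in blast)
    qed
  qed
  have cXv: "l2conv M (\<lambda>n \<omega>. complex_of_real (X t \<omega>) * v n \<omega>) (\<lambda>\<omega>. complex_of_real (X t \<omega>) * Y' \<omega>)"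
  proof (rule l2conv_mult_closed[OF v XM])
    show "(\<lambda>\<omega>. complex_of_real (X t \<omega>) * v n \<omega>) \<in> L2 M" for n unfolding Xv by (intro lcomb_L2 aff_L2 t)
    show "\<exists>N. \<forall>m\<ge>N. \<forall>n\<ge>N. l2norm M (\<lambda>\<omega>. complex_of_real (X t \<omega>) * v n \<omega> - complex_of_real (X t \<omega>) * v m \<omega>) < e" if "e > 0" for e
    proof -
      have "(\<lambda>\<omega>. complex_of_real (X t \<omega>) * v n \<omega> - complex_of_real (X t \<omega>) * v m \<omega>) = lcomb (\<lambda>c. aff t (- \<i> * c) 0 1) (xs n @ lneg (xs m))" for n m
        unfolding lcomb_diff[abs_def] Xv[symmetric] ..
      note eq = this
      obtain N where N: "\<forall>m\<ge>N. \<forall>n\<ge>N. 2 * l2norm M (\<lambda>\<omega>. d n \<omega> - d m \<omega>) + sqrt (A t) * l2norm M (\<lambda>\<omega>. u n \<omega> - u m \<omega>) < e"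
        using small[OF \<open>e > 0\<close>] by blast
      show ?thesis unfolding eq
        by (intro exI[of _ N] allI impI order.strict_trans1[OF bound(2)]) (use N in blast)
    qed
  qed
  have c1: "l2conv M (\<lambda>n. lcomb (\<lambda>c. aff t c (- complex_of_real g) 1) (xs n)) (\<lambda>\<omega>. complex_of_real (X t \<omega> - g) * Y \<omega>)"
    using l2conv_diff[OF cXu l2conv_cmult[OF u, of "complex_of_real g"]]
    unfolding lcomb_aff[where f = "\<lambda>c. c", abs_def] xs by (simp add: algebra_simps)
  have c2: "l2conv M (\<lambda>n. lcomb (\<lambda>c. aff t (- \<i> * c) (- complex_of_real h) 1) (xs n)) (\<lambda>\<omega>. complex_of_real (X t \<omega> - h) * Y' \<omega>)"
    using l2conv_diff[OF cXv l2conv_cmult[OF v, of "complex_of_real h"]]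
    unfolding lcomb_aff[where f = "\<lambda>c. - \<i> * c", abs_def] v_def by (simp add: algebra_simps)
  show ?t1 ?t2 using c1 c2 by (auto simp: l2conv_def)
  show ?t3
  proof (rule LIMSEQ_le)
    show "(\<lambda>n. A t * (l2norm M (u n))\<^sup>2) \<longlonglongrightarrow> A t * (l2norm M Y)\<^sup>2"
      by (intro tendsto_intros l2conv_l2norm u)
    show "(\<lambda>n. l2norm M (lcomb (\<lambda>c. aff t c (- complex_of_real g) 1) (xs n)) * l2norm M (lcomb (\<lambda>c. aff t (- \<i> * c) (- complex_of_real h) 1) (xs n)))
      \<longlonglongrightarrow> l2norm M (\<lambda>\<omega>. complex_of_real (X t \<omega> - g) * Y \<omega>) * l2norm M (\<lambda>\<omega>. complex_of_real (X t \<omega> - h) * Y' \<omega>)"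
      by (intro tendsto_mult l2conv_l2norm c1 c2)
    show "\<exists>N. \<forall>n\<ge>N. A t * (l2norm M (u n))\<^sup>2 \<le> l2norm M (lcomb (\<lambda>c. aff t c (- complex_of_real g) 1) (xs n)) * l2norm M (lcomb (\<lambda>c. aff t (- \<i> * c) (- complex_of_real h) 1) (xs n))"
      unfolding xs using span_uncertainty[OF t] by blast
  qed
qed

end

section \<open>The Ito isometry\<close>

lemma simple_val_zero:
  fixes \<tau> :: "nat \<Rightarrow> real"
  assumes "\<And>i. i < n \<Longrightarrow> \<tau> i \<le> \<tau> (Suc i)" "t > \<tau> n"
  shows "(\<Sum>i<n. f i * indicator {\<tau> i<..\<tau> (Suc i)} t :: 'b::semiring_1) = 0"
proof (rule sum.neutral, safe)
  fix i assume i: "i < n"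
  have "\<tau> (Suc i) \<le> \<tau> n" by (rule grid_mono[of n]) (use i assms(1) in auto)
  then show "f i * indicator {\<tau> i<..\<tau> (Suc i)} t = 0" using assms(2) by simp
qed

text \<open>The intervals are disjoint, so at each \<open>t\<close> at most one summand is nonzero
  and squaring creates no cross terms.\<close>

lemma cmod_simple_val_sq:
  assumes "\<And>i. i < n \<Longrightarrow> \<tau> i \<le> \<tau> (Suc i)"
  shows "(cmod (simple_val n \<tau> \<xi> t \<omega>))\<^sup>2 = (\<Sum>i<n. (cmod (\<xi> i \<omega>))\<^sup>2 * indicator {\<tau> i<..\<tau> (Suc i)} t)"
  using assms
proof (induction n)
  case (Suc n)
  have IH: "(cmod (simple_val n \<tau> \<xi> t \<omega>))\<^sup>2 = (\<Sum>i<n. (cmod (\<xi> i \<omega>))\<^sup>2 * indicator {\<tau> i<..\<tau> (Suc i)} t)"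
    by (rule Suc.IH) (use Suc.prems in simp)
  have step: "simple_val (Suc n) \<tau> \<xi> t \<omega> = simple_val n \<tau> \<xi> t \<omega> + \<xi> n \<omega> * indicator {\<tau> n<..\<tau> (Suc n)} t"
    by (simp add: simple_val_def)
  show ?case
  proof (cases "t > \<tau> n")
    case True
    have z: "simple_val n \<tau> \<xi> t \<omega> = 0" "(\<Sum>i<n. (cmod (\<xi> i \<omega>))\<^sup>2 * indicator {\<tau> i<..\<tau> (Suc i)} t) = 0"
      unfolding simple_val_def by (rule simple_val_zero; use Suc.prems True in simp)+
    show ?thesis by (simp add: step z split: split_indicator)
  next
    case False
    then show ?thesis using IH by (simp add: step)
  qed
qed (simp add: simple_val_def)

section \<open>Simple integrands and the passage to the limit\<close>

context det_qv_martingale begin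

abbreviation "\<nu> \<equiv> interval_measure A"

lemma A_right_cont: "continuous (at_right a) A"
  using A_cont by (meson UNIV_I continuous_on_eq_continuous_within continuous_within_subset subset_UNIV)

lemma nu_Ioc: "a \<le> b \<Longrightarrow> emeasure \<nu> {a<..b} = ennreal (A b - A a)"
  by (rule emeasure_interval_measure_Ioc) (auto intro: A_right_cont monoD[OF A_mono])

lemma nu_sigma_finite: "sigma_finite_measure \<nu>"
  by (rule sigma_finite_interval_measure) (auto intro: A_right_cont monoD[OF A_mono])

text \<open>This is \<open>integral_incr_square\<close> for the weight
  \<open>(cmod (\<xi> \<omega>))^2\<close>, which is bounded by \<open>B^2\<close>.\<close>

lemma bounded_incr_L2:
  assumes st: "s \<in> I" "t \<in> I" "s \<le> t" and \<xi>: "\<xi> \<in> borel_measurable (F s)" and B: "\<And>\<omega>. \<omega> \<in> space M \<Longrightarrow> cmod (\<xi> \<omega>) \<le> B"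
  shows "(\<lambda>\<omega>. \<xi> \<omega> * complex_of_real (X t \<omega> - X s \<omega>)) \<in> L2 M"
    and "(\<integral>\<omega>. (cmod (\<xi> \<omega> * complex_of_real (X t \<omega> - X s \<omega>)))\<^sup>2 \<partial>M) = (\<integral>\<omega>. (cmod (\<xi> \<omega>))\<^sup>2 \<partial>M) * (A t - A s)"
proof -
  have [measurable]: "\<xi> \<in> borel_measurable M" using measurable_F_M st \<xi> by blast
  note [measurable] = X_M[OF st(1)] X_M[OF st(2)]
  have \<eta>: "(\<lambda>\<omega>. complex_of_real ((cmod (\<xi> \<omega>))\<^sup>2)) \<in> borel_measurable (F s)" using \<xi> by measurable
  have bd: "cmod (complex_of_real ((cmod (\<xi> \<omega>))\<^sup>2)) \<le> B\<^sup>2" if "\<omega> \<in> space M" for \<omega>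
    using power_mono[OF B[OF that], of 2] by (simp add: norm_power)
  note r = integral_incr_square[OF st \<eta> bd]
  have eq: "complex_of_real ((cmod (\<xi> \<omega>))\<^sup>2) * complex_of_real ((X t \<omega> - X s \<omega>)\<^sup>2) =
      complex_of_real ((cmod (\<xi> \<omega> * complex_of_real (X t \<omega> - X s \<omega>)))\<^sup>2)" for \<omega>
    by (simp add: norm_mult power_mult_distrib del: of_real_diff of_real_power flip: of_real_mult)
  show "(\<lambda>\<omega>. \<xi> \<omega> * complex_of_real (X t \<omega> - X s \<omega>)) \<in> L2 M"
    using integrable_Re[OF r(1)[unfolded eq]] by (simp add: L2_def)
  show "(\<integral>\<omega>. (cmod (\<xi> \<omega> * complex_of_real (X t \<omega> - X s \<omega>)))\<^sup>2 \<partial>M) = (\<integral>\<omega>. (cmod (\<xi> \<omega>))\<^sup>2 \<partial>M) * (A t - A s)"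
    using r(2)[unfolded eq] unfolding integral_complex_of_real of_real_mult[symmetric] of_real_eq_iff .
qed

text \<open>Everything except the later increment is known at time \<open>t\<close>, and it is
  square integrable because \<open>\<zeta>\<close> is bounded; hence
  \<open>integral_incr_zero\<close> applies.\<close>

lemma incr_orthogonal:
  assumes st: "s \<in> I" "s' \<in> I" "s \<le> s'" "t \<in> I" "t' \<in> I" "t \<le> t'" "s' \<le> t"
    and \<xi>: "\<xi> \<in> borel_measurable (F s)" and B: "\<And>\<omega>. \<omega> \<in> space M \<Longrightarrow> cmod (\<xi> \<omega>) \<le> B"
    and \<zeta>: "\<zeta> \<in> borel_measurable (F t)" and C: "\<And>\<omega>. \<omega> \<in> space M \<Longrightarrow> cmod (\<zeta> \<omega>) \<le> C"
  shows "l2inner M (\<lambda>\<omega>. \<xi> \<omega> * complex_of_real (X s' \<omega> - X s \<omega>)) (\<lambda>\<omega>. \<zeta> \<omega> * complex_of_real (X t' \<omega> - X t \<omega>)) = 0"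
proof -
  have "s \<le> t" using st by linarith
  note [measurable] = measurable_F_mono[OF st(1,4) this \<xi>] \<zeta> measurable_F_mono[OF st(2,4,7) X_F[OF st(2)]]
     measurable_F_mono[OF st(1,4) \<open>s \<le> t\<close> X_F[OF st(1)]]
  let ?\<eta> = "\<lambda>\<omega>. \<xi> \<omega> * complex_of_real (X s' \<omega> - X s \<omega>) * cnj (\<zeta> \<omega>)"
  have \<eta>: "?\<eta> \<in> borel_measurable (F t)" by measurable
  have "integrable M (\<lambda>\<omega>. (cmod (?\<eta> \<omega>))\<^sup>2)"
  proof (rule Bochner_Integration.integrable_bound)
    show "integrable M (\<lambda>\<omega>. (cmod (\<xi> \<omega> * complex_of_real (X s' \<omega> - X s \<omega>)))\<^sup>2 * C\<^sup>2)"
      using bounded_incr_L2(1)[OF st(1-3) \<xi> B] by (intro integrable_mult_left) (simp add: L2_def)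
    show "(\<lambda>\<omega>. (cmod (?\<eta> \<omega>))\<^sup>2) \<in> borel_measurable M" using measurable_F_M[OF st(4) \<eta>] by measurable
    have "(cmod (?\<eta> \<omega>))\<^sup>2 \<le> (cmod (\<xi> \<omega> * complex_of_real (X s' \<omega> - X s \<omega>)))\<^sup>2 * C\<^sup>2" if "\<omega> \<in> space M" for \<omega>
    proof -
      have "(cmod (?\<eta> \<omega>))\<^sup>2 = (cmod (\<xi> \<omega> * complex_of_real (X s' \<omega> - X s \<omega>)))\<^sup>2 * (cmod (\<zeta> \<omega>))\<^sup>2"
        by (simp only: norm_mult complex_mod_cnj power_mult_distrib)
      then show ?thesis using power_mono[OF C[OF that], of 2] by (simp only:) (auto intro: mult_left_mono)
    qed
    then show "AE \<omega> in M. norm ((cmod (?\<eta> \<omega>))\<^sup>2) \<le> norm ((cmod (\<xi> \<omega> * complex_of_real (X s' \<omega> - X s \<omega>)))\<^sup>2 * C\<^sup>2)"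
      by (intro AE_I2) (simp only: real_norm_def abs_power2 abs_mult power2_abs)
  qed
  from integral_incr_zero(2)[OF st(4-6) \<eta> this]
  show ?thesis unfolding l2inner_def by (simp add: mult.assoc mult.left_commute)
qed

text \<open>In \<open>M\<close> the cross terms vanish by orthogonality of the increments, in time
  by disjointness of the intervals. The diagonal terms agree because \<open>\<nu>\<close> gives
  \<open>{a<..b}\<close> the mass \<open>A b - A a\<close>. Vanishing outside \<open>I\<close> lets
  a time integral over \<open>I\<close> be read as one over the whole line.\<close>

lemma simple_isometry:
  assumes I [measurable]: "I \<in> sets borel" and sp: "simple_proc M I F n \<tau> \<xi>"
  shows "(\<lambda>(\<omega>, t). simple_val n \<tau> \<xi> t \<omega>) \<in> L2 (M \<Otimes>\<^sub>M \<nu>)"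
    and "l2norm (M \<Otimes>\<^sub>M \<nu>) (\<lambda>(\<omega>, t). simple_val n \<tau> \<xi> t \<omega>) = l2norm M (simple_int X n \<tau> \<xi>)"
    and "t \<notin> I \<Longrightarrow> simple_val n \<tau> \<xi> t \<omega> = 0"
proof -
  interpret \<nu>: sigma_finite_measure \<nu> by (rule nu_sigma_finite)
  have \<tau>: "\<tau> i < \<tau> (Suc i)" "\<tau> i \<in> I" "\<tau> (Suc i) \<in> I" "\<tau> i \<le> \<tau> (Suc i)" if "i < n" for i
    using sp that less_imp_le unfolding simple_proc_def by (auto simp: Suc_le_eq)
  have \<xi>: "\<xi> i \<in> borel_measurable (F (\<tau> i))" if "i < n" for i using sp that unfolding simple_proc_def by auto
  obtain B where B: "\<And>i \<omega>. i < n \<Longrightarrow> \<omega> \<in> space M \<Longrightarrow> cmod (\<xi> i \<omega>) \<le> B i"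
    using sp unfolding simple_proc_def by metis
  have \<xi>M [measurable]: "\<xi> i \<in> borel_measurable M" if "i < n" for i using measurable_F_M[OF \<tau>(2) \<xi>] that by blast
  have sub: "{\<tau> i<..\<tau> (Suc i)} \<subseteq> I" if "i < n" for i
    using I_Icc[OF \<tau>(2,3)[OF that]] by auto
  show "t \<notin> I \<Longrightarrow> simple_val n \<tau> \<xi> t \<omega> = 0" for t \<omega>
    unfolding simple_val_def
  proof (rule sum.neutral, safe)
    fix i assume "t \<notin> I" "i < n"
    then have "t \<notin> {\<tau> i<..\<tau> (Suc i)}" using sub by blast
    then show "\<xi> i \<omega> * indicator {\<tau> i<..\<tau> (Suc i)} t = 0" by simp
  qed
  let ?F = "\<lambda>i \<omega>. \<xi> i \<omega> * complex_of_real (X (\<tau> (Suc i)) \<omega> - X (\<tau> i) \<omega>)"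
  have FL: "?F i \<in> L2 M" if "i < n" for i
    by (rule bounded_incr_L2(1)[OF \<tau>(2,3,4) \<xi> B]) (use that in auto)
  have orth: "l2inner M (?F i) (?F j) = 0" if "i < j" "j < n" for i j
  proof -
    have "\<tau> (Suc i) \<le> \<tau> j" by (rule grid_mono[of n]) (use \<tau> that in auto)
    with that show ?thesis
      by (intro incr_orthogonal[where B = "B i" and C = "B j"]) (use \<tau> \<xi> B in auto)
  qed
  have orth': "l2inner M (?F i) (?F j) = (if i = j then complex_of_real ((\<integral>\<omega>. (cmod (\<xi> i \<omega>))\<^sup>2 \<partial>M) * (A (\<tau> (Suc i)) - A (\<tau> i))) else 0)"
    if "i < n" "j < n" for i j
  proof -
    consider "i < j" | "j < i" | "i = j" by linarith
    then show ?thesis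
    proof cases
      case 1 then show ?thesis using orth that by simp
    next
      case 2
      then show ?thesis using orth[of j i] that l2inner_cnj[of M "?F j" "?F i"] by simp
    next
      case 3
      have "l2inner M (?F i) (?F i) = complex_of_real ((\<integral>\<omega>. (cmod (\<xi> i \<omega>))\<^sup>2 \<partial>M) * (A (\<tau> (Suc i)) - A (\<tau> i)))"
        unfolding l2inner_self l2norm_sq
        by (subst bounded_incr_L2(2)[OF \<tau>(2,3,4) \<xi> B]) (use that in auto)
      then show ?thesis using 3 by simp
    qed
  qed
  have si: "simple_int X n \<tau> \<xi> = (\<lambda>\<omega>. \<Sum>i\<leftarrow>[0..<n]. ?F i \<omega>)"
    by (rule ext) (simp add: simple_int_def interv_sum_list_conv_sum_set_nat lessThan_atLeast0)
  have "complex_of_real ((l2norm M (simple_int X n \<tau> \<xi>))\<^sup>2) = (\<Sum>i\<leftarrow>[0..<n]. \<Sum>j\<leftarrow>[0..<n]. l2inner M (?F i) (?F j))"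
    unfolding l2inner_self[symmetric] si by (rule l2inner_sum_list) (use FL in auto)
  also have "\<dots> = (\<Sum>i\<in>{..<n}. \<Sum>j\<in>{..<n}. l2inner M (?F i) (?F j))"
    by (simp add: interv_sum_list_conv_sum_set_nat lessThan_atLeast0)
  also have "\<dots> = (\<Sum>i\<in>{..<n}. \<Sum>j\<in>{..<n}. if i = j then complex_of_real ((\<integral>\<omega>. (cmod (\<xi> i \<omega>))\<^sup>2 \<partial>M) * (A (\<tau> (Suc i)) - A (\<tau> i))) else 0)"
    using orth' by (intro sum.cong refl) auto
  also have "\<dots> = complex_of_real (\<Sum>i<n. (\<integral>\<omega>. (cmod (\<xi> i \<omega>))\<^sup>2 \<partial>M) * (A (\<tau> (Suc i)) - A (\<tau> i)))"
    by (simp add: sum.delta')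
  finally have nJ: "(l2norm M (simple_int X n \<tau> \<xi>))\<^sup>2 = (\<Sum>i<n. (\<integral>\<omega>. (cmod (\<xi> i \<omega>))\<^sup>2 \<partial>M) * (A (\<tau> (Suc i)) - A (\<tau> i)))"
    unfolding of_real_eq_iff .
  let ?H = "\<lambda>(\<omega>, t). simple_val n \<tau> \<xi> t \<omega>"
  have Hm: "?H \<in> borel_measurable (M \<Otimes>\<^sub>M \<nu>)"
    unfolding simple_val_def case_prod_beta by (intro borel_measurable_sum) measurable
  have \<alpha>0: "0 \<le> A (\<tau> (Suc i)) - A (\<tau> i)" if "i < n" for i using monoD[OF A_mono \<tau>(4)[OF that]] by simp
  have \<xi>2: "integrable M (\<lambda>\<omega>. (cmod (\<xi> i \<omega>))\<^sup>2)" if "i < n" for i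
    by (rule integrable_const_bound[of _ "(B i)\<^sup>2"]) (use B that in \<open>auto intro!: power_mono\<close>)
  have nn: "(\<integral>\<^sup>+z. ennreal ((cmod (?H z))\<^sup>2) \<partial>(M \<Otimes>\<^sub>M \<nu>)) = ennreal ((l2norm M (simple_int X n \<tau> \<xi>))\<^sup>2)"
  proof -
    have "(\<integral>\<^sup>+z. ennreal ((cmod (?H z))\<^sup>2) \<partial>(M \<Otimes>\<^sub>M \<nu>)) = (\<integral>\<^sup>+\<omega>. (\<integral>\<^sup>+t. ennreal ((cmod (simple_val n \<tau> \<xi> t \<omega>))\<^sup>2) \<partial>\<nu>) \<partial>M)"
      using Hm by (subst \<nu>.nn_integral_fst[symmetric]) auto
    also have "\<dots> = (\<integral>\<^sup>+\<omega>. ennreal (\<Sum>i<n. (cmod (\<xi> i \<omega>))\<^sup>2 * (A (\<tau> (Suc i)) - A (\<tau> i))) \<partial>M)"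
    proof (rule nn_integral_cong)
      fix \<omega>
      have "(\<integral>\<^sup>+t. ennreal ((cmod (simple_val n \<tau> \<xi> t \<omega>))\<^sup>2) \<partial>\<nu>)
         = (\<integral>\<^sup>+t. (\<Sum>i<n. ennreal ((cmod (\<xi> i \<omega>))\<^sup>2) * indicator {\<tau> i<..\<tau> (Suc i)} t) \<partial>\<nu>)"
      proof (rule nn_integral_cong)
        fix t
        have "ennreal ((cmod (simple_val n \<tau> \<xi> t \<omega>))\<^sup>2) = (\<Sum>i<n. ennreal ((cmod (\<xi> i \<omega>))\<^sup>2 * indicator {\<tau> i<..\<tau> (Suc i)} t))"
          by (subst cmod_simple_val_sq) (use \<tau> in auto)
        also have "\<dots> = (\<Sum>i<n. ennreal ((cmod (\<xi> i \<omega>))\<^sup>2) * indicator {\<tau> i<..\<tau> (Suc i)} t)"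
          by (intro sum.cong refl) (auto split: split_indicator)
        finally show "ennreal ((cmod (simple_val n \<tau> \<xi> t \<omega>))\<^sup>2) = \<dots>" .
      qed
      also have "\<dots> = (\<Sum>i<n. ennreal ((cmod (\<xi> i \<omega>))\<^sup>2) * ennreal (A (\<tau> (Suc i)) - A (\<tau> i)))"
        by (subst nn_integral_sum) (auto simp: nn_integral_cmult_indicator nu_Ioc \<tau>)
      also have "\<dots> = ennreal (\<Sum>i<n. (cmod (\<xi> i \<omega>))\<^sup>2 * (A (\<tau> (Suc i)) - A (\<tau> i)))"
        using \<alpha>0 by (subst sum_ennreal[symmetric]) (auto simp: ennreal_mult)
      finally show "(\<integral>\<^sup>+t. ennreal ((cmod (simple_val n \<tau> \<xi> t \<omega>))\<^sup>2) \<partial>\<nu>) = \<dots>" .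
    qed
    also have "\<dots> = ennreal (\<integral>\<omega>. (\<Sum>i<n. (cmod (\<xi> i \<omega>))\<^sup>2 * (A (\<tau> (Suc i)) - A (\<tau> i))) \<partial>M)"
      using \<xi>2 \<alpha>0 by (intro nn_integral_eq_integral) (auto intro!: sum_nonneg)
    also have "(\<integral>\<omega>. (\<Sum>i<n. (cmod (\<xi> i \<omega>))\<^sup>2 * (A (\<tau> (Suc i)) - A (\<tau> i))) \<partial>M) = (l2norm M (simple_int X n \<tau> \<xi>))\<^sup>2"
      unfolding nJ using \<xi>2 by (subst Bochner_Integration.integral_sum) auto
    finally show ?thesis .
  qed
  have Hi: "integrable (M \<Otimes>\<^sub>M \<nu>) (\<lambda>z. (cmod (?H z))\<^sup>2)"
    by (rule integrableI_bounded) (use Hm nn in auto)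
  show "?H \<in> L2 (M \<Otimes>\<^sub>M \<nu>)" using Hm Hi by (simp add: L2_def)
  have "(l2norm (M \<Otimes>\<^sub>M \<nu>) ?H)\<^sup>2 = (l2norm M (simple_int X n \<tau> \<xi>))\<^sup>2"
    using nn nn_integral_eq_integral[OF Hi] unfolding l2norm_sq[of "M \<Otimes>\<^sub>M \<nu>"]
    by (simp add: ennreal_inj[OF Bochner_Integration.integral_nonneg zero_le_power2])
  then show "l2norm (M \<Otimes>\<^sub>M \<nu>) ?H = l2norm M (simple_int X n \<tau> \<xi>)" by simp
qed

text \<open>The simple integrands converge in the product space and their integrals converge in
  \<open>M\<close>. As the norms agree for each simple integrand, the two limiting norms agree by
  uniqueness of limits.\<close>

lemma ito_isometry:
  assumes I [measurable]: "I \<in> sets borel" and ito: "ito_integral M I F X A H J"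
  shows "(\<integral>\<^sup>+\<omega>. (\<integral>\<^sup>+t\<in>I. ennreal ((cmod (H t \<omega>))\<^sup>2) \<partial>\<nu>) \<partial>M) = (\<integral>\<^sup>+\<omega>. ennreal ((cmod (J \<omega>))\<^sup>2) \<partial>M)"
proof -
  interpret \<nu>: sigma_finite_measure \<nu> by (rule nu_sigma_finite)
  let ?N = "M \<Otimes>\<^sub>M \<nu>"
  have sN: "sets (M \<Otimes>\<^sub>M \<nu>) = sets (M \<Otimes>\<^sub>M borel)" by (rule sets_pair_measure_cong) auto
  have Hm: "(\<lambda>(\<omega>, t). H t \<omega>) \<in> borel_measurable ?N"
    using ito unfolding ito_integral_def by (simp add: measurable_cong_sets[OF sN refl])
  obtain n \<tau> \<xi> where sp: "\<And>k. simple_proc M I F (n k) (\<tau> k) (\<xi> k)"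
    and lim: "(\<lambda>k. \<integral>\<^sup>+\<omega>. (\<integral>\<^sup>+t\<in>I. ennreal ((cmod (simple_val (n k) (\<tau> k) (\<xi> k) t \<omega> - H t \<omega>))\<^sup>2) \<partial>\<nu>) \<partial>M) \<longlonglongrightarrow> 0"
    and J: "l2conv M (\<lambda>k. simple_int X (n k) (\<tau> k) (\<xi> k)) J"
    using ito unfolding ito_integral_def by auto
  define S where "S k = (\<lambda>(\<omega>, t). simple_val (n k) (\<tau> k) (\<xi> k) t \<omega>)" for k
  \<comment> \<open>The cut-off by \<open>I\<close> turns the integral over \<open>I\<close> into
    the full norm on the product space.\<close>
  define H' where "H' = (\<lambda>(\<omega>, t). indicator I t * H t \<omega>)"
  note iso = simple_isometry[OF I sp, folded S_def]
  have H'm [measurable]: "H' \<in> borel_measurable ?N" unfolding H'_def using Hm by (simp add: case_prod_beta)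
  note [measurable] = L2_D(1)[OF iso(1)]
  have d: "(\<integral>\<^sup>+\<omega>. (\<integral>\<^sup>+t\<in>I. ennreal ((cmod (simple_val (n k) (\<tau> k) (\<xi> k) t \<omega> - H t \<omega>))\<^sup>2) \<partial>\<nu>) \<partial>M)
      = (\<integral>\<^sup>+z. ennreal ((cmod (S k z - H' z))\<^sup>2) \<partial>?N)" for k
  proof -
    have "(\<integral>\<^sup>+z. ennreal ((cmod (S k z - H' z))\<^sup>2) \<partial>?N) = (\<integral>\<^sup>+\<omega>. (\<integral>\<^sup>+t. ennreal ((cmod (S k (\<omega>, t) - H' (\<omega>, t)))\<^sup>2) \<partial>\<nu>) \<partial>M)"
      by (rule \<nu>.nn_integral_fst[symmetric]) measurable
    also have "\<dots> = (\<integral>\<^sup>+\<omega>. (\<integral>\<^sup>+t\<in>I. ennreal ((cmod (simple_val (n k) (\<tau> k) (\<xi> k) t \<omega> - H t \<omega>))\<^sup>2) \<partial>\<nu>) \<partial>M)"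
      by (intro nn_integral_cong) (auto simp: S_def H'_def simple_isometry(3)[OF I sp] split: split_indicator)
    finally show ?thesis by simp
  qed
  \<comment> \<open>An extended integral that tends to 0 may still be infinite for small
    \<open>k\<close>. From \<open>K\<close> on it is below 1, so the sequences are shifted by
    \<open>K\<close>, and \<open>H'\<close> is square integrable as a difference of a simple
    integrand and one such error.\<close>
  have "eventually (\<lambda>k. (\<integral>\<^sup>+z. ennreal ((cmod (S k z - H' z))\<^sup>2) \<partial>?N) < 1) sequentially"
    using order_tendstoD(2)[OF lim[unfolded d]] by simp
  then obtain K where K: "\<And>k. k \<ge> K \<Longrightarrow> (\<integral>\<^sup>+z. ennreal ((cmod (S k z - H' z))\<^sup>2) \<partial>?N) < 1"
    by (auto simp: eventually_sequentially)
  have dL: "(\<lambda>z. S (k + K) z - H' z) \<in> L2 ?N" for k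
  proof -
    have "integrable ?N (\<lambda>z. (cmod (S (k + K) z - H' z))\<^sup>2)"
      by (rule integrableI_bounded) (use K[of "k + K"] in \<open>auto intro: order.strict_trans\<close>)
    then show ?thesis by (simp add: L2_def)
  qed
  have H'L: "H' \<in> L2 ?N" using L2_diff[OF iso(1)[of "0 + K"] dL[of 0]] by simp
  have "(\<lambda>k. ennreal (\<integral>z. (cmod (S (k + K) z - H' z))\<^sup>2 \<partial>?N)) \<longlonglongrightarrow> ennreal 0"
    using LIMSEQ_ignore_initial_segment[OF lim[unfolded d], of K] nn_integral_eq_integral[OF L2_D(2)[OF dL]] by simp
  then have "(\<lambda>k. \<integral>z. (cmod (S (k + K) z - H' z))\<^sup>2 \<partial>?N) \<longlonglongrightarrow> 0"
    by (subst (asm) tendsto_ennreal_iff) auto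
  then have "l2conv ?N (\<lambda>k. S (k + K)) H'" using iso(1) H'L by (simp add: l2conv_def)
  from l2conv_l2norm[OF this] have "(\<lambda>k. l2norm M (simple_int X (n (k + K)) (\<tau> (k + K)) (\<xi> (k + K)))) \<longlonglongrightarrow> l2norm ?N H'"
    by (simp add: iso(2))
  moreover have "(\<lambda>k. l2norm M (simple_int X (n (k + K)) (\<tau> (k + K)) (\<xi> (k + K)))) \<longlonglongrightarrow> l2norm M J"
    using LIMSEQ_ignore_initial_segment[OF l2conv_l2norm[OF J], of K] .
  ultimately have eq: "l2norm ?N H' = l2norm M J" by (rule LIMSEQ_unique)
  have JL: "J \<in> L2 M" using J by (simp add: l2conv_def)
  have "(\<integral>\<^sup>+\<omega>. (\<integral>\<^sup>+t\<in>I. ennreal ((cmod (H t \<omega>))\<^sup>2) \<partial>\<nu>) \<partial>M) = (\<integral>\<^sup>+\<omega>. (\<integral>\<^sup>+t. ennreal ((cmod (H' (\<omega>, t)))\<^sup>2) \<partial>\<nu>) \<partial>M)"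
    by (intro nn_integral_cong) (auto simp: H'_def split: split_indicator)
  also have "\<dots> = (\<integral>\<^sup>+z. ennreal ((cmod (H' z))\<^sup>2) \<partial>?N)"
    by (rule \<nu>.nn_integral_fst) measurable
  also have "\<dots> = ennreal ((l2norm ?N H')\<^sup>2)"
    unfolding l2norm_sq using L2_D(2)[OF H'L] by (intro nn_integral_eq_integral) auto
  also have "\<dots> = (\<integral>\<^sup>+\<omega>. ennreal ((cmod (J \<omega>))\<^sup>2) \<partial>M)"
    unfolding eq l2norm_sq using L2_D(2)[OF JL] by (intro nn_integral_eq_integral[symmetric]) auto
  finally show ?thesis .
qed

lemma nn_integral_l2norm: "f \<in> L2 M \<Longrightarrow> (\<integral>\<^sup>+\<omega>. ennreal ((cmod (f \<omega>))\<^sup>2) \<partial>M) = ennreal ((l2norm M f)\<^sup>2)"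
  unfolding l2norm_sq by (intro nn_integral_eq_integral L2_D(2)) auto

end

text \<open>The squared form in the extended nonnegative reals makes finiteness of the time integral
  part of the conclusion, since \<open>J1\<close> and \<open>J2\<close> are square integrable by
  \<open>ito_integral\<close>. \<open>GY t\<close> is a chosen representative of the transform of
  \<open>Y t\<close>; joint measurability enters through the second integrand.\<close>

theorem mainTheorem13:
  fixes M :: "'a measure" and I :: "real set" and T :: real
    and F :: "real \<Rightarrow> 'a measure" and X :: "real \<Rightarrow> 'a \<Rightarrow> real" and A :: "real \<Rightarrow> real"
    and Y GY :: "real \<Rightarrow> 'a \<Rightarrow> complex" and g g' :: "real \<Rightarrow> real"
    and J1 J2 :: "'a \<Rightarrow> complex"
  assumes horizon: "(T > 0 \<and> I = {0..T}) \<or> I = {0..}"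
    and setting: "cont_mart_det_qv M I F X A"
    and Y_meas: "(\<lambda>(\<omega>, t). Y t \<omega>) \<in> borel_measurable (M \<Otimes>\<^sub>M borel)"
    and Y_L2: "\<forall>t\<in>I. Y t \<in> L2 M \<and> Y t \<in> borel_measurable (vimage_algebra (space M) (X t) borel)"
    and Y_dom: "\<forall>t\<in>I. Y t \<in> dom_D M X A t \<and> Y t \<in> dom_Dstar M X A t \<and>
                      Y t \<in> dom_D_Dstar M X A t \<and> Y t \<in> dom_Dstar_D M X A t"
    and g_meas: "g \<in> borel_measurable borel" and g'_meas: "g' \<in> borel_measurable borel"
    and GY: "\<forall>t\<in>I. (Y t, GY t) \<in> G_graph M I X A"
    and J1: "ito_integral M I F X A (\<lambda>t \<omega>. complex_of_real (X t \<omega> - g t) * Y t \<omega>) J1"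
    and J2: "ito_integral M I F X A (\<lambda>t \<omega>. complex_of_real (X t \<omega> - g' t) * GY t \<omega>) J2"
  shows "(\<integral>\<^sup>+\<omega>. ennreal ((cmod (J1 \<omega>))\<^sup>2) \<partial>M) * (\<integral>\<^sup>+\<omega>. ennreal ((cmod (J2 \<omega>))\<^sup>2) \<partial>M)
         \<ge> (\<integral>\<^sup>+\<omega>. (\<integral>\<^sup>+t\<in>I. ennreal ((cmod (Y t \<omega>))\<^sup>2 * A t) \<partial>interval_measure A) \<partial>M)\<^sup>2"
proof -
  interpret det_qv_martingale M I F X A
    by unfold_locales (use horizon setting in auto)
  have I [measurable]: "I \<in> sets borel" using horizon by auto
  interpret \<nu>: sigma_finite_measure \<nu> by (rule nu_sigma_finite)
  interpret P: pair_sigma_finite M \<nu> ..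
  have sN: "sets (M \<Otimes>\<^sub>M \<nu>) = sets (M \<Otimes>\<^sub>M borel)" by (rule sets_pair_measure_cong) auto
  define H1 where "H1 t \<omega> = complex_of_real (X t \<omega> - g t) * Y t \<omega>" for t \<omega>
  define H2 where "H2 t \<omega> = complex_of_real (X t \<omega> - g' t) * GY t \<omega>" for t \<omega>
  have meas: "(\<lambda>(\<omega>, t). H1 t \<omega>) \<in> borel_measurable (M \<Otimes>\<^sub>M \<nu>)" "(\<lambda>(\<omega>, t). H2 t \<omega>) \<in> borel_measurable (M \<Otimes>\<^sub>M \<nu>)"
      "(\<lambda>(\<omega>, t). Y t \<omega>) \<in> borel_measurable (M \<Otimes>\<^sub>M \<nu>)"
    using J1 J2 Y_meas unfolding ito_integral_def H1_def H2_def by (simp_all add: measurable_cong_sets[OF sN refl])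
  have A_borel [measurable]: "A \<in> borel_measurable borel" using A_cont by (rule borel_measurable_continuous_onI)
  \<comment> \<open>Tonelli on the product of \<open>M\<close> and \<open>\<nu>\<close>: the
    inequality is known for each fixed time, so the integration over time has to be the outer
    one.\<close>
  have swap: "(\<integral>\<^sup>+\<omega>. (\<integral>\<^sup>+t\<in>I. f \<omega> t \<partial>\<nu>) \<partial>M) = (\<integral>\<^sup>+t. (\<integral>\<^sup>+\<omega>. f \<omega> t \<partial>M) * indicator I t \<partial>\<nu>)"
    "(\<lambda>t. \<integral>\<^sup>+\<omega>. f \<omega> t \<partial>M) \<in> borel_measurable \<nu>"
    if f: "case_prod f \<in> borel_measurable (M \<Otimes>\<^sub>M \<nu>)" for f :: "'a \<Rightarrow> real \<Rightarrow> ennreal"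
  proof -
    have fI: "(\<lambda>(\<omega>, t). f \<omega> t * indicator I t) \<in> borel_measurable (M \<Otimes>\<^sub>M \<nu>)"
      using f by (simp add: case_prod_beta)
    have fs: "(\<lambda>(t, \<omega>). f \<omega> t) \<in> borel_measurable (\<nu> \<Otimes>\<^sub>M M)"
      using measurable_compose[OF measurable_pair_swap' f] by (simp add: case_prod_beta)
    then show "(\<lambda>t. \<integral>\<^sup>+\<omega>. f \<omega> t \<partial>M) \<in> borel_measurable \<nu>" by (rule borel_measurable_nn_integral)
    have fm: "(\<lambda>\<omega>. f \<omega> t) \<in> borel_measurable M" for t
      using measurable_compose[OF measurable_Pair2'[of t \<nu> M] f] by simp
    have "(\<integral>\<^sup>+\<omega>. (\<integral>\<^sup>+t\<in>I. f \<omega> t \<partial>\<nu>) \<partial>M) = (\<integral>\<^sup>+t. (\<integral>\<^sup>+\<omega>. f \<omega> t * indicator I t \<partial>M) \<partial>\<nu>)"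
      using P.Fubini'[OF fI] by simp
    also have "\<dots> = (\<integral>\<^sup>+t. (\<integral>\<^sup>+\<omega>. f \<omega> t \<partial>M) * indicator I t \<partial>\<nu>)"
      by (intro nn_integral_cong nn_integral_multc[OF fm])
    finally show "(\<integral>\<^sup>+\<omega>. (\<integral>\<^sup>+t\<in>I. f \<omega> t \<partial>\<nu>) \<partial>M) = (\<integral>\<^sup>+t. (\<integral>\<^sup>+\<omega>. f \<omega> t \<partial>M) * indicator I t \<partial>\<nu>)" .
  qed
  have sqm: "case_prod (\<lambda>\<omega> t. ennreal ((cmod (H1 t \<omega>))\<^sup>2)) \<in> borel_measurable (M \<Otimes>\<^sub>M \<nu>)"
      "case_prod (\<lambda>\<omega> t. ennreal ((cmod (H2 t \<omega>))\<^sup>2)) \<in> borel_measurable (M \<Otimes>\<^sub>M \<nu>)"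
      "case_prod (\<lambda>\<omega> t. ennreal ((cmod (Y t \<omega>))\<^sup>2 * A t)) \<in> borel_measurable (M \<Otimes>\<^sub>M \<nu>)"
    using meas by (simp_all add: case_prod_beta)
  define p1 where "p1 t = (\<integral>\<^sup>+\<omega>. ennreal ((cmod (H1 t \<omega>))\<^sup>2) \<partial>M)" for t
  define p2 where "p2 t = (\<integral>\<^sup>+\<omega>. ennreal ((cmod (H2 t \<omega>))\<^sup>2) \<partial>M)" for t
  define r where "r t = (\<integral>\<^sup>+\<omega>. ennreal ((cmod (Y t \<omega>))\<^sup>2 * A t) \<partial>M)" for t
  \<comment> \<open>On \<open>I\<close> this is the norm of \<open>H1 t\<close>. Outside
    \<open>I\<close>, where \<open>p1 t\<close> may be infinite, the indicator sets the value to 0.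
    The detour through \<open>p1\<close> passes measurability in \<open>t\<close> on to
    \<open>s1\<close>.\<close>
  define s1 where "s1 t = ennreal (sqrt (enn2real (p1 t))) * indicator I t" for t
  define s2 where "s2 t = ennreal (sqrt (enn2real (p2 t))) * indicator I t" for t
  have [measurable]: "p1 \<in> borel_measurable \<nu>" "p2 \<in> borel_measurable \<nu>"
    using swap(2)[OF sqm(1)] swap(2)[OF sqm(2)] by (simp_all add: p1_def[abs_def] p2_def[abs_def])
  have key: "r t \<le> s1 t * s2 t" "(s1 t)\<^sup>2 = p1 t" "(s2 t)\<^sup>2 = p2 t" if t: "t \<in> I" for t
  proof -
    have dom: "Y t \<in> dom_D M X A t" "(Y t, GY t) \<in> G_graph M I X A" "Y t \<in> L2 M" using Y_dom GY Y_L2 t by auto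
    have u: "H1 t \<in> L2 M" "H2 t \<in> L2 M" "A t * (l2norm M (Y t))\<^sup>2 \<le> l2norm M (H1 t) * l2norm M (H2 t)"
      unfolding H1_def[abs_def] H2_def[abs_def] by (rule uncertainty_at[OF t dom(1,2)])+
    have p: "p1 t = ennreal ((l2norm M (H1 t))\<^sup>2)" "p2 t = ennreal ((l2norm M (H2 t))\<^sup>2)"
      unfolding p1_def p2_def using u(1,2) by (auto intro!: nn_integral_l2norm)
    have s: "s1 t = ennreal (l2norm M (H1 t))" "s2 t = ennreal (l2norm M (H2 t))"
      using t by (simp_all add: s1_def s2_def p)
    show "(s1 t)\<^sup>2 = p1 t" "(s2 t)\<^sup>2 = p2 t" unfolding s p by (simp_all add: ennreal_power)
    have "r t = ennreal (A t * (l2norm M (Y t))\<^sup>2)"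
    proof -
      have "r t = (\<integral>\<^sup>+\<omega>. ennreal (A t) * ennreal ((cmod (Y t \<omega>))\<^sup>2) \<partial>M)"
        unfolding r_def by (intro nn_integral_cong) (simp add: ennreal_mult[OF A_nonneg] mult.commute)
      also have "\<dots> = ennreal (A t) * (\<integral>\<^sup>+\<omega>. ennreal ((cmod (Y t \<omega>))\<^sup>2) \<partial>M)"
        using L2_D(1)[OF dom(3)] by (intro nn_integral_cmult) measurable
      finally show ?thesis by (simp add: nn_integral_l2norm[OF dom(3)] ennreal_mult[OF A_nonneg])
    qed
    then show "r t \<le> s1 t * s2 t" unfolding s using u(3) by (simp add: ennreal_leI flip: ennreal_mult)
  qed
  have s1_sq: "(s1 t)\<^sup>2 = p1 t * indicator I t" for t
    using key(2)[of t] by (cases "t \<in> I") (simp_all add: s1_def)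
  have s2_sq: "(s2 t)\<^sup>2 = p2 t * indicator I t" for t
    using key(3)[of t] by (cases "t \<in> I") (simp_all add: s2_def)
  have "(\<integral>\<^sup>+\<omega>. (\<integral>\<^sup>+t\<in>I. ennreal ((cmod (Y t \<omega>))\<^sup>2 * A t) \<partial>\<nu>) \<partial>M) = (\<integral>\<^sup>+t. r t * indicator I t \<partial>\<nu>)"
    unfolding r_def by (rule swap(1)[OF sqm(3)])
  also have "\<dots> \<le> (\<integral>\<^sup>+t. s1 t * s2 t \<partial>\<nu>)"
    by (intro nn_integral_mono) (auto simp: key(1) split: split_indicator)
  finally have "(\<integral>\<^sup>+\<omega>. (\<integral>\<^sup>+t\<in>I. ennreal ((cmod (Y t \<omega>))\<^sup>2 * A t) \<partial>\<nu>) \<partial>M)\<^sup>2 \<le> (\<integral>\<^sup>+t. s1 t * s2 t \<partial>\<nu>)\<^sup>2"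
    by (rule power_mono) simp
  also have "\<dots> \<le> (\<integral>\<^sup>+t. (s1 t)\<^sup>2 \<partial>\<nu>) * (\<integral>\<^sup>+t. (s2 t)\<^sup>2 \<partial>\<nu>)"
    by (rule Cauchy_Schwarz_nn_integral) (simp_all add: s1_def[abs_def] s2_def[abs_def])
  also have "(\<integral>\<^sup>+t. (s1 t)\<^sup>2 \<partial>\<nu>) = (\<integral>\<^sup>+t. p1 t * indicator I t \<partial>\<nu>)"
    by (intro nn_integral_cong s1_sq)
  also have "\<dots> = (\<integral>\<^sup>+\<omega>. (\<integral>\<^sup>+t\<in>I. ennreal ((cmod (H1 t \<omega>))\<^sup>2) \<partial>\<nu>) \<partial>M)"
    unfolding p1_def by (rule swap(1)[OF sqm(1), symmetric])
  also have "\<dots> = (\<integral>\<^sup>+\<omega>. ennreal ((cmod (J1 \<omega>))\<^sup>2) \<partial>M)"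
    by (rule ito_isometry[OF I]) (use J1 in \<open>simp add: H1_def[abs_def]\<close>)
  also have "(\<integral>\<^sup>+t. (s2 t)\<^sup>2 \<partial>\<nu>) = (\<integral>\<^sup>+t. p2 t * indicator I t \<partial>\<nu>)"
    by (intro nn_integral_cong s2_sq)
  also have "\<dots> = (\<integral>\<^sup>+\<omega>. (\<integral>\<^sup>+t\<in>I. ennreal ((cmod (H2 t \<omega>))\<^sup>2) \<partial>\<nu>) \<partial>M)"
    unfolding p2_def by (rule swap(1)[OF sqm(2), symmetric])
  also have "\<dots> = (\<integral>\<^sup>+\<omega>. ennreal ((cmod (J2 \<omega>))\<^sup>2) \<partial>M)"
    by (rule ito_isometry[OF I]) (use J2 in \<open>simp add: H2_def[abs_def]\<close>)
  finally show ?thesis .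
qed

end
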